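(* Let $\gamma>0$, let $\mathbf x$ be a zero mean Gaussian $H$-valued random variable, independent of $\mathbf w$, with correlation operator $\mathbf R$ on $H$, i.e. $(\mathbf Rh,k)_H=E(\mathbf x,h)_H(\mathbf x,k)_H$ for all $h,k\in H$, and let $\{\lambda_i\}_{i=1}^\infty$ be the (summable, nonnegative) sequence of eigenvalues of $\mathbf R$, repeated according to multiplicity. Let $\mathbf y=\sqrt\gamma\,\mathbf x+\mathbf w$. Then the least causal mean square error of $\mathbf x$ given $\mathbf y$ is $$\widehat\varepsilon^2(\gamma)=E|\mathbf x-\widehat{\mathbf x}^{\mathbf y}|_H^2=\gamma^{-1}\sum_{i=1}^\infty\log(1+\lambda_i\gamma)=\gamma^{-1}\log\det(I+\gamma\mathbf R),$$ where $\det$ is the Fredholm determinant. If $\mathbf x\in L^2(P;H)$ (zero mean and independent of $\mathbf w$) is only assumed to possess the covariance $\mathbf R$, but not necessarily to be Gaussian, then the right-hand side of this formula yields the least linear causal mean square error of $\mathbf x$ given $\mathbf y$.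
   Context: $(\Theta,\mathcal F,P)$ is a complete probability space; measurability is understood modulo $P$-null sets. $\mathbf w$ is a centered nondegenerate Gaussian random variable with values in a Banach space $\Omega$, law $\mu_{\mathbf w}$, and separable reproducing kernel Hilbert space $H$ densely embedded in $\Omega$; thus $(\Omega,H,\mu_{\mathbf w})$ is an abstract Wiener space, $\Omega^*\subset H\subset\Omega$ densely, and $E\,{}_\Omega\langle\mathbf w,l_1\rangle_{\Omega^*}\,{}_\Omega\langle\mathbf w,l_2\rangle_{\Omega^*}=(l_1,l_2)_H$ for $l_1,l_2\in\Omega^*$. $\{\pi_t\}_{0\le t\le1}$ is a continuous, strictly increasing family of orthogonal projections on $H$ with $\pi_0=0$, $\pi_1=\mathrm{Id}_H$ and $\pi_t\Omega^*\subset\Omega^*$ for all $t$. The filtration induced by $\mathbf y$ is $\mathcal F^{\mathbf y}_t=\sigma({}_\Omega\langle\mathbf y,\pi_t l\rangle_{\Omega^*},\,l\in\Omega^* )$, $0\le t\le1$. An $H$-valued random variable $\mathbf z$ is $(\pi_\cdot,\mathcal F^{\mathbf y}_\cdot)$-adapted if $(\mathbf z,\pi_t l)_H$ is $\mathcal F^{\mathbf y}_t$-measurable for all $t\in[0,1]$, $l\in\Omega^*$. The causal least mean square estimator $\widehat{\mathbf x}^{\mathbf y}$ is the orthogonal projection in $L^2(P;H)$ of $\mathbf x$ on the closed subspace of $(\pi_\cdot,\mathcal F^{\mathbf y}_\cdot)$-adapted elements. The least linear causal mean square error is the infimum of $E|\mathbf x-\mathbf z|_H^2$ over those $\mathbf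 z\in L^2(P;H)$ such that, for all $t\in[0,1]$ and $l\in\Omega^*$, $(\mathbf z,\pi_t l)_H$ belongs to the closed linear span in $L^2(P)$ of $\{{}_\Omega\langle\mathbf y,\pi_t l'\rangle_{\Omega^*}: l'\in\Omega^*\}$. *)

theory Defs
  imports "HOL-Probability.Probability" "HOL-Combinatorics.Permutations"
begin

section \<open>Gaussian random variables and independence\<close>

definition real_centered_gaussian :: "'a measure \<Rightarrow> ('a \<Rightarrow> real) \<Rightarrow> bool" where
  "real_centered_gaussian M X \<longleftrightarrow>
     X \<in> borel_measurable M \<and>
     ((AE \<omega> in M. X \<omega> = 0) \<or>
      (\<exists>\<sigma>>0. distributed M lborel X (\<lambda>r. ennreal (normal_density 0 \<sigma> r))))"

definition centered_gaussian :: "'a measure \<Rightarrow> ('a \<Rightarrow> 'b::real_normed_vector) \<Rightarrow> bool" where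
  "centered_gaussian M X \<longleftrightarrow>
     X \<in> borel_measurable M \<and>
     (\<forall>l :: 'b \<Rightarrow>\<^sub>L real. real_centered_gaussian M (\<lambda>\<omega>. blinfun_apply l (X \<omega>)))"

text \<open>The library's \<open>indep_var\<close> needs both variables to have the same codomain type.\<close>

definition independent_rv ::
  "'a measure \<Rightarrow> ('a \<Rightarrow> 'b::topological_space) \<Rightarrow> ('a \<Rightarrow> 'c::topological_space) \<Rightarrow> bool" where
  "independent_rv M X Y \<longleftrightarrow>
     prob_space.indep_set M {X -` A \<inter> space M | A. A \<in> sets borel}
                            {Y -` B \<inter> space M | B. B \<in> sets borel}"

definition square_integrable :: "'a measure \<Rightarrow> ('a \<Rightarrow> 'b::real_normed_vector) \<Rightarrow> bool" where
  "square_integrable M f \<longleftrightarrow>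
     f \<in> borel_measurable M \<and> integrable M (\<lambda>\<omega>. (norm (f \<omega>))\<^sup>2)"


section \<open>Abstract Wiener space with a resolution of the identity\<close>

text \<open>For the embedding \<open>\<iota>\<close> of \<open>H\<close> into \<open>\<Omega>\<close>, the inclusion of \<open>\<Omega>\<^sup>*\<close> into \<open>H\<close>
  sends \<open>l\<close> to the Riesz representative of \<open>l \<circ> \<iota>\<close>.\<close>

definition dual_embed ::
  "('h::real_inner \<Rightarrow>\<^sub>L 'w::real_normed_vector) \<Rightarrow> ('w \<Rightarrow>\<^sub>L real) \<Rightarrow> 'h" where
  "dual_embed \<iota> l = (THE k. \<forall>h. inner h k = blinfun_apply l (blinfun_apply \<iota> h))"

locale abstract_wiener_space = prob_space M + complete_measure M
  for M :: "'a measure"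
  and \<iota> :: "'h::{real_inner, banach, second_countable_topology} \<Rightarrow>\<^sub>L 'w::banach"
  and w :: "'a \<Rightarrow> 'w" +
  assumes embed_inj: "inj (blinfun_apply \<iota>)"
    and embed_dense: "closure (range (blinfun_apply \<iota>)) = UNIV"
    and dual_dense: "closure (range (dual_embed \<iota>)) = UNIV"
    and gaussian: "centered_gaussian M w"
    and nondegenerate: "\<And>l :: 'w \<Rightarrow>\<^sub>L real. l \<noteq> 0 \<Longrightarrow> \<not> (AE \<omega> in M. blinfun_apply l (w \<omega>) = 0)"
    and covariance: "\<And>l1 l2. (\<integral>\<omega>. blinfun_apply l1 (w \<omega>) * blinfun_apply l2 (w \<omega>) \<partial>M)
                              = inner (dual_embed \<iota> l1) (dual_embed \<iota> l2)"

text \<open>Continuity is in the strong operator topology: a strictly increasing family of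
  orthogonal projections is never continuous in operator norm.\<close>

definition projection_flow ::
  "('h::real_inner \<Rightarrow>\<^sub>L 'w::real_normed_vector) \<Rightarrow> (real \<Rightarrow> 'h \<Rightarrow>\<^sub>L 'h) \<Rightarrow> bool" where
  "projection_flow \<iota> p \<longleftrightarrow>
     (\<forall>t\<in>{0..1}. \<forall>h. p t (p t h) = p t h) \<and>
     (\<forall>t\<in>{0..1}. \<forall>h k. inner (p t h) k = inner h (p t k)) \<and>
     (\<forall>s\<in>{0..1}. \<forall>t\<in>{0..1}. s < t \<longrightarrow> range (blinfun_apply (p s)) \<subset> range (blinfun_apply (p t))) \<and>
     (\<forall>h. continuous_on {0..1} (\<lambda>t. p t h)) \<and>
     (\<forall>h. p 0 h = 0) \<and> (\<forall>h. p 1 h = h) \<and>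
     (\<forall>t\<in>{0..1}. \<forall>l. p t (dual_embed \<iota> l) \<in> range (dual_embed \<iota>))"

text \<open>\<open>dual_proj \<iota> q l\<close> is \<open>q l\<close> regarded again as an element of \<open>\<Omega>\<^sup>*\<close>.\<close>

definition dual_proj ::
  "('h::real_inner \<Rightarrow>\<^sub>L 'w::real_normed_vector) \<Rightarrow> ('h \<Rightarrow>\<^sub>L 'h) \<Rightarrow> ('w \<Rightarrow>\<^sub>L real) \<Rightarrow> ('w \<Rightarrow>\<^sub>L real)" where
  "dual_proj \<iota> q l = (THE l'. dual_embed \<iota> l' = q (dual_embed \<iota> l))"


section \<open>Causal estimation\<close>

text \<open>The null sets are adjoined because measurability is understood modulo null sets.\<close>

definition obs_filtration ::
  "'a measure \<Rightarrow> ('h::real_inner \<Rightarrow>\<^sub>L 'w::real_normed_vector) \<Rightarrow> (real \<Rightarrow> 'h \<Rightarrow>\<^sub>L 'h)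
    \<Rightarrow> ('a \<Rightarrow> 'w) \<Rightarrow> real \<Rightarrow> 'a measure" where
  "obs_filtration M \<iota> p y t =
     sigma (space M)
       ({(\<lambda>\<omega>. blinfun_apply (dual_proj \<iota> (p t) l) (y \<omega>)) -` B \<inter> space M | l B. B \<in> sets borel}
        \<union> null_sets M)"

definition adapted_space ::
  "'a measure \<Rightarrow> ('h::real_inner \<Rightarrow>\<^sub>L 'w::real_normed_vector) \<Rightarrow> (real \<Rightarrow> 'h \<Rightarrow>\<^sub>L 'h)
    \<Rightarrow> ('a \<Rightarrow> 'w) \<Rightarrow> ('a \<Rightarrow> 'h) set" where
  "adapted_space M \<iota> p y =
     {z. square_integrable M z \<and>
         (\<forall>t\<in>{0..1}. \<forall>l. (\<lambda>\<omega>. inner (z \<omega>) (p t (dual_embed \<iota> l)))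
                            \<in> borel_measurable (obs_filtration M \<iota> p y t))}"

text \<open>Elements of \<open>L\<^sup>2(P;H)\<close> are represented by functions, so the projection is a relation;
  it determines \<open>z\<close> up to almost sure equality.\<close>

definition is_L2_projection ::
  "'a measure \<Rightarrow> ('a \<Rightarrow> 'h::real_inner) set \<Rightarrow> ('a \<Rightarrow> 'h) \<Rightarrow> ('a \<Rightarrow> 'h) \<Rightarrow> bool" where
  "is_L2_projection M V x z \<longleftrightarrow>
     z \<in> V \<and> (\<forall>v\<in>V. (\<integral>\<omega>. inner (x \<omega> - z \<omega>) (v \<omega>) \<partial>M) = 0)"

definition is_causal_estimator ::
  "'a measure \<Rightarrow> ('h::real_inner \<Rightarrow>\<^sub>L 'w::real_normed_vector) \<Rightarrow> (real \<Rightarrow> 'h \<Rightarrow>\<^sub>L 'h)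
    \<Rightarrow> ('a \<Rightarrow> 'w) \<Rightarrow> ('a \<Rightarrow> 'h) \<Rightarrow> ('a \<Rightarrow> 'h) \<Rightarrow> bool" where
  "is_causal_estimator M \<iota> p y x xh \<longleftrightarrow> is_L2_projection M (adapted_space M \<iota> p y) x xh"

definition L2_closed_span :: "'a measure \<Rightarrow> ('a \<Rightarrow> real) set \<Rightarrow> ('a \<Rightarrow> real) set" where
  "L2_closed_span M S =
     {f. square_integrable M f \<and>
         (\<forall>\<epsilon>>0. \<exists>F c. finite F \<and> F \<subseteq> S \<and>
            square_integrable M (\<lambda>\<omega>. \<Sum>g\<in>F. c g * g \<omega>) \<and>
            (\<integral>\<omega>. (f \<omega> - (\<Sum>g\<in>F. c g * g \<omega>))\<^sup>2 \<partial>M) < \<epsilon>)}"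

definition linear_causal_space ::
  "'a measure \<Rightarrow> ('h::real_inner \<Rightarrow>\<^sub>L 'w::real_normed_vector) \<Rightarrow> (real \<Rightarrow> 'h \<Rightarrow>\<^sub>L 'h)
    \<Rightarrow> ('a \<Rightarrow> 'w) \<Rightarrow> ('a \<Rightarrow> 'h) set" where
  "linear_causal_space M \<iota> p y =
     {z. square_integrable M z \<and>
         (\<forall>t\<in>{0..1}. \<forall>l. (\<lambda>\<omega>. inner (z \<omega>) (p t (dual_embed \<iota> l)))
            \<in> L2_closed_span M (range (\<lambda>l' \<omega>. blinfun_apply (dual_proj \<iota> (p t) l') (y \<omega>))))}"

definition least_linear_causal_mse ::
  "'a measure \<Rightarrow> ('h::real_inner \<Rightarrow>\<^sub>L 'w::real_normed_vector) \<Rightarrow> (real \<Rightarrow> 'h \<Rightarrow>\<^sub>L 'h)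
    \<Rightarrow> ('a \<Rightarrow> 'w) \<Rightarrow> ('a \<Rightarrow> 'h) \<Rightarrow> real" where
  "least_linear_causal_mse M \<iota> p y x =
     (INF z\<in>linear_causal_space M \<iota> p y. \<integral>\<omega>. (norm (x \<omega> - z \<omega>))\<^sup>2 \<partial>M)"


section \<open>Spectral data\<close>

definition correlation_operator ::
  "'a measure \<Rightarrow> ('a \<Rightarrow> 'h::real_inner) \<Rightarrow> ('h \<Rightarrow>\<^sub>L 'h) \<Rightarrow> bool" where
  "correlation_operator M x R \<longleftrightarrow>
     (\<forall>h k. inner (R h) k = (\<integral>\<omega>. inner (x \<omega>) h * inner (x \<omega>) k \<partial>M))"

text \<open>For compact \<open>R\<close>, whose eigenspaces for nonzero eigenvalues are finite-dimensional: every
  nonzero \<open>\<mu>\<close> occurs as often as its multiplicity (not at all if it is no eigenvalue).  The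
  number of zero entries is left free, so both the padding of finite rank operators by
  zeros and the omission of the kernel are allowed.\<close>

definition eigenvalue_sequence :: "('h::real_normed_vector \<Rightarrow>\<^sub>L 'h) \<Rightarrow> (nat \<Rightarrow> real) \<Rightarrow> bool" where
  "eigenvalue_sequence R lam \<longleftrightarrow>
     (\<forall>\<mu>. \<mu> \<noteq> 0 \<longrightarrow> finite {i. lam i = \<mu>} \<and> card {i. lam i = \<mu>} = dim {h. R h = \<mu> *\<^sub>R h})"

definition orthonormal_basis :: "'h::real_inner set \<Rightarrow> bool" where
  "orthonormal_basis B \<longleftrightarrow>
     pairwise orthogonal B \<and> (\<forall>b\<in>B. norm b = 1) \<and> closure (span B) = UNIV"

definition principal_minor :: "('h::real_inner \<Rightarrow>\<^sub>L 'h) \<Rightarrow> 'h set \<Rightarrow> real" where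
  "principal_minor A S =
     (\<Sum>\<sigma> | \<sigma> permutes S. of_int (sign \<sigma>) * (\<Prod>b\<in>S. inner b (A (\<sigma> b))))"

text \<open>\<open>det (I + A) = \<Sum>\<^sub>k tr (\<Lambda>\<^sup>k A)\<close> for trace class \<open>A\<close>.  In an orthonormal basis \<open>B\<close> of \<open>H\<close>
  the exterior products of the \<open>k\<close>-subsets \<open>S\<close> of \<open>B\<close> form an orthonormal basis of
  \<open>\<Lambda>\<^sup>k H\<close>, with diagonal entries \<open>principal_minor A S\<close> of \<open>\<Lambda>\<^sup>k A\<close>; the sums over all \<open>k\<close> and
  all \<open>k\<close>-subsets are merged into one unconditional sum, which does not depend on \<open>B\<close>.\<close>

definition fredholm_det_one_plus :: "('h::real_inner \<Rightarrow>\<^sub>L 'h) \<Rightarrow> real" where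
  "fredholm_det_one_plus A =
     (THE d. \<forall>B. orthonormal_basis B \<longrightarrow>
        (principal_minor A has_sum d) {S. finite S \<and> S \<subseteq> B})"

end

theory Submission
  imports Defs
begin

text \<open>Write \<open>K = \<gamma> R = \<Sum>\<^sub>i \<phi>\<^sub>i \<otimes> \<phi>\<^sub>i\<close> with orthogonal \<open>\<phi>\<^sub>i\<close> and \<open>|\<phi>\<^sub>i|\<^sup>2 = \<gamma> \<lambda>\<^sub>i\<close>, so that
  \<open>log det (I + K) = \<Sum>\<^sub>i ln (1 + \<gamma> \<lambda>\<^sub>i)\<close>. The best linear estimate of a coordinate
  \<open>(x, e)\<close> from the observations up to time \<open>t\<close> has mean square error \<open>(C\<^sub>t e, e) / \<gamma>\<close>,
  where \<open>C\<^sub>t = K (I + \<pi>\<^sub>t K)\<^sup>-\<^sup>1\<close>. A causal estimator may use for the increment \<open>d\<pi>\<^sub>t\<close> of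
  the signal the observations up to \<open>t\<close> only, so \<open>\<gamma>\<close> times the least error ought to be
  \<open>\<integral> tr (C\<^sub>t d\<pi>\<^sub>t)\<close>. The integrand is the differential of \<open>log det (I + K \<pi>\<^sub>t)\<close>, which
  grows from \<open>0\<close> to \<open>log det (I + K)\<close>.

  The integral is replaced by Riemann sums. Cut \<open>[0, 1]\<close> into \<open>N\<close> blocks, with increments
  \<open>\<Delta>\<^sub>j\<close> of the projections. A causal estimator does not do better than one that sees, for
  block \<open>j\<close>, all observations up to the right end of the block; one that sees those up to
  the left end is causal. Hence \<open>\<gamma>\<close> times the least error lies between the sums of
  \<open>tr (\<Delta>\<^sub>j C\<^sub>t)\<close> with \<open>t\<close> the right ends and with \<open>t\<close> the left ends (\<open>mse_lower_bound\<close>,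
  \<open>mse_upper_bound\<close>). Factor the determinant into pivots, one for each mode \<open>\<phi>\<^sub>i\<close>; by
  concavity of the logarithm its increment over a block lies between the same two
  quantities (\<open>ln_pivot_bounds\<close>, \<open>log_det_bounds\<close>). Finally \<open>(1 - a) C\<^sub>s \<le> C\<^sub>t\<close> for the
  ends \<open>s \<le> t\<close> of a block whenever \<open>a\<close> bounds \<open>tr (\<Delta>\<^sub>j K)\<close> (\<open>error_cov_refinement\<close>), and
  \<open>a\<close> can be made small by strong continuity of the projections (\<open>fine_partition\<close>). So
  the two sums have the common limit \<open>log det (I + K)\<close>.

  For Gaussian \<open>x\<close> the estimators that are measurable functions of the observations gain
  nothing over the linear ones: the residual of the linear estimate is orthogonal to
  \<open>cos \<eta>\<close> and \<open>sin \<eta>\<close> for all observed \<open>\<eta>\<close>, and by uniqueness of Fourier transforms to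
  every square integrable function of the observations (\<open>orthogonal_of_generated\<close>,
  \<open>gaussian_measurable_error\<close>).

  The compression of \<open>I + K\<close> to a finite orthonormal set has as determinant both the
  product of the pivots and the sum of the principal minors of \<open>K\<close>. The principal minors
  are nonnegative and the products of pivots approach \<open>\<Prod>\<^sub>i (1 + \<gamma> \<lambda>\<^sub>i)\<close>, so the minors
  sum to this product in every orthonormal basis (\<open>principal_minor_has_sum\<close>). The
  eigenvectors of \<open>R\<close> come from power iteration (\<open>dominant_eigenvector\<close>), and a Gaussian
  \<open>x\<close> is square integrable by the Paley-Zygmund argument (\<open>gaussian_variances_summable\<close>).\<close>

section \<open>Orthonormal systems and the Riesz representation\<close>

lemma le_of_square_le_mult:
  fixes a b :: real
  assumes "a\<^sup>2 \<le> a * b" "0 \<le> a" "0 \<le> b"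
  shows "a \<le> b"
  using assms by (cases "a = 0") (auto simp: power2_eq_square)

lemma discriminant_bound:
  fixes x y z :: real
  assumes q: "\<And>s t. 0 \<le> s\<^sup>2 * x - 2 * s * t * y + t\<^sup>2 * z"
  shows "y\<^sup>2 \<le> x * z"
proof (cases "z = 0")
  case True
  have "y = 0"
  proof (rule ccontr)
    assume "y \<noteq> 0"
    then show False using q[of 1 "(x + 1) / (2 * y)"] True by simp
  qed
  then show ?thesis using True by simp
next
  case False
  then have "0 < z" using q[of 0 1] by simp
  moreover have "0 \<le> z * (x * z - y\<^sup>2)"
    using q[of z y] by (simp add: power2_eq_square algebra_simps)
  ultimately show ?thesis by (simp add: zero_le_mult_iff)
qed

text \<open>Zero vectors are admitted so that systems indexed by all of \<open>nat\<close> also describe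
  finite-dimensional spaces, and so that Gram-Schmidt need not skip dependent vectors.\<close>

definition orthonormal_or_zero :: "('i \<Rightarrow> 'h::real_inner) \<Rightarrow> 'i set \<Rightarrow> bool" where
  "orthonormal_or_zero e I \<longleftrightarrow>
     (\<forall>i\<in>I. \<forall>j\<in>I. i \<noteq> j \<longrightarrow> inner (e i) (e j) = 0) \<and> (\<forall>i\<in>I. norm (e i) = 1 \<or> e i = 0)"

definition partial_proj :: "('i \<Rightarrow> 'h::real_inner) \<Rightarrow> 'i set \<Rightarrow> 'h \<Rightarrow> 'h" where
  "partial_proj e I h = (\<Sum>i\<in>I. inner h (e i) *\<^sub>R e i)"

lemma orthonormal_or_zero_subset:
  "orthonormal_or_zero e I \<Longrightarrow> J \<subseteq> I \<Longrightarrow> orthonormal_or_zero e J"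
  by (auto simp: orthonormal_or_zero_def)

lemma orthonormal_or_zero_inner_self:
  assumes "orthonormal_or_zero e I" "i \<in> I"
  shows "inner h (e i) * inner (e i) (e i) = inner h (e i)"
  using assms by (auto simp: orthonormal_or_zero_def dot_square_norm)

lemma inner_partial_proj:
  assumes "orthonormal_or_zero e I" "finite I" "i \<in> I"
  shows "inner (partial_proj e I h) (e i) = inner h (e i)"
proof -
  have "inner (partial_proj e I h) (e i) = (\<Sum>j\<in>I. inner h (e j) * inner (e j) (e i))"
    by (simp add: partial_proj_def inner_sum_left)
  also have "\<dots> = (\<Sum>j\<in>I. if j = i then inner h (e i) else 0)"
    using assms orthonormal_or_zero_inner_self[OF assms(1,3)]
    by (intro sum.cong refl) (auto simp: orthonormal_or_zero_def)
  finally show ?thesis using assms by simp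
qed

lemma inner_partial_proj_commute:
  "inner (partial_proj e I h) k = inner h (partial_proj e I k)"
  by (simp add: partial_proj_def inner_sum_left inner_sum_right mult.commute inner_commute)

lemma norm_partial_proj:
  assumes "orthonormal_or_zero e I" "finite I"
  shows "(norm (partial_proj e I h))\<^sup>2 = (\<Sum>i\<in>I. (inner h (e i))\<^sup>2)"
proof -
  let ?q = "partial_proj e I h"
  have "inner ?q ?q = (\<Sum>i\<in>I. inner h (e i) * inner ?q (e i))"
    by (subst (2) partial_proj_def) (simp add: inner_sum_right)
  also have "\<dots> = (\<Sum>i\<in>I. (inner h (e i))\<^sup>2)"
    using inner_partial_proj[OF assms] by (simp add: power2_eq_square)
  finally show ?thesis by (simp add: power2_norm_eq_inner)
qed

lemma norm_diff_partial_proj: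
  assumes "orthonormal_or_zero e I" "finite I"
  shows "(norm (h - partial_proj e I h))\<^sup>2 = (norm h)\<^sup>2 - (\<Sum>i\<in>I. (inner h (e i))\<^sup>2)"
proof -
  let ?q = "partial_proj e I h"
  have a: "inner ?q ?q = (\<Sum>i\<in>I. (inner h (e i))\<^sup>2)"
    using norm_partial_proj[OF assms, of h] by (simp add: power2_norm_eq_inner)
  have b: "inner h ?q = (\<Sum>i\<in>I. (inner h (e i))\<^sup>2)"
    by (simp add: partial_proj_def inner_sum_right power2_eq_square)
  show ?thesis
    using a b by (simp add: power2_norm_eq_inner inner_diff_left inner_diff_right inner_commute)
qed

lemma bessel_inequality:
  assumes "orthonormal_or_zero e I" "finite I"
  shows "(\<Sum>i\<in>I. (inner h (e i))\<^sup>2) \<le> (norm h)\<^sup>2"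
  using norm_diff_partial_proj[OF assms, of h] by (smt (verit) zero_le_power2)

lemma partial_proj_id_on_span:
  assumes "orthonormal_or_zero e I" "finite I" "v \<in> span (e ` I)"
  shows "partial_proj e I v = v"
  using assms(3)
proof (induction rule: span_induct_alt)
  case base
  show ?case by (simp add: partial_proj_def)
next
  case (step c x y)
  then obtain i where i: "i \<in> I" "x = e i" by auto
  have "partial_proj e I x = (\<Sum>j\<in>I. if j = i then x else 0)"
    unfolding partial_proj_def
  proof (intro sum.cong refl)
    fix j assume "j \<in> I"
    then show "inner x (e j) *\<^sub>R e j = (if j = i then x else 0)"
      using assms(1) i by (auto simp: orthonormal_or_zero_def dot_square_norm)
  qed
  then have "partial_proj e I x = x" using i assms(2) by simp
  moreover have "partial_proj e I (c *\<^sub>R x + y) = c *\<^sub>R partial_proj e I x + partial_proj e I y"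
    by (simp add: partial_proj_def inner_add_left scaleR_add_left sum.distrib scaleR_sum_right)
  ultimately show ?case using step by simp
qed

lemma partial_proj_diff:
  "partial_proj e I (a - b) = partial_proj e I a - partial_proj e I b"
  by (simp add: partial_proj_def inner_diff_left scaleR_diff_left sum_subtractf)

text \<open>\<open>h - v\<close> and \<open>h\<close> have the same residual for \<open>v\<close> in the span, and passing to the residual
  does not increase the norm.\<close>

lemma partial_proj_best_approximation:
  assumes "orthonormal_or_zero e I" "finite I" "v \<in> span (e ` I)"
  shows "norm (h - partial_proj e I h) \<le> norm (h - v)"
proof -
  have "(norm ((h - v) - partial_proj e I (h - v)))\<^sup>2 \<le> (norm (h - v))\<^sup>2"
    using norm_diff_partial_proj[OF assms(1,2), of "h - v"] by (simp add: sum_nonneg)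
  moreover have "(h - v) - partial_proj e I (h - v) = h - partial_proj e I h"
    by (simp add: partial_proj_diff partial_proj_id_on_span[OF assms])
  ultimately show ?thesis by (simp add: power2_le_iff_abs_le)
qed

text \<open>Unconditional convergence comes from best approximation: once a finite set supports a
  good approximant of \<open>h\<close>, every larger finite set does at least as well.\<close>

lemma orthonormal_expansion:
  assumes "orthonormal_or_zero e I" "h \<in> closure (span (e ` I))"
  shows "((\<lambda>i. inner h (e i) *\<^sub>R e i) has_sum h) I"
  unfolding has_sum_def
proof (rule tendstoI)
  fix \<epsilon> :: real assume "\<epsilon> > 0"
  with assms(2) obtain v where v: "v \<in> span (e ` I)" "dist v h < \<epsilon>"
    by (meson closure_approachable)
  from v(1) obtain G where G: "finite G" "G \<subseteq> e ` I" "v \<in> span G"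
    by (auto simp: span_explicit intro: span_sum span_scale span_base)
  then obtain F where F: "F \<subseteq> I" "finite F" "G = e ` F"
    by (meson finite_subset_image)
  show "\<forall>\<^sub>F J in finite_subsets_at_top I. dist (\<Sum>i\<in>J. inner h (e i) *\<^sub>R e i) h < \<epsilon>"
    unfolding eventually_finite_subsets_at_top
  proof (intro exI[of _ F] conjI F allI impI)
    fix J assume J: "finite J \<and> F \<subseteq> J \<and> J \<subseteq> I"
    have "v \<in> span (e ` J)" using G F J by (meson image_mono span_mono subsetD)
    then have "norm (h - partial_proj e J h) \<le> norm (h - v)"
      using J assms(1) by (intro partial_proj_best_approximation) (auto intro: orthonormal_or_zero_subset)
    then show "dist (\<Sum>i\<in>J. inner h (e i) *\<^sub>R e i) h < \<epsilon>"
      using v(2) by (simp add: dist_norm partial_proj_def norm_minus_commute)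
  qed
qed

lemma parseval_inner:
  assumes "orthonormal_or_zero e I" "h \<in> closure (span (e ` I))"
  shows "((\<lambda>i. inner h (e i) * inner (e i) k) has_sum inner h k) I"
  using has_sum_bounded_linear[OF bounded_linear_inner_left orthonormal_expansion[OF assms], of k]
  by (simp add: o_def)

lemma parseval:
  assumes "orthonormal_or_zero e I" "h \<in> closure (span (e ` I))"
  shows "((\<lambda>i. (inner h (e i))\<^sup>2) has_sum (norm h)\<^sup>2) I"
  using parseval_inner[OF assms, of h]
  by (simp add: power2_eq_square inner_commute power2_norm_eq_inner[symmetric])

lemma parseval_sums:
  assumes "orthonormal_or_zero e (UNIV :: nat set)" "h \<in> closure (span (range e))"
  shows "(\<lambda>i. (inner h (e i))\<^sup>2) sums (norm h)\<^sup>2"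
  using parseval[OF assms] by (rule has_sum_imp_sums)

text \<open>A vector that depends on its predecessors has residual \<open>0\<close> and \<open>sgn 0 = 0\<close>.\<close>

fun gram_schmidt_seq :: "(nat \<Rightarrow> 'h::real_inner) \<Rightarrow> nat \<Rightarrow> 'h" where
  "gram_schmidt_seq d n =
     sgn (d n - (\<Sum>k<n. inner (d n) (gram_schmidt_seq d k) *\<^sub>R gram_schmidt_seq d k))"

declare gram_schmidt_seq.simps [simp del]

lemma gram_schmidt_seq_orthonormal:
  "orthonormal_or_zero (gram_schmidt_seq d) {..<n}"
proof (induction n)
  case 0
  show ?case by (simp add: orthonormal_or_zero_def)
next
  case (Suc n)
  let ?e = "gram_schmidt_seq d"
  have eq: "?e n = sgn (d n - partial_proj ?e {..<n} (d n))"
    by (subst gram_schmidt_seq.simps) (simp add: partial_proj_def)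
  have "inner (?e n) (?e k) = 0" if "k < n" for k
    using inner_partial_proj[OF Suc finite_lessThan, of k "d n"] that
    by (simp add: eq sgn_div_norm inner_diff_left)
  moreover have "norm (?e n) = 1 \<or> ?e n = 0"
    by (subst (1 2) gram_schmidt_seq.simps) (auto simp: norm_sgn sgn_zero_iff)
  ultimately show ?case using Suc
    by (auto simp: orthonormal_or_zero_def less_Suc_eq inner_commute)
qed

lemma orthonormal_gram_schmidt_seq: "orthonormal_or_zero (gram_schmidt_seq d) UNIV"
proof -
  have "inner (gram_schmidt_seq d i) (gram_schmidt_seq d j) = 0" if "i \<noteq> j" for i j
    using gram_schmidt_seq_orthonormal[of d "Suc (max i j)"] that
    by (simp add: orthonormal_or_zero_def less_Suc_eq_le)
  moreover have "norm (gram_schmidt_seq d i) = 1 \<or> gram_schmidt_seq d i = 0" for i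
    using gram_schmidt_seq_orthonormal[of d "Suc i"] by (simp add: orthonormal_or_zero_def)
  ultimately show ?thesis by (simp add: orthonormal_or_zero_def)
qed

lemma gram_schmidt_seq_spans: "d n \<in> span (range (gram_schmidt_seq d))"
proof -
  let ?e = "gram_schmidt_seq d"
  let ?r = "d n - (\<Sum>k<n. inner (d n) (?e k) *\<^sub>R ?e k)"
  have "norm ?r *\<^sub>R ?e n = ?r"
    by (subst gram_schmidt_seq.simps, cases "?r = 0") (simp_all add: sgn_div_norm)
  then have "d n = norm ?r *\<^sub>R ?e n + (\<Sum>k<n. inner (d n) (?e k) *\<^sub>R ?e k)"
    by (metis diff_add_cancel)
  also have "\<dots> \<in> span (range ?e)"
    by (intro span_add span_scale span_sum span_base) auto
  finally show ?thesis .
qed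

lemma gram_schmidt_seq_in_subspace:
  assumes "subspace S" "\<And>n. d n \<in> S"
  shows "gram_schmidt_seq d n \<in> S"
proof (induction n rule: less_induct)
  case (less n)
  have "d n - (\<Sum>k<n. inner (d n) (gram_schmidt_seq d k) *\<^sub>R gram_schmidt_seq d k) \<in> S"
    using less assms by (intro subspace_diff subspace_sum subspace_scale) auto
  then show ?case
    by (subst gram_schmidt_seq.simps) (auto simp: sgn_div_norm intro: subspace_scale[OF assms(1)])
qed

text \<open>Applied to the identity this yields an orthonormal basis of the whole space, applied to
  an orthogonal projection one of its range: orthonormalise the image of a countable
  dense set.\<close>

lemma orthonormal_system_of_range:
  fixes P :: "'h::{real_inner, second_countable_topology} \<Rightarrow> 'h"
  assumes "bounded_linear P"
  obtains e :: "nat \<Rightarrow> 'h" where "orthonormal_or_zero e UNIV" "\<And>n. e n \<in> range P"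
    "range P \<subseteq> closure (span (range e))"
proof -
  interpret P: bounded_linear P by fact
  obtain D :: "'h set" where D: "countable D" "closure D = UNIV"
  proof -
    obtain D :: "'h set" where "countable D" "\<And>X. open X \<Longrightarrow> X \<noteq> {} \<Longrightarrow> \<exists>d\<in>D. d \<in> X"
      using countable_dense_setE by blast
    moreover have "closure D = UNIV"
    proof -
      have "x \<in> closure D" for x
        unfolding closure_iff_nhds_not_empty
        using \<open>\<And>X. open X \<Longrightarrow> X \<noteq> {} \<Longrightarrow> \<exists>d\<in>D. d \<in> X\<close> by (metis Int_iff empty_iff subsetD)
      then show ?thesis by blast
    qed
    ultimately show thesis using that by blast
  qed
  have "D \<noteq> {}" using D by force
  define d where "d = (\<lambda>n. P (from_nat_into D n))"
  have rd: "range d = P ` D"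
  proof -
    have "range d = P ` range (from_nat_into D)" by (simp add: d_def image_image)
    then show ?thesis by (simp add: range_from_nat_into[OF \<open>D \<noteq> {}\<close> D(1)])
  qed
  let ?e = "gram_schmidt_seq d"
  have "range P \<subseteq> closure (P ` D)"
  proof -
    have "P ` closure D \<subseteq> closure (P ` D)"
    proof (rule image_closure_subset)
      show "continuous_on (closure D) P" by (rule P.continuous_on[OF continuous_on_id])
      show "P ` D \<subseteq> closure (P ` D)" by (rule closure_subset)
    qed simp
    then show ?thesis using D by simp
  qed
  also have "\<dots> \<subseteq> closure (span (range ?e))"
    using gram_schmidt_seq_spans[of d] rd by (intro closure_mono) (metis image_subset_iff range_subsetD subsetI imageE)
  finally have "range P \<subseteq> closure (span (range ?e))" .
  moreover have "?e n \<in> range P" for n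
    by (rule gram_schmidt_seq_in_subspace)
       (auto simp: d_def linear_subspace_image P.linear_axioms)
  ultimately show thesis
    using that[of ?e] orthonormal_gram_schmidt_seq by blast
qed

text \<open>Completeness enters through the series \<open>\<Sum>\<^sub>i f (e\<^sub>i) e\<^sub>i\<close> over an orthonormal basis,
  whose coefficients are square summable because \<open>f\<close> is bounded.\<close>

lemma riesz_representation:
  fixes f :: "'h::{real_inner, banach, second_countable_topology} \<Rightarrow> real"
  assumes "bounded_linear f"
  shows "\<exists>k. \<forall>h. inner h k = f h"
proof -
  interpret f: bounded_linear f by fact
  obtain e :: "nat \<Rightarrow> 'h" where e: "orthonormal_or_zero e UNIV" "closure (span (range e)) = UNIV"
  proof -
    obtain e :: "nat \<Rightarrow> 'h" where "orthonormal_or_zero e UNIV"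
        "range (\<lambda>h::'h. h) \<subseteq> closure (span (range e))"
      using orthonormal_system_of_range[OF bounded_linear_ident] by metis
    then show thesis using that[of e] by auto
  qed
  obtain B where B: "B > 0" "\<And>h. \<bar>f h\<bar> \<le> norm h * B" using f.pos_bounded by auto
  have normS: "(norm (\<Sum>i\<in>F. f (e i) *\<^sub>R e i))\<^sup>2 = (\<Sum>i\<in>F. (f (e i))\<^sup>2)" if "finite F" for F
  proof -
    have "(norm (\<Sum>i\<in>F. f (e i) *\<^sub>R e i))\<^sup>2 =
        (\<Sum>i\<in>F. \<Sum>j\<in>F. f (e i) * f (e j) * inner (e i) (e j))"
      by (simp add: power2_norm_eq_inner inner_sum_left inner_sum_right sum_distrib_left mult_ac inner_commute)
    also have "\<dots> = (\<Sum>i\<in>F. \<Sum>j\<in>F. if j = i then (f (e i))\<^sup>2 else 0)"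
    proof (intro sum.cong refl)
      fix i j
      show "f (e i) * f (e j) * inner (e i) (e j) = (if j = i then (f (e i))\<^sup>2 else 0)"
        using e(1) f.zero unfolding orthonormal_or_zero_def
        by (cases "j = i"; cases "e i = 0") (auto simp: power2_eq_square norm_eq_1)
    qed
    finally show ?thesis using that by simp
  qed
  have bound: "(\<Sum>i\<in>F. (f (e i))\<^sup>2) \<le> B\<^sup>2" if "finite F" for F
  proof -
    let ?v = "\<Sum>i\<in>F. f (e i) *\<^sub>R e i"
    have fv: "f ?v = (\<Sum>i\<in>F. (f (e i))\<^sup>2)"
      by (simp add: f.sum f.scaleR power2_eq_square)
    have "(norm ?v)\<^sup>2 \<le> norm ?v * B"
      using B(2)[of ?v] fv normS[OF that] by simp
    then have "norm ?v \<le> B" by (rule le_of_square_le_mult) (simp_all add: order_less_imp_le[OF B(1)])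
    then have "(norm ?v)\<^sup>2 \<le> B\<^sup>2" by (simp add: power_mono)
    then show ?thesis by (simp only: normS[OF that])
  qed
  have summ: "summable (\<lambda>i. (f (e i))\<^sup>2)"
    using bound by (intro summableI_nonneg_bounded[of _ "B\<^sup>2"]) auto
  have "summable (\<lambda>i. f (e i) *\<^sub>R e i)"
    unfolding summable_Cauchy
  proof (intro allI impI)
    fix \<epsilon> :: real assume "\<epsilon> > 0"
    then obtain N where N: "\<And>m n. m \<ge> N \<Longrightarrow> norm (\<Sum>i=m..<n. (f (e i))\<^sup>2) < \<epsilon>\<^sup>2"
      using summ unfolding summable_Cauchy by (meson zero_less_power)
    have "norm (\<Sum>i=m..<n. f (e i) *\<^sub>R e i) < \<epsilon>" if "m \<ge> N" for m n
    proof -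
      have "(norm (\<Sum>i=m..<n. f (e i) *\<^sub>R e i))\<^sup>2 < \<epsilon>\<^sup>2"
        using normS[of "{m..<n}"] N[OF that, of n] by (simp add: abs_less_iff)
      then show ?thesis using \<open>\<epsilon> > 0\<close> by (simp add: power2_less_imp_less)
    qed
    then show "\<exists>N. \<forall>m\<ge>N. \<forall>n. norm (\<Sum>i=m..<n. f (e i) *\<^sub>R e i) < \<epsilon>" by blast
  qed
  then have s1: "(\<lambda>i. f (e i) *\<^sub>R e i) sums (\<Sum>i. f (e i) *\<^sub>R e i)" (is "_ sums ?k") by (rule summable_sums)
  have "inner h ?k = f h" for h
  proof -
    have "(\<lambda>i. inner h (f (e i) *\<^sub>R e i)) sums inner h ?k"
      using bounded_linear.sums[OF bounded_linear_inner_right s1] .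
    moreover have "(\<lambda>i. f (inner h (e i) *\<^sub>R e i)) sums f h"
      using e by (intro f.sums has_sum_imp_sums orthonormal_expansion) auto
    ultimately show ?thesis
      by (simp add: f.scaleR mult.commute sums_unique2)
  qed
  then show ?thesis by blast
qed

section \<open>Spectral decomposition of positive trace class operators\<close>

text \<open>For positive \<open>A\<close> this says that \<open>A\<close> is of trace class with trace at most \<open>\<tau>\<close>. The bound
  over all finite orthonormal systems does not refer to a basis and passes at once to
  smaller operators.\<close>

definition trace_le :: "('h::real_inner \<Rightarrow>\<^sub>L 'h) \<Rightarrow> real \<Rightarrow> bool" where
  "trace_le A \<tau> \<longleftrightarrow> (\<forall>(e :: nat \<Rightarrow> 'h) F. finite F \<longrightarrow> orthonormal_or_zero e F \<longrightarrow>
     (\<Sum>i\<in>F. inner (A (e i)) (e i)) \<le> \<tau>)"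

locale positive_operator =
  fixes A :: "'h::{real_inner, banach, second_countable_topology} \<Rightarrow>\<^sub>L 'h"
  assumes symmetric: "inner (A h) k = inner h (A k)"
    and nonneg: "0 \<le> inner (A h) h"
begin

lemma cauchy_schwarz: "(inner (A h) k)\<^sup>2 \<le> inner (A h) h * inner (A k) k"
proof (rule discriminant_bound)
  fix s t :: real
  have "inner (A k) h = inner (A h) k" by (subst symmetric) (rule inner_commute)
  then have "inner (A (s *\<^sub>R h - t *\<^sub>R k)) (s *\<^sub>R h - t *\<^sub>R k)
      = s\<^sup>2 * inner (A h) h - 2 * s * t * inner (A h) k + t\<^sup>2 * inner (A k) k"
    by (simp add: blinfun.diff_right blinfun.scaleR_right inner_diff_left inner_diff_right
        power2_eq_square algebra_simps)
  then show "0 \<le> s\<^sup>2 * inner (A h) h - 2 * s * t * inner (A h) k + t\<^sup>2 * inner (A k) k"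
    using nonneg[of "s *\<^sub>R h - t *\<^sub>R k"] by simp
qed

text \<open>This is \<open>A\<^sup>2 \<le> \<parallel>A\<parallel> A\<close>, which makes the Hilbert-Schmidt norm of a contraction finite
  when its trace is.\<close>

lemma norm_sq_le: "(norm (A h))\<^sup>2 \<le> norm A * inner (A h) h"
proof -
  have "inner (A (A h)) (A h) \<le> norm (A (A h)) * norm (A h)" by (rule norm_cauchy_schwarz)
  also have "\<dots> \<le> (norm A * norm (A h)) * norm (A h)" by (intro mult_right_mono norm_blinfun) simp
  finally have X: "inner (A (A h)) (A h) \<le> norm A * (norm (A h))\<^sup>2" by (simp add: power2_eq_square)
  have "((norm (A h))\<^sup>2)\<^sup>2 = (inner (A h) (A h))\<^sup>2" by (simp add: power2_norm_eq_inner)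
  also have "\<dots> \<le> inner (A h) h * inner (A (A h)) (A h)" by (rule cauchy_schwarz)
  also have "\<dots> \<le> inner (A h) h * (norm A * (norm (A h))\<^sup>2)" by (intro mult_left_mono X nonneg)
  finally have "((norm (A h))\<^sup>2)\<^sup>2 \<le> (norm (A h))\<^sup>2 * (norm A * inner (A h) h)" by (simp only: mult_ac)
  then show ?thesis by (rule le_of_square_le_mult) (simp_all add: nonneg)
qed

definition pow :: "nat \<Rightarrow> 'h \<Rightarrow> 'h" where "pow n h = ((blinfun_apply A) ^^ n) h"

lemma pow_simps: "pow 0 h = h" "pow (Suc n) h = A (pow n h)"
  by (simp_all add: pow_def)

lemma pow_add: "pow (m + n) h = pow m (pow n h)"
  by (simp add: pow_def funpow_add)

lemma pow_sym: "inner (pow n h) k = inner h (pow n k)"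
proof (induction n arbitrary: h k)
  case (Suc n)
  have "inner (pow (Suc n) h) k = inner (pow n h) (A k)" by (simp add: pow_simps symmetric)
  also have "\<dots> = inner h (pow n (pow 1 k))" by (simp add: Suc pow_simps)
  finally show ?case by (simp add: pow_add[symmetric])
qed (simp add: pow_simps)

lemma pow_inner: "inner (pow m h) (pow n h) = inner (pow (m + n) h) h"
  by (metis pow_add pow_sym add.commute)

lemma pow_norm_log_convex: "(norm (pow n h))\<^sup>2 \<le> norm (pow (n + n) h) * norm h"
  using norm_cauchy_schwarz[of "pow (n + n) h" h] by (simp add: power2_norm_eq_inner pow_inner)

text \<open>Log-convexity of \<open>n \<mapsto> \<parallel>A\<^sup>n h\<parallel>\<close> is needed along powers of two only, where it follows by
  repeated doubling.\<close>

lemma pow_norm_ge: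
  assumes "norm h = 1"
  shows "norm (A h) ^ (2 ^ m) \<le> norm (pow (2 ^ m) h)"
proof (induction m)
  case 0
  show ?case by (simp add: pow_simps(2)[of 0 h, simplified] pow_simps)
next
  case (Suc m)
  have "norm (A h) ^ (2 ^ Suc m) = (norm (A h) ^ (2 ^ m))\<^sup>2" by (simp add: power_mult[symmetric] mult.commute)
  also have "\<dots> \<le> (norm (pow (2 ^ m) h))\<^sup>2" using Suc by (intro power_mono) auto
  also have "\<dots> \<le> norm (pow (2 ^ m + 2 ^ m) h)" using pow_norm_log_convex[of "2^m" h] assms by simp
  finally show ?case by (simp add: mult_2)
qed

text \<open>Power iteration: \<open>A\<^sup>2\<^sup>k h\<close> converges to a vector fixed by \<open>A\<close>, and it remains to find
  an \<open>h\<close> whose limit is not \<open>0\<close>. If all the limits vanished, the squared Hilbert-Schmidt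
  norms \<open>\<Sum>\<^sub>i \<parallel>A\<^sup>k e\<^sub>i\<parallel>\<^sup>2\<close> would tend to \<open>0\<close> by dominated convergence, the domination
  being the finite trace; but these norms are at least the squared operator norms of
  \<open>A\<^sup>k\<close>, which are \<open>1\<close>.\<close>

lemma dominant_eigenvector_contraction:
  assumes n1: "norm A = 1" and tr: "trace_le A \<tau>"
  obtains v where "v \<noteq> 0" "A v = v"
proof -
  obtain e :: "nat \<Rightarrow> 'h" where e: "orthonormal_or_zero e UNIV" "closure (span (range e)) = UNIV"
  proof -
    obtain e :: "nat \<Rightarrow> 'h" where "orthonormal_or_zero e UNIV"
        "range (\<lambda>h::'h. h) \<subseteq> closure (span (range e))"
      using orthonormal_system_of_range[OF bounded_linear_ident] by metis
    then show thesis using that[of e] by auto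
  qed
  define b where "b = (\<lambda>k h. (norm (pow k h))\<^sup>2)"
  have bin: "b k h = inner (pow (k + k) h) h" for k h
    by (simp add: b_def power2_norm_eq_inner pow_inner)
  have normA: "norm (A h) \<le> norm h" for h using norm_blinfun[of A h] n1 by simp
  have bdec: "b (Suc k) h \<le> b k h" for k h
    using normA[of "pow k h"] by (simp add: b_def pow_simps power_mono)
  then have bmono: "b n h \<le> b m h" if "m \<le> n" for m n h
    using that by (rule lift_Suc_antimono_le[of "\<lambda>k. b k h"])
  have conv: "convergent (\<lambda>k. b k h)" for h
    using decseq_convergent[of "\<lambda>k. b k h" 0] bmono unfolding decseq_def convergent_def
    by (metis b_def zero_le_power2)
  \<comment> \<open>\<open>(A\<^sup>2\<^sup>m h, A\<^sup>2\<^sup>n h) = \<parallel>A\<^sup>m\<^sup>+\<^sup>n h\<parallel>\<^sup>2\<close>, so the distances are second differences of a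
    convergent sequence of norms.\<close>
  have Cau: "Cauchy (\<lambda>k. pow (2 * k) h)" for h
    unfolding Cauchy_def
  proof (intro allI impI)
    fix \<epsilon> :: real assume \<epsilon>: "\<epsilon> > 0"
    have "Cauchy (\<lambda>k. b k h)" using conv by (rule convergent_Cauchy)
    then obtain M where M: "\<And>m n. m \<ge> M \<Longrightarrow> n \<ge> M \<Longrightarrow> dist (b m h) (b n h) < \<epsilon>\<^sup>2 / 2"
      unfolding Cauchy_def using \<epsilon> by (metis half_gt_zero zero_less_power)
    have "dist (pow (2 * m) h) (pow (2 * n) h) < \<epsilon>" if "m \<ge> M" "n \<ge> M" for m n
    proof -
      have "(norm (pow (2 * m) h - pow (2 * n) h))\<^sup>2 = b (2 * m) h - 2 * b (m + n) h + b (2 * n) h"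
      proof -
        have "inner (pow (2 * m) h) (pow (2 * n) h) = b (m + n) h"
          by (simp add: bin pow_inner mult_2 add_ac)
        then show ?thesis
          by (simp add: power2_norm_eq_inner inner_diff_left inner_diff_right b_def
              inner_commute[of "pow (2 * n) h" "pow (2 * m) h"])
      qed
      also have "\<dots> < \<epsilon>\<^sup>2"
      proof -
        have "dist (b (2 * m) h) (b (m + n) h) < \<epsilon>\<^sup>2 / 2" "dist (b (2 * n) h) (b (m + n) h) < \<epsilon>\<^sup>2 / 2"
          by (rule M; use that in linarith)+
        then show ?thesis unfolding dist_real_def by linarith
      qed
      finally show ?thesis using \<epsilon> by (simp add: dist_norm power2_less_imp_less)
    qed
    then show "\<exists>M. \<forall>m\<ge>M. \<forall>n\<ge>M. dist (pow (2 * m) h) (pow (2 * n) h) < \<epsilon>" by blast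
  qed
  define Q where "Q = (\<lambda>h. lim (\<lambda>k. pow (2 * k) h))"
  have Q: "(\<lambda>k. pow (2 * k) h) \<longlonglongrightarrow> Q h" for h
    using Cau[of h] unfolding Q_def by (simp add: Cauchy_convergent_iff convergent_LIMSEQ_iff)
  have AQ: "A (A (Q h)) = Q h" for h
  proof -
    have "(\<lambda>k. A (A (pow (2 * k) h))) \<longlonglongrightarrow> A (A (Q h))" by (intro tendsto_intros Q)
    moreover have "(\<lambda>k. A (A (pow (2 * k) h))) = (\<lambda>k. pow (2 * Suc k) h)" by (simp add: pow_simps)
    moreover have "(\<lambda>k. pow (2 * Suc k) h) \<longlonglongrightarrow> Q h"
      using LIMSEQ_Suc[OF Q[of h]] .
    ultimately show ?thesis using LIMSEQ_unique by metis
  qed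
  \<comment> \<open>The iteration yields \<open>A\<^sup>2 = I\<close> on the limits; positivity excludes the eigenvalue \<open>-1\<close>.\<close>
  have AQ1: "A (Q h) = Q h" for h
  proof -
    define u where "u = A (Q h) - Q h"
    have "A u = - u" by (simp add: u_def blinfun.diff_right AQ)
    then have "inner u u \<le> 0" using nonneg[of u] by simp
    then have "inner u u = 0" using inner_ge_zero[of u] by linarith
    then show ?thesis by (simp add: u_def)
  qed
  have "\<exists>h. Q h \<noteq> 0"
  proof (rule ccontr)
    assume "\<not> ?thesis"
    then have Q0: "(\<lambda>k. pow (2 * k) h) \<longlonglongrightarrow> 0" for h using Q[of h] by simp
    have bto0: "(\<lambda>k. b k h) \<longlonglongrightarrow> 0" for h
    proof -
      have "(\<lambda>k. inner (pow (2 * k) h) h) \<longlonglongrightarrow> inner 0 h" by (intro tendsto_intros Q0)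
      then show ?thesis by (simp add: bin mult_2)
    qed
    have sumb: "summable (\<lambda>i. b 1 (e i))"
    proof (rule summableI_nonneg_bounded)
      fix n
      have "(\<Sum>i<n. b 1 (e i)) \<le> (\<Sum>i<n. inner (A (e i)) (e i))"
        using norm_sq_le n1 by (intro sum_mono) (simp add: b_def pow_simps)
      also have "\<dots> \<le> \<tau>"
        using tr orthonormal_or_zero_subset[OF e(1)] unfolding trace_le_def by blast
      finally show "(\<Sum>i<n. b 1 (e i)) \<le> \<tau>" .
    qed (simp add: b_def)
    have "(\<lambda>k. \<Sum>i. b k (e i)) \<longlonglongrightarrow> (\<Sum>i. 0)"
    proof (rule tannerys_theorem[where M = "\<lambda>i. b 1 (e i)", THEN conjunct2, THEN conjunct2])
      show "eventually (\<lambda>(i, k). norm (b k (e i)) \<le> b 1 (e i)) (at_top \<times>\<^sub>F sequentially)"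
        using bmono[of 1] by (intro eventually_prodI[THEN eventually_mono, OF _ eventually_ge_at_top[of 1]])
          (auto simp: b_def intro!: always_eventually)
    qed (use bto0 sumb in auto)
    then have lim0: "(\<lambda>k. \<Sum>i. b k (e i)) \<longlonglongrightarrow> 0" by simp
    \<comment> \<open>A unit vector \<open>g\<close> with \<open>\<parallel>A g\<parallel>\<close> so close to \<open>1\<close> that \<open>\<parallel>A\<^sup>n g\<parallel>\<^sup>2 \<ge> 1/2\<close> for this one \<open>n\<close>,
      by Bernoulli's inequality.\<close>
    have big: "1 / 2 \<le> (\<Sum>i. b (2 ^ m) (e i))" for m
    proof -
      let ?n = "2 ^ m :: nat"
      define \<delta> :: real where "\<delta> = 1 / (4 * real ?n)"
      have "1 \<le> real ?n" by simp
      then have d: "0 < \<delta>" "\<delta> < 1" unfolding \<delta>_def by (simp_all only: divide_less_eq_1 zero_less_divide_1_iff) linarith+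
      have "\<exists>h. \<not> norm (A h) \<le> (1 - \<delta>) * norm h"
      proof (rule ccontr)
        assume "\<not> ?thesis"
        then have "norm A \<le> 1 - \<delta>" using d by (intro norm_blinfun_bound) auto
        then show False using n1 d by simp
      qed
      then obtain h where h: "(1 - \<delta>) * norm h < norm (A h)" by (auto simp: not_le)
      then have "h \<noteq> 0" by auto
      define g where "g = h /\<^sub>R norm h"
      have g: "norm g = 1" "1 - \<delta> < norm (A g)"
        using h \<open>h \<noteq> 0\<close> by (simp_all add: g_def blinfun.scaleR_right field_simps)
      have "1 / 2 \<le> 1 - real (2 * ?n) * \<delta>" by (simp add: \<delta>_def)
      also have "\<dots> \<le> (1 - \<delta>) ^ (2 * ?n)"
        using Bernoulli_inequality[of "- \<delta>" "2 * ?n"] d by simp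
      also have "\<dots> \<le> norm (A g) ^ (2 * ?n)" using g d by (intro power_mono) auto
      also have "\<dots> = (norm (A g) ^ ?n)\<^sup>2" by (simp add: power_mult[symmetric] mult.commute)
      also have "\<dots> \<le> (norm (pow ?n g))\<^sup>2" by (intro power_mono pow_norm_ge g) simp
      also have "(\<lambda>i. (inner (pow ?n g) (e i))\<^sup>2) sums (norm (pow ?n g))\<^sup>2"
        using e by (intro parseval_sums) auto
      then have "(norm (pow ?n g))\<^sup>2 = (\<Sum>i. (inner (pow ?n g) (e i))\<^sup>2)" by (rule sums_unique)
      also have "\<dots> \<le> (\<Sum>i. b ?n (e i))"
      proof (rule suminf_le)
        fix i
        have "\<bar>inner (pow ?n g) (e i)\<bar> \<le> norm g * norm (pow ?n (e i))"
          unfolding pow_sym by (rule Cauchy_Schwarz_ineq2)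
        then show "(inner (pow ?n g) (e i))\<^sup>2 \<le> b ?n (e i)"
          using g(1) by (simp add: b_def abs_le_square_iff[symmetric])
        show "summable (\<lambda>i. (inner (pow ?n g) (e i))\<^sup>2)"
          using parseval_sums[OF e(1)] e(2) by (auto simp: sums_iff)
        show "summable (\<lambda>i. b ?n (e i))"
          using bmono[of 1 ?n] by (intro summable_comparison_test[OF _ sumb]) (auto simp: b_def)
      qed
      finally show ?thesis .
    qed
    have "filterlim (\<lambda>m. 2 ^ m :: nat) sequentially sequentially"
      by (rule filterlim_subseq) (simp add: strict_mono_def)
    then have "(\<lambda>m. \<Sum>i. b (2 ^ m) (e i)) \<longlonglongrightarrow> 0" by (rule filterlim_compose[OF lim0])
    then have "1 / 2 \<le> (0 :: real)" using big by (intro LIMSEQ_le_const) auto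
    then show False by simp
  qed
  then show thesis using AQ1 that by blast
qed

end

lemma dominant_eigenvector:
  fixes A :: "'h::{real_inner, banach, second_countable_topology} \<Rightarrow>\<^sub>L 'h"
  assumes "positive_operator A" "trace_le A \<tau>" "A \<noteq> 0"
  obtains v where "v \<noteq> 0" "A v = norm A *\<^sub>R v"
proof -
  interpret A: positive_operator A by fact
  have n: "0 < norm A" using assms(3) by simp
  let ?B = "A /\<^sub>R norm A"
  interpret B: positive_operator ?B
  proof
    show "0 \<le> inner (?B h) h" for h using A.nonneg[of h] n by (simp add: blinfun.scaleR_left)
  qed (simp add: blinfun.scaleR_left A.symmetric)
  have "trace_le ?B (\<tau> / norm A)"
    unfolding trace_le_def
  proof (intro allI impI)
    fix e :: "nat \<Rightarrow> 'h" and F :: "nat set" assume F: "finite F" "orthonormal_or_zero e F"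
    have "(\<Sum>i\<in>F. inner (?B (e i)) (e i)) = (\<Sum>i\<in>F. inner (A (e i)) (e i)) / norm A"
      unfolding sum_divide_distrib
      by (intro sum.cong refl) (simp add: blinfun.scaleR_left divide_inverse mult.commute)
    also have "\<dots> \<le> \<tau> / norm A"
      using assms(2) F n unfolding trace_le_def by (intro divide_right_mono) auto
    finally show "(\<Sum>i\<in>F. inner (?B (e i)) (e i)) \<le> \<tau> / norm A" .
  qed
  then obtain v where "v \<noteq> 0" "?B v = v"
    using B.dominant_eigenvector_contraction n by auto
  have "norm A *\<^sub>R v = norm A *\<^sub>R ?B v" using \<open>?B v = v\<close> by simp
  also have "\<dots> = A v" using n by (simp add: blinfun.scaleR_left)
  finally have "A v = norm A *\<^sub>R v" ..
  then show thesis using that \<open>v \<noteq> 0\<close> by blast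
qed

text \<open>A finite orthonormal set in the eigenspace of \<open>\<mu>\<close> contributes \<open>\<mu>\<close> per element to the
  trace, so its size is at most \<open>\<tau> / \<mu>\<close>; one of maximal size spans.\<close>

lemma eigenspace_orthonormal_basis:
  fixes A :: "'h::{real_inner, banach, second_countable_topology} \<Rightarrow>\<^sub>L 'h"
  assumes "positive_operator A" "trace_le A \<tau>" "\<mu> \<noteq> 0"
  obtains S where "finite S" "S \<subseteq> {h. A h = \<mu> *\<^sub>R h}" "orthonormal_or_zero (\<lambda>s. s) S" "0 \<notin> S"
    "span S = {h. A h = \<mu> *\<^sub>R h}" "card S = dim {h. A h = \<mu> *\<^sub>R h}" "S \<noteq> {} \<longrightarrow> 0 < \<mu>"
proof -
  interpret A: positive_operator A by fact
  let ?E = "{h. A h = \<mu> *\<^sub>R h}"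
  have sub: "subspace ?E"
    by (auto simp: subspace_def blinfun.add_right blinfun.scaleR_right scaleR_add_right)
  have pos: "0 < \<mu>" if "h \<in> ?E" "h \<noteq> 0" for h
  proof -
    have "0 \<le> \<mu> * inner h h" using that A.nonneg[of h] by simp
    moreover have "0 < inner h h" using that by simp
    ultimately show ?thesis using assms(3) by (simp add: zero_le_mult_iff)
  qed
  define good where "good = (\<lambda>S. finite S \<and> S \<subseteq> ?E \<and> orthonormal_or_zero (\<lambda>s. s) S \<and> 0 \<notin> S)"
  have bound: "real (card S) \<le> \<tau> / \<mu>" if "good S" "S \<noteq> {}" for S
  proof -
    have S: "finite S" "S \<subseteq> ?E" "orthonormal_or_zero (\<lambda>s. s) S" "0 \<notin> S" using that by (auto simp: good_def)
    have mu: "0 < \<mu>" using that S pos by (metis all_not_in_conv subsetD)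
    obtain g where g: "bij_betw g {0..<card S} S" using ex_bij_betw_nat_finite[OF S(1)] by blast
    have "orthonormal_or_zero g {0..<card S}"
      using S(3) g unfolding orthonormal_or_zero_def bij_betw_def inj_on_def by (metis imageI)
    then have "(\<Sum>i\<in>{0..<card S}. inner (A (g i)) (g i)) \<le> \<tau>"
      using assms(2) unfolding trace_le_def by blast
    moreover have "(\<Sum>i\<in>{0..<card S}. inner (A (g i)) (g i)) = (\<Sum>s\<in>S. inner (A s) s)"
      by (rule sum.reindex_bij_betw[OF g])
    moreover have "(\<Sum>s\<in>S. inner (A s) s) = (\<Sum>s\<in>S. \<mu>)"
    proof (intro sum.cong refl)
      fix s assume "s \<in> S"
      then have "A s = \<mu> *\<^sub>R s" "norm s = 1" using S by (auto simp: orthonormal_or_zero_def)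
      then show "inner (A s) s = \<mu>" by (simp add: norm_eq_1)
    qed
    ultimately show ?thesis using mu by (simp add: field_simps)
  qed
  have good0: "good {}" by (simp add: good_def orthonormal_or_zero_def)
  have "\<exists>S. good S \<and> (\<forall>T. good T \<longrightarrow> card T \<le> card S)"
  proof (rule ex_has_greatest_nat)
    show "\<forall>T. good T \<longrightarrow> card T < Suc (nat \<lceil>\<tau> / \<mu>\<rceil>)"
    proof (intro allI impI)
      fix T assume T: "good T"
      show "card T < Suc (nat \<lceil>\<tau> / \<mu>\<rceil>)"
        using bound[OF T] by (cases "T = {}") (simp_all, linarith)
    qed
  qed (rule good0)
  then obtain S where S: "good S" and max: "\<And>T. good T \<Longrightarrow> card T \<le> card S" by blast
  have Sp: "finite S" "S \<subseteq> ?E" "orthonormal_or_zero (\<lambda>s. s) S" "0 \<notin> S" using S by (auto simp: good_def)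
  have "?E \<subseteq> span S"
  proof (rule ccontr)
    assume "\<not> ?thesis"
    then obtain v where v: "v \<in> ?E" "v \<notin> span S" by blast
    define r where "r = v - partial_proj (\<lambda>s. s) S v"
    have "partial_proj (\<lambda>s. s) S v \<in> span S"
      unfolding partial_proj_def by (intro span_sum span_scale span_base)
    then have r0: "r \<noteq> 0" and rE: "r \<in> ?E"
      using v Sp(2) sub span_minimal[OF Sp(2) sub]
      by (auto simp: r_def intro!: subspace_diff[OF sub, of v, simplified])
    have perp: "inner r s = 0" if "s \<in> S" for s
      using inner_partial_proj[OF Sp(3,1) that, of v] by (simp add: r_def inner_diff_left)
    define u where "u = sgn r"
    have u: "norm u = 1" "u \<noteq> 0" "u \<in> ?E" "\<And>s. s \<in> S \<Longrightarrow> inner u s = 0"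
      using r0 rE perp subspace_scale[OF sub, of r "inverse (norm r)"]
      by (auto simp: u_def norm_sgn sgn_zero_iff sgn_div_norm)
    have "u \<notin> S" using u by (metis norm_eq_1 zero_neq_one)
    moreover have "good (insert u S)"
      using Sp u by (auto simp: good_def orthonormal_or_zero_def inner_commute)
    ultimately show False using max[of "insert u S"] Sp(1) by simp
  qed
  then have spanS: "span S = ?E" using span_minimal[OF Sp(2) sub] by blast
  have "independent S"
    using Sp(3,4) by (intro pairwise_orthogonal_independent)
      (auto simp: pairwise_def orthogonal_def orthonormal_or_zero_def)
  then have "card S = dim ?E"
    using Sp(2) spanS by (metis basis_card_eq_dim order_refl)
  then show thesis using that[of S] Sp spanS pos by (metis all_not_in_conv subsetD)
qed

text \<open>The enumeration of eigenvalues is given, so eigenvectors have to be matched to it: the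
  indices carrying an eigenvalue are as many as the vectors in an orthonormal basis of
  its eigenspace. The resulting series \<open>S\<close> exhausts \<open>R\<close> because \<open>R - S\<close> is again positive
  with finite trace; were it not \<open>0\<close>, its dominant eigenvector would be an eigenvector of
  \<open>R\<close> orthogonal to all the eigenvectors with the same eigenvalue.\<close>

lemma spectral_decomposition:
  fixes R :: "'h::{real_inner, banach, second_countable_topology} \<Rightarrow>\<^sub>L 'h"
  assumes "positive_operator R" "trace_le R \<tau>" "eigenvalue_sequence R lam"
  shows "\<forall>i. 0 \<le> lam i" "summable lam"
    "\<exists>f. orthonormal_or_zero f UNIV \<and> (\<forall>i. f i = 0 \<longleftrightarrow> lam i = 0) \<and>
         (\<forall>h. (\<lambda>i. lam i *\<^sub>R inner (f i) h *\<^sub>R f i) sums R h)"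
proof -
  interpret R: positive_operator R by fact
  let ?E = "\<lambda>\<mu>. {h. R h = \<mu> *\<^sub>R h}"
  \<comment> \<open>\<open>labels \<mu> g\<close>: \<open>g\<close> numbers an orthonormal basis of the eigenspace by the indices \<open>i\<close>
    with \<open>lam i = \<mu>\<close>.\<close>
  define labels where "labels = (\<lambda>\<mu> g. \<exists>S. bij_betw g {i. lam i = \<mu>} S \<and> S \<subseteq> ?E \<mu> \<and>
      orthonormal_or_zero (\<lambda>s. s) S \<and> 0 \<notin> S \<and> span S = ?E \<mu> \<and> (S \<noteq> {} \<longrightarrow> 0 < \<mu>))"
  have "\<forall>\<mu>. \<exists>g. \<mu> \<noteq> 0 \<longrightarrow> labels \<mu> g"
  proof
    fix \<mu> :: real
    show "\<exists>g. \<mu> \<noteq> 0 \<longrightarrow> labels \<mu> g"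
    proof (cases "\<mu> = 0")
      case False
      obtain S where S: "finite S" "S \<subseteq> ?E \<mu>" "orthonormal_or_zero (\<lambda>s. s) S" "0 \<notin> S"
          "span S = ?E \<mu>" "card S = dim (?E \<mu>)" "S \<noteq> {} \<longrightarrow> 0 < \<mu>"
        by (rule eigenspace_orthonormal_basis[OF assms(1,2) False])
      moreover have "finite {i. lam i = \<mu>}" "card {i. lam i = \<mu>} = card S"
        using assms(3) False S(6) unfolding eigenvalue_sequence_def by auto
      ultimately obtain g where "bij_betw g {i. lam i = \<mu>} S" by (metis finite_same_card_bij)
      then show ?thesis using S unfolding labels_def by blast
    qed simp
  qed
  then obtain g where "\<And>\<mu>. \<mu> \<noteq> 0 \<Longrightarrow> labels \<mu> (g \<mu>)" by metis
  then have g: "\<exists>S. bij_betw (g \<mu>) {i. lam i = \<mu>} S \<and> S \<subseteq> ?E \<mu> \<and>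
      orthonormal_or_zero (\<lambda>s. s) S \<and> 0 \<notin> S \<and> span S = ?E \<mu> \<and> (S \<noteq> {} \<longrightarrow> 0 < \<mu>)" if "\<mu> \<noteq> 0" for \<mu>
    using that unfolding labels_def by blast
  define f where "f = (\<lambda>i. if lam i = 0 then 0 else g (lam i) i)"
  have f: "R (f i) = lam i *\<^sub>R f i" "norm (f i) = 1" "0 < lam i" if nz: "lam i \<noteq> 0" for i
  proof -
    obtain S where S: "bij_betw (g (lam i)) {j. lam j = lam i} S" "S \<subseteq> ?E (lam i)"
        "orthonormal_or_zero (\<lambda>s. s) S" "0 \<notin> S" "S \<noteq> {} \<longrightarrow> 0 < lam i"
      using g[OF nz] by blast
    have "f i \<in> S" using S(1) nz by (auto simp: f_def bij_betw_def)
    then show "R (f i) = lam i *\<^sub>R f i" "norm (f i) = 1" "0 < lam i"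
      using S by (auto simp: orthonormal_or_zero_def)
  qed
  have f0: "f i = 0 \<longleftrightarrow> lam i = 0" for i using f(2)[of i] by (auto simp: f_def)
  have Rf: "R (f i) = lam i *\<^sub>R f i" for i using f(1)[of i] f0[of i] by (cases "lam i = 0") auto
  show lam0: "\<forall>i. 0 \<le> lam i" using f(3) by (metis less_eq_real_def)
  have orth: "inner (f i) (f j) = 0" if "i \<noteq> j" for i j
  proof (cases "lam i = 0 \<or> lam j = 0")
    case True
    then show ?thesis by (auto simp: f_def)
  next
    case nz: False
    show ?thesis
    proof (cases "lam i = lam j")
      case True
      obtain S where S: "bij_betw (g (lam i)) {k. lam k = lam i} S" "orthonormal_or_zero (\<lambda>s. s) S"
        using g[of "lam i"] nz by blast
      then have "f i \<in> S" "f j \<in> S" "f i \<noteq> f j"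
        using nz that True by (auto simp: f_def bij_betw_def inj_on_def)
      then show ?thesis using S(2) by (auto simp: orthonormal_or_zero_def)
    next
      case False
      have "lam i * inner (f i) (f j) = lam j * inner (f i) (f j)"
        using R.symmetric[of "f i" "f j"] by (simp add: Rf)
      then show ?thesis using False by simp
    qed
  qed
  have on: "orthonormal_or_zero f UNIV"
    using orth f(2) f0 by (auto simp: orthonormal_or_zero_def)
  have inn: "inner (R (f i)) (f i) = lam i" for i
    using f(2)[of i] by (cases "lam i = 0") (auto simp: Rf norm_eq_1)
  show suml: "summable lam"
  proof (rule summableI_nonneg_bounded)
    fix n
    have "(\<Sum>i<n. inner (R (f i)) (f i)) \<le> \<tau>"
      using assms(2) orthonormal_or_zero_subset[OF on] unfolding trace_le_def by blast
    then show "(\<Sum>i<n. lam i) \<le> \<tau>" by (simp add: inn)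
  qed (use lam0 in blast)
  have nf: "norm (f i) \<le> 1" for i using f(2)[of i] f0[of i] by (cases "lam i = 0") auto
  define T where "T = (\<lambda>i. lam i *\<^sub>R blinfun_scaleR_left (f i) o\<^sub>L blinfun_inner_left (f i))"
  have T: "T i h = lam i *\<^sub>R inner (f i) h *\<^sub>R f i" for i h
    by (simp add: T_def blinfun.scaleR_left inner_commute)
  have "summable T"
  proof (rule summable_comparison_test[OF _ suml], intro exI allI impI)
    fix i
    show "norm (T i) \<le> lam i"
    proof (rule norm_blinfun_bound)
      fix h
      have "norm (T i h) = lam i * (\<bar>inner (f i) h\<bar> * norm (f i))" using lam0 by (simp add: T abs_mult)
      also have "\<dots> \<le> lam i * ((norm (f i) * norm h) * norm (f i))"
        using lam0 by (intro mult_left_mono mult_right_mono Cauchy_Schwarz_ineq2) auto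
      also have "\<dots> \<le> lam i * ((1 * norm h) * 1)"
        using lam0 nf by (intro mult_left_mono mult_mono) auto
      finally show "norm (T i h) \<le> lam i * norm h" by simp
    qed (use lam0 in blast)
  qed
  define S where "S = (\<Sum>i. T i)"
  have S: "(\<lambda>i. lam i *\<^sub>R inner (f i) h *\<^sub>R f i) sums S h" for h
    using bounded_linear.sums[OF blinfun.bounded_linear_left summable_sums[OF \<open>summable T\<close>], of h]
    by (simp add: S_def T)
  have Sin: "(\<lambda>i. lam i * inner (f i) h * inner (f i) k) sums inner (S h) k" for h k
    using bounded_linear.sums[OF bounded_linear_inner_left S, of h k] by (simp add: mult.assoc)
  let ?D = "R - S"
  have Df: "?D (f j) = 0" for j
  proof -
    have "(\<lambda>i. lam i *\<^sub>R inner (f i) (f j) *\<^sub>R f i) = (\<lambda>i. if i = j then lam j *\<^sub>R f j else 0)"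
      using orth f(2) f0 by (fastforce simp: norm_eq_1)
    then have "S (f j) = lam j *\<^sub>R f j" using sums_unique2[OF S[of "f j"]] sums_single[of j "\<lambda>_. lam j *\<^sub>R f j"] by simp
    then show ?thesis by (simp add: blinfun.diff_left Rf)
  qed
  have Dsym: "inner (?D h) k = inner h (?D k)" for h k
  proof -
    have "(\<lambda>i. lam i * inner (f i) h * inner (f i) k) = (\<lambda>i. lam i * inner (f i) k * inner (f i) h)"
      by (rule ext) simp
    then have "inner (S h) k = inner (S k) h" using sums_unique2[OF Sin[of h k]] Sin[of k h] by simp
    then have "inner (S h) k = inner h (S k)" by (simp add: inner_commute)
    then show ?thesis by (simp add: blinfun.diff_left inner_diff_left inner_diff_right R.symmetric)
  qed
  \<comment> \<open>\<open>R - S\<close> kills the first \<open>n\<close> eigenvectors, so \<open>h\<close> may be replaced by its part \<open>r\<close>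
    orthogonal to them, on which \<open>S\<close> is bounded by the tail of the eigenvalues.\<close>
  have Dnonneg: "0 \<le> inner (?D h) h" for h
  proof -
    have "- ((\<Sum>i. lam i) - (\<Sum>i<n. lam i)) * (norm h)\<^sup>2 \<le> inner (?D h) h" for n
    proof -
      define r where "r = h - partial_proj f {..<n} h"
      have "?D (partial_proj f {..<n} h) = 0"
        unfolding partial_proj_def blinfun.sum_right blinfun.scaleR_right Df by simp
      then have Dr: "?D r = ?D h" by (simp add: r_def blinfun.diff_right)
      have "inner (?D h) h = inner (?D r) r" by (metis Dr Dsym)
      moreover have "0 \<le> inner (R r) r" by (rule R.nonneg)
      moreover have "inner (S r) r \<le> ((\<Sum>i. lam i) - (\<Sum>i<n. lam i)) * (norm h)\<^sup>2"
      proof -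
        have on': "orthonormal_or_zero f {..<n}" using on orthonormal_or_zero_subset by blast
        have perp: "inner (f i) r = 0" if "i < n" for i
          using inner_partial_proj[OF on' finite_lessThan, of i h] that
          by (simp add: r_def inner_diff_right inner_commute)
        have nr: "(norm r)\<^sup>2 \<le> (norm h)\<^sup>2"
          using norm_diff_partial_proj[OF on' finite_lessThan, of h] by (simp add: r_def sum_nonneg)
        have s1: "(\<lambda>i. lam (i + n) * inner (f (i + n)) r * inner (f (i + n)) r) sums inner (S r) r"
          using Sin[of r r] perp by (subst sums_iff_shift) simp
        have s2: "(\<lambda>i. lam (i + n) * (norm h)\<^sup>2) sums (((\<Sum>i. lam i) - (\<Sum>i<n. lam i)) * (norm h)\<^sup>2)"
          by (intro sums_mult2) (subst sums_iff_shift, simp add: summable_sums suml)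
        show ?thesis
        proof (rule sums_le[OF _ s1 s2])
          fix i
          have "\<bar>inner (f (i + n)) r\<bar> \<le> 1 * norm r"
            using Cauchy_Schwarz_ineq2[of "f (i + n)" r] nf[of "i + n"]
            by (meson mult_right_mono norm_ge_zero order_trans)
          then have "(inner (f (i + n)) r)\<^sup>2 \<le> (norm h)\<^sup>2"
            using nr by (metis abs_norm_cancel abs_le_square_iff mult_1 order_trans)
          then show "lam (i + n) * inner (f (i + n)) r * inner (f (i + n)) r \<le> lam (i + n) * (norm h)\<^sup>2"
            using lam0 by (simp add: power2_eq_square mult.assoc mult_left_mono)
        qed
      qed
      ultimately have "- (((\<Sum>i. lam i) - (\<Sum>i<n. lam i)) * (norm h)\<^sup>2) \<le> inner (?D h) h"
        by (simp only: blinfun.diff_left inner_diff_left)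
      then show ?thesis by (simp only: mult_minus_left)
    qed
    moreover have "(\<lambda>n. - ((\<Sum>i. lam i) - (\<Sum>i<n. lam i)) * (norm h)\<^sup>2) \<longlonglongrightarrow> - ((\<Sum>i. lam i) - (\<Sum>i. lam i)) * (norm h)\<^sup>2"
      by (intro tendsto_intros summable_LIMSEQ suml)
    ultimately show ?thesis by (intro LIMSEQ_le_const2[of _ 0]) auto
  qed
  have pos: "positive_operator ?D" by standard (rule Dsym Dnonneg)+
  have tr: "trace_le ?D \<tau>"
    unfolding trace_le_def
  proof (intro allI impI)
    fix e :: "nat \<Rightarrow> 'h" and F :: "nat set" assume F: "finite F" "orthonormal_or_zero e F"
    have "0 \<le> inner (S h) h" for h
      using Sin[of h h] lam0 by (intro sums_le[OF _ sums_zero Sin[of h h]]) (simp add: mult.assoc)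
    then have "(\<Sum>i\<in>F. inner (?D (e i)) (e i)) \<le> (\<Sum>i\<in>F. inner (R (e i)) (e i))"
      by (intro sum_mono) (simp add: blinfun.diff_left inner_diff_left)
    also have "\<dots> \<le> \<tau>" using assms(2) F unfolding trace_le_def by blast
    finally show "(\<Sum>i\<in>F. inner (?D (e i)) (e i)) \<le> \<tau>" .
  qed
  have "?D = 0"
  proof (rule ccontr)
    assume "?D \<noteq> 0"
    then obtain v where v: "v \<noteq> 0" "?D v = norm ?D *\<^sub>R v" using dominant_eigenvector[OF pos tr] by metis
    let ?\<mu> = "norm ?D"
    have mu: "?\<mu> \<noteq> 0" using \<open>?D \<noteq> 0\<close> by simp
    have perp: "inner (f i) v = 0" for i
    proof -
      have "?\<mu> * inner (f i) v = inner (f i) (?D v)" by (simp add: v(2))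
      also have "\<dots> = inner (?D (f i)) v" by (simp only: Dsym)
      finally show ?thesis using mu Df by simp
    qed
    then have "S v = 0" using sums_unique2[OF S[of v]] by (simp add: sums_zero)
    then have "v \<in> ?E ?\<mu>" using v(2) by (simp add: blinfun.diff_left)
    moreover obtain B where B: "bij_betw (g ?\<mu>) {i. lam i = ?\<mu>} B" "span B = ?E ?\<mu>"
      using g[OF mu] by blast
    ultimately have "v \<in> span B" by simp
    moreover have "B = f ` {i. lam i = ?\<mu>}" using B(1) mu by (auto simp: bij_betw_def f_def)
    then have perpB: "inner b v = 0" if "b \<in> B" for b using that perp by auto
    have "inner x v = 0" if "x \<in> span B" for x
      using that by (induction rule: span_induct_alt) (simp_all add: inner_add_left perpB)
    ultimately show False using v(1) by fastforce
  qed
  then have "S = R" by simp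
  then show "\<exists>f. orthonormal_or_zero f UNIV \<and> (\<forall>i. f i = 0 \<longleftrightarrow> lam i = 0) \<and>
         (\<forall>h. (\<lambda>i. lam i *\<^sub>R inner (f i) h *\<^sub>R f i) sums R h)"
    using on f0 S by blast
qed

section \<open>Error covariances and pivots\<close>

text \<open>\<open>P\<close> is a plain function and not a bounded operator, so that increments of projections,
  finite sums \<open>partial_proj e S\<close> and the identity are instances as they stand.\<close>

locale orthogonal_projection =
  fixes P :: "'h::real_inner \<Rightarrow> 'h"
  assumes lin: "linear P"
    and idem [simp]: "P (P h) = P h"
    and sym: "inner (P h) k = inner h (P k)"
begin

lemma add: "P (h + k) = P h + P k" and scale: "P (c *\<^sub>R h) = c *\<^sub>R P h"
  and diff: "P (h - k) = P h - P k" and zero [simp]: "P 0 = 0"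
  using lin by (auto simp: linear_add linear_cmul linear_diff linear_0)

lemma inner_self: "inner (P h) h = (norm (P h))\<^sup>2"
  using sym[of "P h" h] by (simp add: power2_norm_eq_inner)

lemma inner_self': "inner h (P h) = (norm (P h))\<^sup>2"
  using inner_self by (simp add: inner_commute)

lemma norm_le: "norm (P h) \<le> norm h"
proof -
  have "(norm (P h))\<^sup>2 \<le> norm (P h) * norm h"
    using inner_self[of h] norm_cauchy_schwarz[of "P h" h] by simp
  then show ?thesis by (rule le_of_square_le_mult) auto
qed

lemma bounded: "bounded_linear P"
  using lin norm_le by (intro bounded_linear_intro[of P 1]) (auto simp: add scale)

end

lemma orthogonal_projection_diff:
  assumes "orthogonal_projection P" "orthogonal_projection Q" "\<And>h. Q (P h) = P h" "\<And>h. P (Q h) = P h"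
  shows "orthogonal_projection (\<lambda>h. Q h - P h)"
proof -
  interpret P: orthogonal_projection P by fact
  interpret Q: orthogonal_projection Q by fact
  show ?thesis
    by standard (auto simp: linear_iff P.add Q.add P.scale Q.scale P.diff Q.diff assms(3,4)
        algebra_simps P.sym Q.sym)
qed

lemma orthogonal_projection_id: "orthogonal_projection (\<lambda>h. h)"
  by standard (auto simp: linear_iff)

text \<open>Denoted \<open>K\<^sub>n\<close> in the comments that follow: the covariance operator of a signal with the
  first \<open>n\<close> modes only.\<close>

definition gram_op :: "(nat \<Rightarrow> 'h::real_inner) \<Rightarrow> nat \<Rightarrow> 'h \<Rightarrow> 'h" where
  "gram_op \<phi> n h = (\<Sum>i<n. inner (\<phi> i) h *\<^sub>R \<phi> i)"

text \<open>The operator \<open>C\<^sub>n = K\<^sub>n (I + P K\<^sub>n)\<^sup>-\<^sup>1\<close>: if the signal has covariance \<open>K\<^sub>n\<close> and its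
  projection by \<open>P\<close> is observed in white noise of unit intensity, then this is the
  covariance of the error of the best linear estimate. It is built one rank-one term at a
  time by the Sherman-Morrison formula (a Kalman update), so that no operator has to be
  inverted; every step divides by a number that is at least \<open>1\<close>.\<close>

primrec error_cov :: "(nat \<Rightarrow> 'h::real_inner) \<Rightarrow> ('h \<Rightarrow> 'h) \<Rightarrow> nat \<Rightarrow> 'h \<Rightarrow> 'h" where
  "error_cov \<phi> P 0 = (\<lambda>h. 0)"
| "error_cov \<phi> P (Suc n) =
     (let \<psi> = \<phi> n - error_cov \<phi> P n (P (\<phi> n)) in
      (\<lambda>h. error_cov \<phi> P n h + (inner \<psi> h / (1 + inner (\<phi> n) (P \<psi>))) *\<^sub>R \<psi>))"

text \<open>\<open>\<psi>\<^sub>n = (I + K\<^sub>n P)\<^sup>-\<^sup>1 \<phi>\<^sub>n\<close>, the part of the mode \<open>\<phi>\<^sub>n\<close> that the observation leaves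
  unexplained by the earlier modes.\<close>

definition residual :: "(nat \<Rightarrow> 'h::real_inner) \<Rightarrow> ('h \<Rightarrow> 'h) \<Rightarrow> nat \<Rightarrow> 'h" where
  "residual \<phi> P n = \<phi> n - error_cov \<phi> P n (P (\<phi> n))"

text \<open>The ratio \<open>det (I + P K\<^sub>n\<^sub>+\<^sub>1 P) / det (I + P K\<^sub>n P)\<close>, by the matrix determinant lemma.\<close>

definition pivot :: "(nat \<Rightarrow> 'h::real_inner) \<Rightarrow> ('h \<Rightarrow> 'h) \<Rightarrow> nat \<Rightarrow> real" where
  "pivot \<phi> P n = 1 + inner (\<phi> n) (P (residual \<phi> P n))"

lemma error_cov_Suc:
  "error_cov \<phi> P (Suc n) h =
     error_cov \<phi> P n h + (inner (residual \<phi> P n) h / pivot \<phi> P n) *\<^sub>R residual \<phi> P n"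
  by (simp add: Let_def residual_def pivot_def)

declare error_cov.simps(2) [simp del]

lemma error_cov_eq_sum:
  "error_cov \<phi> P n h = (\<Sum>i<n. (inner (residual \<phi> P i) h / pivot \<phi> P i) *\<^sub>R residual \<phi> P i)"
  by (induction n) (simp_all add: error_cov_Suc)

lemma inner_error_cov:
  "inner (error_cov \<phi> P n h) k = (\<Sum>i<n. inner (residual \<phi> P i) h * inner (residual \<phi> P i) k / pivot \<phi> P i)"
  by (simp add: error_cov_eq_sum inner_sum_left)

lemma error_cov_sym: "inner (error_cov \<phi> P n h) k = inner h (error_cov \<phi> P n k)"
  by (simp add: inner_error_cov inner_commute[of h] mult.commute)

lemma error_cov_linear:
  "error_cov \<phi> P n (h + k) = error_cov \<phi> P n h + error_cov \<phi> P n k"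
  "error_cov \<phi> P n (c *\<^sub>R h) = c *\<^sub>R error_cov \<phi> P n h"
  "error_cov \<phi> P n (h - k) = error_cov \<phi> P n h - error_cov \<phi> P n k"
  "error_cov \<phi> P n 0 = 0"
  by (simp_all add: error_cov_eq_sum inner_add_right inner_diff_right add_divide_distrib diff_divide_distrib
      scaleR_add_left scaleR_diff_left sum.distrib sum_subtractf scaleR_sum_right)

lemma gram_op_linear:
  "gram_op \<phi> n (h + k) = gram_op \<phi> n h + gram_op \<phi> n k"
  "gram_op \<phi> n (c *\<^sub>R h) = c *\<^sub>R gram_op \<phi> n h"
  "gram_op \<phi> n (h - k) = gram_op \<phi> n h - gram_op \<phi> n k"
  "gram_op \<phi> n 0 = 0"
  by (simp_all add: gram_op_def inner_add_right inner_diff_right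
      scaleR_add_left scaleR_diff_left sum.distrib sum_subtractf scaleR_sum_right)

lemma inner_gram_op: "inner (gram_op \<phi> n h) k = (\<Sum>i<n. inner (\<phi> i) h * inner (\<phi> i) k)"
  by (simp add: gram_op_def inner_sum_left)

lemma gram_op_sym: "inner (gram_op \<phi> n h) k = inner h (gram_op \<phi> n k)"
  by (simp add: inner_gram_op inner_commute[of h] mult.commute)

lemma gram_op_nonneg: "0 \<le> inner (gram_op \<phi> n h) h"
  by (auto simp: inner_gram_op intro!: sum_nonneg)

lemma gram_op_Suc: "gram_op \<phi> (Suc n) h = gram_op \<phi> n h + inner (\<phi> n) h *\<^sub>R \<phi> n"
  by (simp add: gram_op_def)

context orthogonal_projection begin

text \<open>The two claims are proved together since the update formula divides by the pivots. In
  terms of the residual a pivot is \<open>1 + |P \<psi>|\<^sup>2 + (K\<^sub>n P \<psi>, P \<psi>)\<close>.\<close>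

lemma error_cov_resolvent_and_pivot:
  "(\<forall>h. error_cov \<phi> P n h + gram_op \<phi> n (P (error_cov \<phi> P n h)) = gram_op \<phi> n h) \<and>
   (\<forall>i<n. 1 \<le> pivot \<phi> P i)"
proof (induction n)
  case 0
  show ?case by (simp add: gram_op_def)
next
  case (Suc n)
  let ?C = "error_cov \<phi> P n" and ?K = "gram_op \<phi> n" and ?\<psi> = "residual \<phi> P n" and ?m = "pivot \<phi> P n"
  have C: "?C h + ?K (P (?C h)) = ?K h" for h using Suc by blast
  have psi: "?\<psi> + ?K (P ?\<psi>) = \<phi> n"
  proof -
    have "?\<psi> + ?K (P ?\<psi>) = \<phi> n + ?K (P (\<phi> n)) - (?C (P (\<phi> n)) + ?K (P (?C (P (\<phi> n)))))"
      by (simp add: residual_def diff gram_op_linear)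
    also have "\<dots> = \<phi> n" by (simp add: C)
    finally show ?thesis .
  qed
  have m: "?m = 1 + (norm (P ?\<psi>))\<^sup>2 + inner (?K (P ?\<psi>)) (P ?\<psi>)"
  proof -
    have "inner (\<phi> n) (P ?\<psi>) = inner ?\<psi> (P ?\<psi>) + inner (?K (P ?\<psi>)) (P ?\<psi>)"
      by (subst psi[symmetric]) (simp add: inner_add_left)
    then show ?thesis by (simp add: pivot_def inner_self')
  qed
  then have m1: "1 \<le> ?m" using gram_op_nonneg[of \<phi> n "P ?\<psi>"] by simp
  \<comment> \<open>The rank-one term added to \<open>K\<^sub>n\<close> is met by the rank-one term added to \<open>C\<^sub>n\<close>: the
    correction \<open>c\<close> satisfies \<open>(\<phi>\<^sub>n, P C\<^sub>n\<^sub>+\<^sub>1 h) = (\<phi>\<^sub>n, h) - c\<close>.\<close>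
  have "error_cov \<phi> P (Suc n) h + gram_op \<phi> (Suc n) (P (error_cov \<phi> P (Suc n) h)) = gram_op \<phi> (Suc n) h" for h
  proof -
    let ?c = "inner ?\<psi> h / ?m"
    have "inner (\<phi> n) (P (?C h)) = inner (\<phi> n) h - inner ?\<psi> h"
      by (simp add: residual_def inner_diff_left error_cov_sym sym)
    moreover have "inner (\<phi> n) (P ?\<psi>) = ?m - 1" by (simp add: pivot_def)
    ultimately have in': "inner (\<phi> n) (P (error_cov \<phi> P (Suc n) h)) = inner (\<phi> n) h - ?c"
    proof -
      have "inner (\<phi> n) (P (error_cov \<phi> P (Suc n) h)) = inner (\<phi> n) (P (?C h)) + ?c * inner (\<phi> n) (P ?\<psi>)"
        by (simp add: error_cov_Suc add scale inner_add_right)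
      also have "\<dots> = (inner (\<phi> n) h - inner ?\<psi> h) + ?c * (?m - 1)"
        by (simp only: \<open>inner (\<phi> n) (P (?C h)) = _\<close> \<open>inner (\<phi> n) (P ?\<psi>) = _\<close>)
      also have "?c * (?m - 1) = inner ?\<psi> h - ?c" using m1 by (simp add: field_simps)
      finally show ?thesis by simp
    qed
    have "error_cov \<phi> P (Suc n) h + ?K (P (error_cov \<phi> P (Suc n) h))
        = (?C h + ?K (P (?C h))) + ?c *\<^sub>R (?\<psi> + ?K (P ?\<psi>))"
      by (simp add: error_cov_Suc add scale gram_op_linear scaleR_add_right)
    also have "\<dots> = ?K h + ?c *\<^sub>R \<phi> n" by (simp only: C psi)
    finally show ?thesis
      by (simp add: gram_op_Suc in' scaleR_diff_left algebra_simps)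
  qed
  then show ?case using Suc m1 by (auto simp: less_Suc_eq)
qed

lemma pivot_ge_1: "1 \<le> pivot \<phi> P i"
  using error_cov_resolvent_and_pivot[of \<phi> "Suc i"] by blast

lemma error_cov_resolvent: "error_cov \<phi> P n h + gram_op \<phi> n (P (error_cov \<phi> P n h)) = gram_op \<phi> n h"
  using error_cov_resolvent_and_pivot[of \<phi> n] by blast

lemma error_cov_resolvent': "error_cov \<phi> P n h = gram_op \<phi> n (h - P (error_cov \<phi> P n h))"
  using error_cov_resolvent[of \<phi> n h] by (simp add: gram_op_linear algebra_simps)

lemma residual_resolvent: "residual \<phi> P n + gram_op \<phi> n (P (residual \<phi> P n)) = \<phi> n"
proof -
  have "residual \<phi> P n + gram_op \<phi> n (P (residual \<phi> P n)) = \<phi> n + gram_op \<phi> n (P (\<phi> n))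
      - (error_cov \<phi> P n (P (\<phi> n)) + gram_op \<phi> n (P (error_cov \<phi> P n (P (\<phi> n)))))"
    by (simp add: residual_def diff gram_op_linear)
  then show ?thesis by (simp add: error_cov_resolvent)
qed

lemma error_cov_nonneg: "0 \<le> inner (error_cov \<phi> P n h) h"
  using pivot_ge_1[of \<phi>] by (auto simp: inner_error_cov intro!: sum_nonneg divide_nonneg_nonneg)
     (meson order_trans zero_le_one)

text \<open>The mean square error, for signal covariance \<open>K\<^sub>n\<close>, of estimating \<open>(x, e)\<close> by the
  observation of \<open>u\<close>: the unexplained signal plus the noise admitted. Estimators that
  only see the range of \<open>P\<close> have \<open>P u = u\<close>.\<close>

definition causal_cost :: "(nat \<Rightarrow> 'h) \<Rightarrow> nat \<Rightarrow> 'h \<Rightarrow> 'h \<Rightarrow> real" where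
  "causal_cost \<phi> n e u = inner (gram_op \<phi> n (e - u)) (e - u) + (norm u)\<^sup>2"

lemma causal_cost_at_minimiser:
  "causal_cost \<phi> n e (P (error_cov \<phi> P n e)) = inner (error_cov \<phi> P n e) e"
proof -
  let ?C = "error_cov \<phi> P n e"
  have "inner (gram_op \<phi> n (e - P ?C)) (e - P ?C) = inner ?C (e - P ?C)"
    by (subst (3) error_cov_resolvent') simp
  then show ?thesis by (simp add: causal_cost_def inner_diff_right inner_self')
qed

text \<open>Completing the square around the minimiser \<open>P C e\<close>; the linear term vanishes by the
  resolvent equation.\<close>

lemma causal_cost_ge:
  assumes "P u = u"
  shows "inner (error_cov \<phi> P n e) e \<le> causal_cost \<phi> n e u"
proof -
  let ?C = "error_cov \<phi> P n e" and ?K = "gram_op \<phi> n"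
  define d where "d = u - P ?C"
  have Pd: "P d = d" by (simp add: d_def diff assms)
  have e: "e - u = (e - P ?C) - d" "u = P ?C + d" by (simp_all add: d_def)
  have "inner (?K (e - u)) (e - u) = inner (?K (e - P ?C)) (e - P ?C) - 2 * inner ?C d + inner (?K d) d"
  proof -
    have "inner (?K d) (e - P ?C) = inner ?C d"
      by (subst (2) error_cov_resolvent') (simp add: gram_op_sym inner_commute)
    moreover have "inner (?K (e - P ?C)) d = inner ?C d"
      by (subst (2) error_cov_resolvent') simp
    ultimately show ?thesis unfolding e(1)
      by (simp only: gram_op_linear(3) inner_diff_left inner_diff_right)
  qed
  moreover have "(norm u)\<^sup>2 = (norm (P ?C))\<^sup>2 + 2 * inner ?C d + (norm d)\<^sup>2"
  proof -
    have "inner (P ?C) d = inner ?C d" by (simp add: sym Pd)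
    then show ?thesis
      by (subst e(2)) (simp add: power2_norm_eq_inner inner_add_left inner_add_right inner_commute)
  qed
  ultimately have "causal_cost \<phi> n e u = causal_cost \<phi> n e (P ?C) + inner (?K d) d + (norm d)\<^sup>2"
    by (simp add: causal_cost_def)
  then show ?thesis
    using gram_op_nonneg[of \<phi> n d] by (simp add: causal_cost_at_minimiser)
qed

lemma error_cov_le_gram_op: "inner (error_cov \<phi> P n e) e \<le> inner (gram_op \<phi> n e) e"
  using causal_cost_ge[of 0 \<phi> n e] by (simp add: causal_cost_def)

end

locale projection_pair = P: orthogonal_projection P + Q: orthogonal_projection Q
  for P Q :: "'h::real_inner \<Rightarrow> 'h" +
  assumes QP [simp]: "Q (P h) = P h" and PQ [simp]: "P (Q h) = P h"
begin

definition D :: "'h \<Rightarrow> 'h" where "D h = Q h - P h"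

sublocale D: orthogonal_projection D
  unfolding D_def[abs_def] by (rule orthogonal_projection_diff) (auto intro: P.orthogonal_projection_axioms Q.orthogonal_projection_axioms)

text \<open>Expand \<open>\<phi>\<^sub>n\<close> in \<open>(\<phi>\<^sub>n, Q \<psi>\<^sup>Q)\<close> by the resolvent equation for \<open>P\<close> and in \<open>(\<phi>\<^sub>n, P \<psi>\<^sup>P)\<close>
  by the one for \<open>Q\<close>; the terms with \<open>K\<^sub>n\<close> cancel.\<close>

lemma pivot_increment: "pivot \<phi> Q n - pivot \<phi> P n = inner (residual \<phi> P n) (D (residual \<phi> Q n))"
proof -
  let ?p = "residual \<phi> P n" and ?q = "residual \<phi> Q n" and ?K = "gram_op \<phi> n"
  have "pivot \<phi> Q n - pivot \<phi> P n = inner (\<phi> n) (Q ?q) - inner (\<phi> n) (P ?p)"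
    by (simp add: pivot_def)
  also have "inner (\<phi> n) (Q ?q) = inner ?p (Q ?q) + inner (?K (P ?p)) (Q ?q)"
    by (subst P.residual_resolvent[symmetric]) (simp add: inner_add_left)
  also have "inner (\<phi> n) (P ?p) = inner ?q (P ?p) + inner (?K (Q ?q)) (P ?p)"
    by (subst Q.residual_resolvent[symmetric]) (simp add: inner_add_left)
  finally have "pivot \<phi> Q n - pivot \<phi> P n = inner ?p (Q ?q) + inner (?K (P ?p)) (Q ?q)
      - (inner ?q (P ?p) + inner (?K (Q ?q)) (P ?p))" .
  moreover have "inner (?K (Q ?q)) (P ?p) = inner (?K (P ?p)) (Q ?q)"
    by (subst gram_op_sym) (rule inner_commute)
  moreover have "inner ?q (P ?p) = inner ?p (P ?q)"
    by (subst P.sym[symmetric]) (rule inner_commute)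
  ultimately show ?thesis by (simp add: D_def inner_diff_right)
qed

lemma residual_difference:
  "residual \<phi> P n - residual \<phi> Q n = gram_op \<phi> n (Q (residual \<phi> Q n) - P (residual \<phi> P n))"
  using P.residual_resolvent[of \<phi> n] Q.residual_resolvent[of \<phi> n]
  by (simp add: gram_op_linear algebra_simps)

text \<open>The mixed expression \<open>(\<psi>\<^sup>P, D \<psi>\<^sup>Q)\<close> lies between the two pure ones because the residual
  shrinks when more is observed: \<open>(\<psi>\<^sup>P - \<psi>\<^sup>Q, D \<psi>\<^sup>Q) \<ge> 0\<close>.\<close>

lemma pivot_increment_bounds:
  "(norm (D (residual \<phi> Q n)))\<^sup>2 \<le> pivot \<phi> Q n - pivot \<phi> P n"
  "pivot \<phi> Q n - pivot \<phi> P n \<le> (norm (D (residual \<phi> P n)))\<^sup>2"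
proof -
  let ?p = "residual \<phi> P n" and ?q = "residual \<phi> Q n" and ?K = "gram_op \<phi> n"
  define d where "d = Q ?q - P ?p"
  have pq: "?p - ?q = ?K d" using residual_difference[of \<phi> n] by (simp add: d_def)
  have dq: "D ?q = d + P (?p - ?q)" by (simp add: D_def d_def P.diff)
  have "inner (?p - ?q) (D ?q) = inner (?K d) d + (norm (P (?K d)))\<^sup>2"
    unfolding dq by (simp add: pq inner_add_right P.inner_self')
  then have a: "0 \<le> inner (?p - ?q) (D ?q)" using gram_op_nonneg[of \<phi> n d] by simp
  then show "(norm (D ?q))\<^sup>2 \<le> pivot \<phi> Q n - pivot \<phi> P n"
    by (simp add: pivot_increment inner_diff_left D.inner_self')
  have "inner (D (?p - ?q)) (?p - ?q) = (norm (D (?p - ?q)))\<^sup>2" by (rule D.inner_self)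
  then have "0 \<le> inner (D (?p - ?q)) ?p - inner (D (?p - ?q)) ?q" by (simp add: inner_diff_right)
  then show "pivot \<phi> Q n - pivot \<phi> P n \<le> (norm (D ?p))\<^sup>2"
  proof -
    have "inner (D (?p - ?q)) ?q = inner (?p - ?q) (D ?q)" by (rule D.sym)
    moreover have "inner (D (?p - ?q)) ?p = (norm (D ?p))\<^sup>2 - inner ?p (D ?q)"
      by (simp add: D.diff inner_diff_left D.inner_self) (metis inner_commute)
    ultimately show ?thesis
      using a \<open>0 \<le> inner (D (?p - ?q)) ?p - _\<close> by (simp only: pivot_increment)
  qed
qed

text \<open>A finite version of \<open>d log det = tr (C dP)\<close>. The term \<open>|D \<psi>|\<^sup>2 / m\<close> is the share of one
  mode in \<open>tr (C D)\<close>, and concavity of the logarithm decides at which end of the step it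
  has to be taken.\<close>

lemma ln_pivot_bounds:
  "(norm (D (residual \<phi> Q n)))\<^sup>2 / pivot \<phi> Q n \<le> ln (pivot \<phi> Q n) - ln (pivot \<phi> P n)"
  "ln (pivot \<phi> Q n) - ln (pivot \<phi> P n) \<le> (norm (D (residual \<phi> P n)))\<^sup>2 / pivot \<phi> P n"
proof -
  let ?a = "pivot \<phi> P n" and ?b = "pivot \<phi> Q n"
  have pos: "0 < ?a" "0 < ?b" using P.pivot_ge_1[of \<phi> n] Q.pivot_ge_1[of \<phi> n] by auto
  have "ln ?b - ln ?a = ln (?b / ?a)" using pos by (simp add: ln_div)
  also have "\<dots> \<le> ?b / ?a - 1" using pos by (intro ln_le_minus_one) auto
  also have "\<dots> = (?b - ?a) / ?a" using pos by (simp add: field_simps)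
  also have "\<dots> \<le> (norm (D (residual \<phi> P n)))\<^sup>2 / ?a"
    using pos pivot_increment_bounds(2) by (intro divide_right_mono) auto
  finally show "ln ?b - ln ?a \<le> (norm (D (residual \<phi> P n)))\<^sup>2 / ?a" .
  have "ln ?a - ln ?b = ln (?a / ?b)" using pos by (simp add: ln_div)
  also have "\<dots> \<le> ?a / ?b - 1" using pos by (intro ln_le_minus_one) auto
  also have "\<dots> = - ((?b - ?a) / ?b)" using pos by (simp add: field_simps)
  also have "\<dots> \<le> - ((norm (D (residual \<phi> Q n)))\<^sup>2 / ?b)"
    using pos pivot_increment_bounds(1) by (simp add: divide_right_mono)
  finally show "(norm (D (residual \<phi> Q n)))\<^sup>2 / ?b \<le> ln ?b - ln ?a" by simp
qed

text \<open>The quadratic form of \<open>C\<^sub>P - C\<^sub>Q = C\<^sub>P D C\<^sub>Q\<close>.\<close>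

lemma error_cov_resolvent_identity:
  "inner (error_cov \<phi> P n e) e - inner (error_cov \<phi> Q n e) e
     = inner (error_cov \<phi> P n e) (D (error_cov \<phi> Q n e))"
proof -
  let ?p = "error_cov \<phi> P n e" and ?q = "error_cov \<phi> Q n e" and ?K = "gram_op \<phi> n"
  have p: "?p + ?K (P ?p) = ?K e" and q: "?q + ?K (Q ?q) = ?K e"
    using P.error_cov_resolvent Q.error_cov_resolvent by auto
  have "inner ?p (Q ?q) = inner (?K e) (Q ?q) - inner (?K (P ?p)) (Q ?q)"
    by (subst p[symmetric]) (simp add: inner_add_left)
  also have "inner (?K e) (Q ?q) = inner (?K e) e - inner ?q e"
    using q by (metis gram_op_sym inner_add_right inner_commute add_diff_cancel_left')
  finally have 1: "inner ?p (Q ?q) = inner (?K e) e - inner ?q e - inner (?K (P ?p)) (Q ?q)" .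
  have "inner ?q (P ?p) = inner (?K e) (P ?p) - inner (?K (Q ?q)) (P ?p)"
    by (subst q[symmetric]) (simp add: inner_add_left)
  also have "inner (?K e) (P ?p) = inner (?K e) e - inner ?p e"
    using p by (metis gram_op_sym inner_add_right inner_commute add_diff_cancel_left')
  finally have 2: "inner ?q (P ?p) = inner (?K e) e - inner ?p e - inner (?K (Q ?q)) (P ?p)" .
  have "inner (?K (Q ?q)) (P ?p) = inner (?K (P ?p)) (Q ?q)" by (metis gram_op_sym inner_commute)
  moreover have "inner ?p (P ?q) = inner ?q (P ?p)" by (metis P.sym inner_commute)
  ultimately show ?thesis using 1 2 by (simp add: D_def inner_diff_right)
qed

text \<open>\<open>C\<^sub>R \<le> K\<^sub>n\<close> and \<open>tr (D K\<^sub>n D) \<le> a\<close> give \<open>D C\<^sub>R D \<le> a\<close>; now apply the Cauchy-Schwarz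
  inequality to the quadratic form of \<open>C\<^sub>R\<close>.\<close>

lemma norm_D_error_cov_le:
  fixes R
  assumes "R = P \<or> R = Q" and a: "(\<Sum>i<n. (norm (D (\<phi> i)))\<^sup>2) \<le> a"
  shows "(norm (D (error_cov \<phi> R n e)))\<^sup>2 \<le> a * inner (error_cov \<phi> R n e) e"
proof -
  interpret R: orthogonal_projection R
    using assms(1) P.orthogonal_projection_axioms Q.orthogonal_projection_axioms by blast
  let ?C = "error_cov \<phi> R n"
  define g where "g = D (?C e)"
  have "a \<ge> 0" using a by (meson order_trans sum_nonneg zero_le_power2)
  have gg: "inner (?C g) g \<le> a * (norm g)\<^sup>2"
  proof -
    have "inner (?C g) g \<le> inner (gram_op \<phi> n g) g" by (rule R.error_cov_le_gram_op)
    also have "\<dots> = (\<Sum>i<n. (inner (D (\<phi> i)) g)\<^sup>2)"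
    proof -
      have "inner (\<phi> i) g = inner (D (\<phi> i)) g" for i by (simp add: g_def D.sym)
      then show ?thesis by (simp add: inner_gram_op power2_eq_square)
    qed
    also have "\<dots> \<le> (\<Sum>i<n. (norm (D (\<phi> i)))\<^sup>2 * (norm g)\<^sup>2)"
      by (intro sum_mono) (simp add: power_mult_distrib[symmetric] Cauchy_Schwarz_ineq2 abs_le_square_iff[symmetric])
    also have "\<dots> \<le> a * (norm g)\<^sup>2" using a by (simp add: sum_distrib_right[symmetric] mult_right_mono)
    finally show ?thesis .
  qed
  have cs: "(inner (?C e) g)\<^sup>2 \<le> inner (?C e) e * inner (?C g) g"
  proof (rule discriminant_bound)
    fix s t :: real
    have "inner (?C g) e = inner (?C e) g" by (subst error_cov_sym) (rule inner_commute)
    then have "inner (?C (s *\<^sub>R e - t *\<^sub>R g)) (s *\<^sub>R e - t *\<^sub>R g)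
        = s\<^sup>2 * inner (?C e) e - 2 * s * t * inner (?C e) g + t\<^sup>2 * inner (?C g) g"
      by (simp add: error_cov_linear inner_diff_left inner_diff_right power2_eq_square algebra_simps)
    then show "0 \<le> s\<^sup>2 * inner (?C e) e - 2 * s * t * inner (?C e) g + t\<^sup>2 * inner (?C g) g"
      using R.error_cov_nonneg[of \<phi> n "s *\<^sub>R e - t *\<^sub>R g"] by simp
  qed
  have "inner (?C e) g = (norm g)\<^sup>2" by (simp add: g_def D.inner_self')
  then have "(norm g)\<^sup>2 * (norm g)\<^sup>2 \<le> inner (?C e) e * (a * (norm g)\<^sup>2)"
  proof -
    have "(norm g)\<^sup>2 * (norm g)\<^sup>2 = (inner (?C e) g)\<^sup>2"
      using \<open>inner (?C e) g = (norm g)\<^sup>2\<close> by (simp add: power2_eq_square)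
    also have "\<dots> \<le> inner (?C e) e * inner (?C g) g" by (rule cs)
    also have "\<dots> \<le> inner (?C e) e * (a * (norm g)\<^sup>2)"
      by (intro mult_left_mono gg R.error_cov_nonneg)
    finally show ?thesis .
  qed
  then have "((norm g)\<^sup>2)\<^sup>2 \<le> (norm g)\<^sup>2 * (a * inner (?C e) e)"
    by (simp add: power2_eq_square mult_ac)
  then have "(norm g)\<^sup>2 \<le> a * inner (?C e) e"
    by (rule le_of_square_le_mult) (simp_all add: \<open>a \<ge> 0\<close> R.error_cov_nonneg)
  then show ?thesis by (simp add: g_def)
qed

text \<open>Observing the additional range of \<open>D\<close> leaves at least the fraction \<open>1 - a\<close> of the
  error. This is what makes upper and lower Riemann sums converge to each other.\<close>

lemma error_cov_refinement:
  assumes a: "(\<Sum>i<n. (norm (D (\<phi> i)))\<^sup>2) \<le> a"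
  shows "(1 - a) * inner (error_cov \<phi> P n e) e \<le> inner (error_cov \<phi> Q n e) e"
proof -
  let ?X = "inner (error_cov \<phi> P n e) e" and ?Y = "inner (error_cov \<phi> Q n e) e"
  have pos: "0 \<le> ?X" "0 \<le> ?Y" by (rule P.error_cov_nonneg Q.error_cov_nonneg)+
  have "a \<ge> 0" using a by (meson order_trans sum_nonneg zero_le_power2)
  have "?X - ?Y = inner (D (error_cov \<phi> P n e)) (D (error_cov \<phi> Q n e))"
    using error_cov_resolvent_identity[of \<phi> n e] by (simp add: D.sym)
  also have "\<dots> \<le> norm (D (error_cov \<phi> P n e)) * norm (D (error_cov \<phi> Q n e))"
    by (rule norm_cauchy_schwarz)
  also have "\<dots> \<le> sqrt (a * ?X) * sqrt (a * ?Y)"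
    using norm_D_error_cov_le[OF _ a] \<open>a \<ge> 0\<close> pos by (intro mult_mono real_le_rsqrt) auto
  also have "\<dots> = a * sqrt (?X * ?Y)"
    using \<open>a \<ge> 0\<close> by (simp add: real_sqrt_mult)
  finally have xy: "?X - ?Y \<le> a * sqrt (?X * ?Y)" .
  show ?thesis
  proof (cases "?Y \<le> ?X")
    case True
    then have "sqrt (?X * ?Y) \<le> sqrt (?X * ?X)" using pos by (intro real_sqrt_le_mono mult_left_mono)
    then have "a * sqrt (?X * ?Y) \<le> a * ?X" using \<open>a \<ge> 0\<close> pos by (intro mult_left_mono) auto
    then show ?thesis using xy by (simp add: algebra_simps)
  next
    case False
    moreover have "0 \<le> a * ?X" using \<open>a \<ge> 0\<close> pos by simp
    ultimately show ?thesis by (simp add: algebra_simps)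
  qed
qed

end

text \<open>With everything observed the modes do not interact, and the pivots are the eigenvalues
  of \<open>I + K\<close>.\<close>

lemma residual_orthogonal_family:
  assumes "\<And>i j. i \<noteq> j \<Longrightarrow> inner (\<phi> i) (\<phi> j) = 0"
  shows "residual \<phi> (\<lambda>h. h) n = \<phi> n" "pivot \<phi> (\<lambda>h. h) n = 1 + (norm (\<phi> n))\<^sup>2"
proof -
  let ?C = "error_cov \<phi> (\<lambda>h. h) n (\<phi> n)"
  have "gram_op \<phi> n (\<phi> n) = 0"
    unfolding gram_op_def by (rule sum.neutral) (auto simp: assms)
  then have "?C + gram_op \<phi> n ?C = 0"
    using orthogonal_projection.error_cov_resolvent[OF orthogonal_projection_id, of \<phi> n "\<phi> n"] by simp
  then have "inner ?C ?C + inner (gram_op \<phi> n ?C) ?C = 0" by (metis inner_add_left inner_zero_left)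
  then have "inner ?C ?C = 0" using gram_op_nonneg[of \<phi> n ?C] inner_ge_zero[of ?C] by linarith
  then show "residual \<phi> (\<lambda>h. h) n = \<phi> n" by (simp add: residual_def)
  then show "pivot \<phi> (\<lambda>h. h) n = 1 + (norm (\<phi> n))\<^sup>2"
    by (simp add: pivot_def power2_norm_eq_inner)
qed

lemma residual_zero_projection:
  "residual \<phi> (\<lambda>h. 0) n = \<phi> n" "pivot \<phi> (\<lambda>h. 0) n = 1"
  by (simp_all add: residual_def pivot_def error_cov_linear)

section \<open>The Fredholm determinant\<close>

text \<open>Leibniz's determinant with an arbitrary finite index set, as needed for compressions to
  finite sets of basis vectors.\<close>

definition minor_det :: "('b \<Rightarrow> 'b \<Rightarrow> real) \<Rightarrow> 'b set \<Rightarrow> real" where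
  "minor_det a S = (\<Sum>\<sigma> | \<sigma> permutes S. of_int (sign \<sigma>) * (\<Prod>b\<in>S. a b (\<sigma> b)))"

lemma minor_det_cong:
  assumes "\<And>b c. b \<in> S \<Longrightarrow> c \<in> S \<Longrightarrow> a b c = a' b c"
  shows "minor_det a S = minor_det a' S"
  unfolding minor_det_def using assms
  by (intro sum.cong refl arg_cong2[of _ _ _ _ "(*)"] prod.cong) (auto simp: permutes_in_image)

text \<open>Composition with the transposition pairs the permutations into terms that cancel; every
  vanishing of determinants with equal rows or columns below is an instance.\<close>

lemma alternating_sum_zero:
  fixes F :: "('b \<Rightarrow> 'b) \<Rightarrow> real"
  assumes "finite S" "b \<in> S" "c \<in> S" "b \<noteq> c"
    and F: "\<And>\<sigma>. \<sigma> permutes S \<Longrightarrow> F (\<sigma> \<circ> Transposition.transpose b c) = F \<sigma>"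
  shows "(\<Sum>\<sigma> | \<sigma> permutes S. of_int (sign \<sigma>) * F \<sigma>) = 0"
proof -
  let ?t = "Transposition.transpose b c"
  have t: "?t permutes S" using assms by (intro permutes_swap_id)
  have "(\<Sum>\<sigma> | \<sigma> permutes S. of_int (sign \<sigma>) * F \<sigma>)
      = (\<Sum>\<sigma> | \<sigma> permutes S. of_int (sign (\<sigma> \<circ> ?t)) * F (\<sigma> \<circ> ?t))"
    by (rule sum.reindex_bij_witness[of _ "\<lambda>\<sigma>. \<sigma> \<circ> ?t" "\<lambda>\<sigma>. \<sigma> \<circ> ?t"])
       (auto simp: o_assoc[symmetric] permutes_compose[OF t])
  also have "\<dots> = (\<Sum>\<sigma> | \<sigma> permutes S. - (of_int (sign \<sigma>) * F \<sigma>))"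
  proof (intro sum.cong refl)
    fix \<sigma> assume "\<sigma> \<in> {\<sigma>. \<sigma> permutes S}"
    then have "\<sigma> permutes S" by simp
    then have "sign (\<sigma> \<circ> ?t) = - sign \<sigma>"
      using assms(4) permutation_permutes assms(1)
      by (subst sign_compose) (auto simp: sign_swap_id permutation_swap_id)
    then show "of_int (sign (\<sigma> \<circ> ?t)) * F (\<sigma> \<circ> ?t) = - (of_int (sign \<sigma>) * F \<sigma>)"
      using F[OF \<open>\<sigma> permutes S\<close>] by simp
  qed
  finally show ?thesis by (simp add: sum_negf)
qed

text \<open>Expand each factor \<open>\<delta> + a\<close>; taking \<open>\<delta>\<close> outside \<open>T\<close> forces the permutation to fix the
  complement of \<open>T\<close>.\<close>

lemma minor_det_one_plus:
  assumes "finite S"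
  shows "minor_det (\<lambda>b c. (if b = c then 1 else 0) + a b c) S = (\<Sum>T\<in>Pow S. minor_det a T)"
proof -
  let ?d = "\<lambda>b c. if b = c then 1 else (0 :: real)"
  have "minor_det (\<lambda>b c. ?d b c + a b c) S
      = (\<Sum>\<sigma> | \<sigma> permutes S. \<Sum>T\<in>Pow S. of_int (sign \<sigma>) * ((\<Prod>b\<in>T. a b (\<sigma> b)) * (\<Prod>b\<in>S - T. ?d b (\<sigma> b))))"
    unfolding minor_det_def
    by (subst add.commute) (simp only: prod_add[OF assms] sum_distrib_left)
  also have "\<dots> = (\<Sum>T\<in>Pow S. \<Sum>\<sigma> | \<sigma> permutes S. of_int (sign \<sigma>) * ((\<Prod>b\<in>T. a b (\<sigma> b)) * (\<Prod>b\<in>S - T. ?d b (\<sigma> b))))"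
    by (rule sum.swap)
  also have "\<dots> = (\<Sum>T\<in>Pow S. minor_det a T)"
  proof (intro sum.cong refl)
    fix T assume "T \<in> Pow S"
    then have TS: "T \<subseteq> S" by simp
    have "(\<Sum>\<sigma> | \<sigma> permutes S. of_int (sign \<sigma>) * ((\<Prod>b\<in>T. a b (\<sigma> b)) * (\<Prod>b\<in>S - T. ?d b (\<sigma> b))))
        = (\<Sum>\<sigma> | \<sigma> permutes T. of_int (sign \<sigma>) * ((\<Prod>b\<in>T. a b (\<sigma> b)) * (\<Prod>b\<in>S - T. ?d b (\<sigma> b))))"
    proof (rule sum.mono_neutral_right)
      show "finite {\<sigma>. \<sigma> permutes S}" using assms by (rule finite_permutations)
      show "{\<sigma>. \<sigma> permutes T} \<subseteq> {\<sigma>. \<sigma> permutes S}" using TS permutes_subset by blast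
      show "\<forall>\<sigma>\<in>{\<sigma>. \<sigma> permutes S} - {\<sigma>. \<sigma> permutes T}.
          of_int (sign \<sigma>) * ((\<Prod>b\<in>T. a b (\<sigma> b)) * (\<Prod>b\<in>S - T. ?d b (\<sigma> b))) = 0"
      proof
        fix \<sigma> assume "\<sigma> \<in> {\<sigma>. \<sigma> permutes S} - {\<sigma>. \<sigma> permutes T}"
        then obtain b where "b \<in> S - T" "\<sigma> b \<noteq> b" using permutes_superset by blast
        then have "(\<Prod>b\<in>S - T. ?d b (\<sigma> b)) = 0" using assms by (intro prod_zero) force+
        then show "of_int (sign \<sigma>) * ((\<Prod>b\<in>T. a b (\<sigma> b)) * (\<Prod>b\<in>S - T. ?d b (\<sigma> b))) = 0" by simp
      qed
    qed
    also have "\<dots> = minor_det a T"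
      unfolding minor_det_def
    proof (intro sum.cong refl)
      fix \<sigma> assume "\<sigma> \<in> {\<sigma>. \<sigma> permutes T}"
      then have "(\<Prod>b\<in>S - T. ?d b (\<sigma> b)) = 1" by (intro prod.neutral) (auto simp: permutes_not_in)
      then show "of_int (sign \<sigma>) * ((\<Prod>b\<in>T. a b (\<sigma> b)) * (\<Prod>b\<in>S - T. ?d b (\<sigma> b)))
          = of_int (sign \<sigma>) * (\<Prod>b\<in>T. a b (\<sigma> b))" by simp
    qed
    finally show "(\<Sum>\<sigma> | \<sigma> permutes S. of_int (sign \<sigma>) * ((\<Prod>b\<in>T. a b (\<sigma> b)) * (\<Prod>b\<in>S - T. ?d b (\<sigma> b))))
        = minor_det a T" .
  qed
  finally show ?thesis .
qed

lemma minor_det_identity: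
  assumes "finite S"
  shows "minor_det (\<lambda>b c. if b = c then 1 else 0) S = 1"
proof -
  have "minor_det (\<lambda>_ _. 0) T = (if T = {} then 1 else 0)" if "T \<in> Pow S" for T :: "'a set"
  proof -
    have "finite T" using that assms finite_subset by auto
    then show ?thesis by (cases "T = {}") (simp_all add: minor_det_def power_0_left)
  qed
  then have "(\<Sum>T\<in>Pow S. minor_det (\<lambda>_ _. 0) T) = 1" using assms by simp
  then show ?thesis using minor_det_one_plus[OF assms, of "\<lambda>_ _. 0"] by simp
qed

lemma minor_det_scale:
  "minor_det (\<lambda>b c. k * a b c) S = k ^ card S * minor_det a S"
  by (simp add: minor_det_def prod.distrib sum_distrib_left mult_ac)

text \<open>The matrix determinant lemma. The vector \<open>x\<close> solves \<open>x a = v\<close>, which replaces the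
  inverse matrix; in the applications the residual supplies it.\<close>

lemma minor_det_rank_one_update:
  assumes S: "finite S"
    and v: "\<And>c. c \<in> S \<Longrightarrow> v c = (\<Sum>b\<in>S. x b * a b c)"
  shows "minor_det (\<lambda>b c. a b c + u b * v c) S = (1 + (\<Sum>b\<in>S. u b * x b)) * minor_det a S"
proof -
  define F where "F = (\<lambda>T \<sigma>. (\<Prod>b\<in>S - T. a b (\<sigma> b)) * (\<Prod>b\<in>T. u b * v (\<sigma> b)))"
  define G where "G = (\<lambda>T. \<Sum>\<sigma> | \<sigma> permutes S. of_int (sign \<sigma>) * F T \<sigma>)"
  have "minor_det (\<lambda>b c. a b c + u b * v c) S
      = (\<Sum>\<sigma> | \<sigma> permutes S. \<Sum>T\<in>Pow S. of_int (sign \<sigma>) * F T \<sigma>)"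
    unfolding minor_det_def F_def
    by (subst add.commute) (simp only: prod_add[OF S] sum_distrib_left mult.commute)
  also have "\<dots> = (\<Sum>T\<in>Pow S. G T)" unfolding G_def by (rule sum.swap)
  also have "\<dots> = (\<Sum>T\<in>insert {} ((\<lambda>b. {b}) ` S). G T)"
  proof (rule sum.mono_neutral_right)
    \<comment> \<open>Two rows taken from the rank-one part are proportional.\<close>
    show "\<forall>T\<in>Pow S - insert {} ((\<lambda>b. {b}) ` S). G T = 0"
    proof
      fix T assume T: "T \<in> Pow S - insert {} ((\<lambda>b. {b}) ` S)"
      then obtain b c where bc: "b \<in> T" "c \<in> T" "b \<noteq> c" by blast
      have TS: "T \<subseteq> S" using T by blast
      show "G T = 0"
        unfolding G_def
      proof (rule alternating_sum_zero[of S b c])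
        fix \<sigma> assume "\<sigma> permutes S"
        have "(\<Prod>b'\<in>S - T. a b' ((\<sigma> \<circ> Transposition.transpose b c) b')) = (\<Prod>b'\<in>S - T. a b' (\<sigma> b'))"
          using bc by (intro prod.cong refl) (metis DiffD2 comp_apply transpose_apply_other)
        moreover have "(\<Prod>b'\<in>T. v ((\<sigma> \<circ> Transposition.transpose b c) b')) = (\<Prod>b'\<in>T. v (\<sigma> b'))"
          using bc by (intro prod.reindex_bij_witness[of _ "Transposition.transpose b c" "Transposition.transpose b c"])
            (auto simp: Transposition.transpose_def)
        ultimately show "F T (\<sigma> \<circ> Transposition.transpose b c) = F T \<sigma>" by (simp add: F_def prod.distrib)
      qed (use bc TS S in auto)
    qed
  qed (use S in auto)
  also have "\<dots> = G {} + (\<Sum>b\<in>S. G {b})"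
    using S by (subst sum.insert) (auto simp: sum.reindex inj_on_def)
  also have "G {} = minor_det a S" by (simp add: G_def F_def minor_det_def)
  \<comment> \<open>Row \<open>b\<close> is replaced by \<open>v\<close>, a combination of the rows of \<open>a\<close>; only row \<open>b\<close> itself
    avoids a repetition.\<close>
  also have "(\<Sum>b\<in>S. G {b}) = (\<Sum>b\<in>S. u b * x b * minor_det a S)"
  proof (intro sum.cong refl)
    fix b assume b: "b \<in> S"
    define H where "H = (\<lambda>c \<sigma>. (\<Prod>b'\<in>S - {b}. a b' (\<sigma> b')) * a c (\<sigma> b))"
    have "G {b} = (\<Sum>\<sigma> | \<sigma> permutes S. \<Sum>c\<in>S. u b * x c * (of_int (sign \<sigma>) * H c \<sigma>))"
      unfolding G_def
    proof (intro sum.cong refl)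
      fix \<sigma> assume "\<sigma> \<in> {\<sigma>. \<sigma> permutes S}"
      then have "\<sigma> b \<in> S" using b permutes_in_image by fastforce
      then show "of_int (sign \<sigma>) * F {b} \<sigma> = (\<Sum>c\<in>S. u b * x c * (of_int (sign \<sigma>) * H c \<sigma>))"
        unfolding F_def H_def by (simp add: v sum_distrib_left sum_distrib_right mult_ac)
    qed
    also have "\<dots> = (\<Sum>c\<in>S. u b * x c * (\<Sum>\<sigma> | \<sigma> permutes S. of_int (sign \<sigma>) * H c \<sigma>))"
      by (subst sum.swap) (simp add: sum_distrib_left)
    also have "\<dots> = (\<Sum>c\<in>S. if c = b then u b * x b * minor_det a S else 0)"
    proof (intro sum.cong refl)
      fix c assume c: "c \<in> S"
      show "u b * x c * (\<Sum>\<sigma> | \<sigma> permutes S. of_int (sign \<sigma>) * H c \<sigma>)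
          = (if c = b then u b * x b * minor_det a S else 0)"
      proof (cases "c = b")
        case True
        then have "H c \<sigma> = (\<Prod>b'\<in>S. a b' (\<sigma> b'))" for \<sigma>
          using S b by (simp add: H_def prod.remove mult.commute)
        then show ?thesis using True by (simp add: minor_det_def)
      next
        case False
        have "(\<Sum>\<sigma> | \<sigma> permutes S. of_int (sign \<sigma>) * H c \<sigma>) = 0"
        proof (rule alternating_sum_zero[OF S b c])
          fix \<sigma>
          let ?t = "Transposition.transpose b c"
          have split: "H c \<tau> = (\<Prod>b'\<in>S - {b} - {c}. a b' (\<tau> b')) * (a c (\<tau> c) * a c (\<tau> b))" for \<tau>
            using S c False by (simp add: H_def prod.remove[of "S - {b}" c] mult_ac)
          have "(\<Prod>b'\<in>S - {b} - {c}. a b' ((\<sigma> \<circ> ?t) b')) = (\<Prod>b'\<in>S - {b} - {c}. a b' (\<sigma> b'))"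
            by (intro prod.cong refl) (auto simp: Transposition.transpose_def)
          then show "H c (\<sigma> \<circ> ?t) = H c \<sigma>" unfolding split by (simp add: mult.commute)
        qed (use False in auto)
        then show ?thesis using False by simp
      qed
    qed
    also have "\<dots> = u b * x b * minor_det a S" using S b by simp
    finally show "G {b} = u b * x b * minor_det a S" .
  qed
  finally show ?thesis by (simp add: sum_distrib_right distrib_right)
qed

lemma minor_det_tendsto:
  assumes "finite S" "\<And>b c. b \<in> S \<Longrightarrow> c \<in> S \<Longrightarrow> ((\<lambda>n. f n b c) \<longlongrightarrow> a b c) F"
  shows "((\<lambda>n. minor_det (f n) S) \<longlongrightarrow> minor_det a S) F"
  unfolding minor_det_def using assms(2)
  by (intro tendsto_intros) (auto simp: permutes_in_image)

lemma residual_eq_sum: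
  "residual \<phi> P n = \<phi> n - (\<Sum>i<n. (inner (residual \<phi> P i) (P (\<phi> n)) / pivot \<phi> P i) *\<^sub>R residual \<phi> P i)"
  by (subst residual_def) (simp only: error_cov_eq_sum)

text \<open>Each residual is a finite expression in the earlier residuals and pivots, hence
  strongly continuous in the projection.\<close>

lemma residual_pivot_tendsto:
  assumes sym: "\<And>s h k. inner (Pr s h) k = inner h (Pr s k)" "\<And>h k. inner (Q h) k = inner h (Q k)"
    and lim: "\<And>h. ((\<lambda>s. Pr s h) \<longlongrightarrow> Q h) F"
    and ge: "\<And>n. 1 \<le> pivot \<phi> Q n"
  shows "((\<lambda>s. residual \<phi> (Pr s) n) \<longlongrightarrow> residual \<phi> Q n) F \<and> ((\<lambda>s. pivot \<phi> (Pr s) n) \<longlongrightarrow> pivot \<phi> Q n) F"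
proof (induction n rule: less_induct)
  case (less n)
  have r: "((\<lambda>s. residual \<phi> (Pr s) n) \<longlongrightarrow> residual \<phi> Q n) F"
    unfolding residual_eq_sum[of _ _ n]
  proof (intro tendsto_intros lim)
    fix i assume "i \<in> {..<n}"
    then have "i < n" by simp
    show "((\<lambda>s. residual \<phi> (Pr s) i) \<longlongrightarrow> residual \<phi> Q i) F"
      "((\<lambda>s. residual \<phi> (Pr s) i) \<longlongrightarrow> residual \<phi> Q i) F"
      "((\<lambda>s. pivot \<phi> (Pr s) i) \<longlongrightarrow> pivot \<phi> Q i) F" using less[OF \<open>i < n\<close>] by auto
    show "pivot \<phi> Q i \<noteq> 0" using ge[of i] by simp
  qed
  have "((\<lambda>s. 1 + inner (Pr s (\<phi> n)) (residual \<phi> (Pr s) n)) \<longlongrightarrow> 1 + inner (Q (\<phi> n)) (residual \<phi> Q n)) F"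
    by (intro tendsto_intros r lim)
  then show ?case using r by (simp add: pivot_def sym)
qed

text \<open>The form in which a positive trace class operator is used: \<open>A = \<Sum>\<^sub>i \<phi>\<^sub>i \<otimes> \<phi>\<^sub>i\<close> with
  orthogonal \<open>\<phi>\<^sub>i\<close>, that is, eigenvectors scaled by the square roots of their
  eigenvalues.\<close>

locale orthogonal_family =
  fixes \<phi> :: "nat \<Rightarrow> 'h::{real_inner, banach, second_countable_topology}" and A :: "'h \<Rightarrow>\<^sub>L 'h"
  assumes orth: "i \<noteq> j \<Longrightarrow> inner (\<phi> i) (\<phi> j) = 0"
    and summ: "summable (\<lambda>i. (norm (\<phi> i))\<^sup>2)"
    and A: "(\<lambda>i. inner (\<phi> i) h *\<^sub>R \<phi> i) sums A h"
begin

definition log_det :: real where "log_det = (\<Sum>i. ln (1 + (norm (\<phi> i))\<^sup>2))"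

lemma summable_ln: "summable (\<lambda>i. ln (1 + (norm (\<phi> i))\<^sup>2))"
  by (rule summable_comparison_test[OF _ summ]) (auto simp: ln_add_one_self_le_self)

lemma gram_op_tendsto: "(\<lambda>n. gram_op \<phi> n h) \<longlonglongrightarrow> A h"
  using A[of h] by (simp add: sums_def gram_op_def)

lemma prod_eq_exp: "(\<Prod>i<n. 1 + (norm (\<phi> i))\<^sup>2) = exp (\<Sum>i<n. ln (1 + (norm (\<phi> i))\<^sup>2))"
  by (simp add: exp_sum add_pos_nonneg)

lemma prod_tendsto: "(\<lambda>n. \<Prod>i<n. 1 + (norm (\<phi> i))\<^sup>2) \<longlonglongrightarrow> exp log_det"
  unfolding prod_eq_exp log_det_def by (intro tendsto_intros summable_LIMSEQ summable_ln)

lemma prod_le: "(\<Prod>i<n. 1 + (norm (\<phi> i))\<^sup>2) \<le> exp log_det"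
  unfolding prod_eq_exp log_det_def
  by (simp, intro sum_le_suminf summable_ln) auto

end

lemma orthogonal_projection_partial_proj:
  assumes "orthonormal_or_zero e S" "finite S"
  shows "orthogonal_projection (partial_proj e S)"
proof (rule orthogonal_projection.intro)
  show "linear (partial_proj e S)"
    by (auto simp: linear_iff partial_proj_def inner_add_left scaleR_add_left sum.distrib scaleR_sum_right)
next
  fix h
  have "partial_proj e S h \<in> span (e ` S)"
    unfolding partial_proj_def by (intro span_sum span_scale span_base) auto
  then show "partial_proj e S (partial_proj e S h) = partial_proj e S h"
    by (rule partial_proj_id_on_span[OF assms])
qed (rule inner_partial_proj_commute)

context orthogonal_family begin

definition compressed_det :: "'h set \<Rightarrow> real" where
  "compressed_det S = minor_det (\<lambda>b c. (if b = c then 1 else 0) + inner b (A c)) S"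

context
  fixes S :: "'h set"
  assumes S: "finite S" "orthonormal_or_zero (\<lambda>b. b) S" "0 \<notin> S"
begin

interpretation P: orthogonal_projection "partial_proj (\<lambda>b. b) S"
  using S by (intro orthogonal_projection_partial_proj)

text \<open>Adding one mode is a rank-one update of the compressed matrix, and the residual of the
  mode solves the linear system that the update formula asks for.\<close>

lemma minor_det_gram_op:
  "minor_det (\<lambda>b c. (if b = c then 1 else 0) + inner b (gram_op \<phi> n c)) S
     = (\<Prod>i<n. pivot \<phi> (partial_proj (\<lambda>b. b) S) i)"
proof (induction n)
  case 0
  show ?case using minor_det_identity[OF S(1)] by (simp add: gram_op_def)
next
  case (Suc n)
  let ?P = "partial_proj (\<lambda>b. b) S"
  let ?\<psi> = "residual \<phi> ?P n"
  let ?a = "\<lambda>b c. (if b = c then 1 else 0) + inner b (gram_op \<phi> n c)"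
  have "minor_det (\<lambda>b c. (if b = c then 1 else 0) + inner b (gram_op \<phi> (Suc n) c)) S
      = minor_det (\<lambda>b c. ?a b c + inner b (\<phi> n) * inner (\<phi> n) c) S"
    by (rule minor_det_cong) (simp add: gram_op_Suc inner_add_right)
  also have "\<dots> = (1 + (\<Sum>b\<in>S. inner b (\<phi> n) * inner ?\<psi> b)) * minor_det ?a S"
  proof (rule minor_det_rank_one_update[OF S(1)])
    fix c assume c: "c \<in> S"
    have "(\<Sum>b\<in>S. inner ?\<psi> b * ?a b c) = (\<Sum>b\<in>S. if b = c then inner ?\<psi> c else 0) + inner (?P ?\<psi>) (gram_op \<phi> n c)"
    proof -
      have "inner ?\<psi> b * ?a b c = (if b = c then inner ?\<psi> c else 0) + inner ?\<psi> b * inner b (gram_op \<phi> n c)" for b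
        by (simp add: distrib_left)
      then show ?thesis by (simp only: sum.distrib partial_proj_def inner_sum_left inner_scaleR_left)
    qed
    also have "\<dots> = inner (?\<psi> + gram_op \<phi> n (?P ?\<psi>)) c"
      using S(1) c by (simp add: inner_add_left gram_op_sym)
    finally show "inner (\<phi> n) c = (\<Sum>b\<in>S. inner ?\<psi> b * ?a b c)"
      by (simp only: P.residual_resolvent)
  qed
  also have "1 + (\<Sum>b\<in>S. inner b (\<phi> n) * inner ?\<psi> b) = pivot \<phi> ?P n"
    by (simp add: pivot_def partial_proj_def inner_sum_right inner_commute mult.commute)
  finally show ?case by (simp add: Suc)
qed

lemma pivot_compressed_le: "pivot \<phi> (partial_proj (\<lambda>b. b) S) i \<le> 1 + (norm (\<phi> i))\<^sup>2"
proof -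
  have pair: "projection_pair (partial_proj (\<lambda>b. b) S) (\<lambda>h. h)"
    by (intro projection_pair.intro projection_pair_axioms.intro P.orthogonal_projection_axioms
        orthogonal_projection_id refl)
  have "0 \<le> pivot \<phi> (\<lambda>h. h) i - pivot \<phi> (partial_proj (\<lambda>b. b) S) i"
    by (rule order_trans[OF zero_le_power2 projection_pair.pivot_increment_bounds(1)[OF pair]])
  also have "pivot \<phi> (\<lambda>h. h) i = 1 + (norm (\<phi> i))\<^sup>2"
    by (rule residual_orthogonal_family) (rule orth)
  finally show ?thesis by simp
qed

lemma compressed_det_tendsto:
  "(\<lambda>n. \<Prod>i<n. pivot \<phi> (partial_proj (\<lambda>b. b) S) i) \<longlonglongrightarrow> compressed_det S"
  unfolding compressed_det_def minor_det_gram_op[symmetric]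
  by (intro minor_det_tendsto S tendsto_intros gram_op_tendsto)

lemma compressed_det_le: "compressed_det S \<le> exp log_det"
proof (rule LIMSEQ_le_const2[OF compressed_det_tendsto], intro exI allI impI)
  fix n
  have "(\<Prod>i<n. pivot \<phi> (partial_proj (\<lambda>b. b) S) i) \<le> (\<Prod>i<n. 1 + (norm (\<phi> i))\<^sup>2)"
    using pivot_compressed_le P.pivot_ge_1[of \<phi>] by (intro prod_mono) (auto intro: order_trans[OF zero_le_one])
  then show "(\<Prod>i<n. pivot \<phi> (partial_proj (\<lambda>b. b) S) i) \<le> exp log_det" using prod_le[of n] by simp
qed

lemma compressed_det_ge: "(\<Prod>i<n. pivot \<phi> (partial_proj (\<lambda>b. b) S) i) \<le> compressed_det S"
proof (rule LIMSEQ_le_const[OF compressed_det_tendsto], intro exI[of _ n] allI impI)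
  fix m assume "n \<le> m"
  then show "(\<Prod>i<n. pivot \<phi> (partial_proj (\<lambda>b. b) S) i) \<le> (\<Prod>i<m. pivot \<phi> (partial_proj (\<lambda>b. b) S) i)"
    using P.pivot_ge_1[of \<phi>] by (intro prod_mono2) (auto intro: order_trans[OF zero_le_one])
qed

lemma compressed_det_pos: "0 < compressed_det S"
  using compressed_det_ge[of 0] by simp

end

end

text \<open>A principal minor of \<open>A\<close> is the limit of \<open>det (s\<^sup>-\<^sup>1 I + A)\<close> over \<open>S\<close> as \<open>s \<rightarrow> \<infinity>\<close>, which
  up to a power of \<open>s\<close> is the determinant for the family scaled by \<open>\<surd>s\<close>, a product of
  pivots and so positive.\<close>

lemma (in orthogonal_family) principal_minor_nonneg:
  assumes S: "finite S" "orthonormal_or_zero (\<lambda>b. b) S" "0 \<notin> S"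
  shows "0 \<le> principal_minor A S"
proof -
  have pm: "principal_minor A S = minor_det (\<lambda>b c. inner b (A c)) S"
    by (simp add: principal_minor_def minor_det_def)
  let ?d = "\<lambda>b c :: 'h. if b = c then 1 else (0 :: real)"
  have nn: "0 \<le> minor_det (\<lambda>b c. inverse (real (Suc n)) * ?d b c + inner b (A c)) S" for n
  proof -
    let ?s = "real (Suc n)"
    interpret scaled: orthogonal_family "\<lambda>i. sqrt ?s *\<^sub>R \<phi> i" "?s *\<^sub>R A"
    proof
      show "summable (\<lambda>i. (norm (sqrt ?s *\<^sub>R \<phi> i))\<^sup>2)"
        using summable_mult[OF summ, of ?s] by (simp add: power_mult_distrib del: of_nat_Suc)
      have eq: "(\<lambda>i. inner (sqrt ?s *\<^sub>R \<phi> i) h *\<^sub>R sqrt ?s *\<^sub>R \<phi> i) = (\<lambda>i. ?s *\<^sub>R (inner (\<phi> i) h *\<^sub>R \<phi> i))" for h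
      proof
        fix i
        have "inner (sqrt ?s *\<^sub>R \<phi> i) h *\<^sub>R sqrt ?s *\<^sub>R \<phi> i = (sqrt ?s * sqrt ?s) *\<^sub>R (inner (\<phi> i) h *\<^sub>R \<phi> i)"
          by (simp only: inner_scaleR_left scaleR_scaleR mult_ac)
        also have "sqrt ?s * sqrt ?s = ?s" by simp
        finally show "inner (sqrt ?s *\<^sub>R \<phi> i) h *\<^sub>R sqrt ?s *\<^sub>R \<phi> i = ?s *\<^sub>R (inner (\<phi> i) h *\<^sub>R \<phi> i)" .
      qed
      show "(\<lambda>i. inner (sqrt ?s *\<^sub>R \<phi> i) h *\<^sub>R sqrt ?s *\<^sub>R \<phi> i) sums blinfun_apply (?s *\<^sub>R A) h" for h
        unfolding eq blinfun.scaleR_left by (intro sums_scaleR_right A)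
    qed (use orth in auto)
    have "minor_det (\<lambda>b c. inverse ?s * ?d b c + inner b (A c)) S
        = minor_det (\<lambda>b c. inverse ?s * (?d b c + inner b ((?s *\<^sub>R A) c))) S"
      by (rule minor_det_cong) (simp add: blinfun.scaleR_left field_simps del: of_nat_Suc)
    also have "\<dots> = inverse ?s ^ card S * scaled.compressed_det S"
      by (simp add: minor_det_scale scaled.compressed_det_def del: of_nat_Suc)
    also have "\<dots> \<ge> 0" using scaled.compressed_det_pos[OF S] by simp
    finally show ?thesis .
  qed
  have "(\<lambda>n. minor_det (\<lambda>b c. inverse (real (Suc n)) * ?d b c + inner b (A c)) S)
      \<longlonglongrightarrow> minor_det (\<lambda>b c. 0 * ?d b c + inner b (A c)) S"
    by (intro minor_det_tendsto[OF S(1)] tendsto_intros LIMSEQ_inverse_real_of_nat)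
  then have "0 \<le> minor_det (\<lambda>b c. 0 * ?d b c + inner b (A c)) S"
    using nn by (intro LIMSEQ_le_const) auto
  then show ?thesis by (simp add: pm)
qed

context orthogonal_family begin

text \<open>Sums over all subsets of a finite \<open>S\<close> are the compressed determinants, at most
  \<open>\<Prod>\<^sub>i (1 + |\<phi>\<^sub>i|\<^sup>2)\<close>. As \<open>S\<close> grows the projections onto its span tend to the identity,
  each pivot to its value \<open>1 + |\<phi>\<^sub>i|\<^sup>2\<close>, and finitely many pivots already come close to
  the full product. Nonnegativity of the minors turns this into unconditional
  summability.\<close>

lemma principal_minor_has_sum:
  assumes B: "orthonormal_basis B"
  shows "(principal_minor A has_sum exp log_det) {S. finite S \<and> S \<subseteq> B}"
proof -
  have on: "orthonormal_or_zero (\<lambda>b. b) B" and B0: "0 \<notin> B" and cl: "closure (span B) = UNIV"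
    using B by (auto simp: orthonormal_basis_def orthonormal_or_zero_def pairwise_def orthogonal_def)
  have sub: "finite S \<Longrightarrow> S \<subseteq> B \<Longrightarrow> finite S \<and> orthonormal_or_zero (\<lambda>b. b) S \<and> 0 \<notin> S" for S
    using on B0 orthonormal_or_zero_subset by blast
  have sumPow: "(\<Sum>T\<in>Pow S. principal_minor A T) = compressed_det S" if "finite S" for S
    using minor_det_one_plus[OF that, of "\<lambda>b c. inner b (A c)"]
    by (simp add: compressed_det_def principal_minor_def minor_det_def)
  have nonneg: "0 \<le> principal_minor A T" if "finite T" "T \<subseteq> B" for T
    using principal_minor_nonneg sub that by blast
  have approach: "\<exists>S. finite S \<and> S \<subseteq> B \<and> exp log_det - \<epsilon> < compressed_det S" if "\<epsilon> > 0" for \<epsilon>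
  proof -
    have "\<forall>\<^sub>F n in sequentially. exp log_det - \<epsilon> < (\<Prod>i<n. 1 + (norm (\<phi> i))\<^sup>2)"
      using that by (intro order_tendstoD[OF prod_tendsto]) simp
    then obtain n where n: "exp log_det - \<epsilon> < (\<Prod>i<n. 1 + (norm (\<phi> i))\<^sup>2)"
      by (auto simp: eventually_sequentially)
    have "((\<lambda>S. partial_proj (\<lambda>b. b) S h) \<longlongrightarrow> h) (finite_subsets_at_top B)" for h
      using orthonormal_expansion[OF on, of h] cl by (simp add: has_sum_def partial_proj_def)
    then have "((\<lambda>S. pivot \<phi> (partial_proj (\<lambda>b. b) S) i) \<longlongrightarrow> pivot \<phi> (\<lambda>h. h) i) (finite_subsets_at_top B)" for i
      by (intro residual_pivot_tendsto[THEN conjunct2])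
         (auto simp: inner_partial_proj_commute residual_orthogonal_family(2) orth)
    then have "((\<lambda>S. \<Prod>i<n. pivot \<phi> (partial_proj (\<lambda>b. b) S) i) \<longlongrightarrow> (\<Prod>i<n. 1 + (norm (\<phi> i))\<^sup>2)) (finite_subsets_at_top B)"
      using orth by (intro tendsto_prod) (simp add: residual_orthogonal_family(2))
    then have "\<forall>\<^sub>F S in finite_subsets_at_top B. exp log_det - \<epsilon> < (\<Prod>i<n. pivot \<phi> (partial_proj (\<lambda>b. b) S) i)"
      using n by (rule order_tendstoD)
    then obtain S where S: "finite S" "S \<subseteq> B" "exp log_det - \<epsilon> < (\<Prod>i<n. pivot \<phi> (partial_proj (\<lambda>b. b) S) i)"
      unfolding eventually_finite_subsets_at_top by blast
    then show ?thesis using compressed_det_ge[of S n] sub by (meson less_le_trans)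
  qed
  show ?thesis
    unfolding has_sum_def
  proof (rule tendstoI)
    fix \<epsilon> :: real assume "\<epsilon> > 0"
    from approach[OF this] obtain S where S: "finite S" "S \<subseteq> B" "exp log_det - \<epsilon> < compressed_det S" by blast
    show "\<forall>\<^sub>F G in finite_subsets_at_top {S. finite S \<and> S \<subseteq> B}. dist (sum (principal_minor A) G) (exp log_det) < \<epsilon>"
      unfolding eventually_finite_subsets_at_top
    proof (intro exI[of _ "Pow S"] conjI allI impI)
      show "finite (Pow S)" "Pow S \<subseteq> {S. finite S \<and> S \<subseteq> B}" using S finite_subset by auto
      fix G assume G: "finite G \<and> Pow S \<subseteq> G \<and> G \<subseteq> {S. finite S \<and> S \<subseteq> B}"
      have "compressed_det S \<le> sum (principal_minor A) G"
        unfolding sumPow[OF S(1), symmetric]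
      proof (rule sum_mono2)
        show "0 \<le> principal_minor A T" if "T \<in> G - Pow S" for T
          using that G by (intro nonneg) auto
      qed (use G in blast)+
      moreover have "sum (principal_minor A) G \<le> exp log_det"
      proof -
        have fin: "finite (\<Union>G)" "\<Union>G \<subseteq> B" using G by auto
        have "sum (principal_minor A) G \<le> sum (principal_minor A) (Pow (\<Union>G))"
          using fin nonneg by (intro sum_mono2) (auto, meson finite_subset order_trans)
        also have "\<dots> = compressed_det (\<Union>G)" by (rule sumPow[OF fin(1)])
        also have "\<dots> \<le> exp log_det" using compressed_det_le sub[OF fin] by blast
        finally show ?thesis .
      qed
      ultimately show "dist (sum (principal_minor A) G) (exp log_det) < \<epsilon>"
        using S(3) by (simp add: dist_real_def)
    qed
  qed
qed

lemma fredholm_det_eq: "fredholm_det_one_plus A = exp log_det"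
  unfolding fredholm_det_one_plus_def
proof (rule the_equality)
  show "\<forall>B. orthonormal_basis B \<longrightarrow> (principal_minor A has_sum exp log_det) {S. finite S \<and> S \<subseteq> B}"
    using principal_minor_has_sum by blast
  fix d assume d: "\<forall>B. orthonormal_basis B \<longrightarrow> (principal_minor A has_sum d) {S. finite S \<and> S \<subseteq> B}"
  obtain e :: "nat \<Rightarrow> 'h" where e: "orthonormal_or_zero e UNIV"
      "range (\<lambda>h::'h. h) \<subseteq> closure (span (range e))"
    using orthonormal_system_of_range[OF bounded_linear_ident] by metis
  have "span (range e - {0}) = span (range e)" by (rule span_delete_0)
  then have "orthonormal_basis (range e - {0})"
    using e by (auto simp: orthonormal_basis_def orthonormal_or_zero_def pairwise_def orthogonal_def) metis
  then show "d = exp log_det" using d principal_minor_has_sum has_sum_unique by blast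
qed

end

section \<open>Partitions of a continuous nest of projections\<close>

locale continuous_nest =
  fixes p :: "real \<Rightarrow> 'h::{real_inner, banach, second_countable_topology} \<Rightarrow>\<^sub>L 'h"
  assumes projection: "t \<in> {0..1} \<Longrightarrow> orthogonal_projection (p t)"
    and nested: "0 \<le> s \<Longrightarrow> s \<le> t \<Longrightarrow> t \<le> 1 \<Longrightarrow> p t (p s h) = p s h"
      "0 \<le> s \<Longrightarrow> s \<le> t \<Longrightarrow> t \<le> 1 \<Longrightarrow> p s (p t h) = p s h"
    and continuous: "continuous_on {0..1} (\<lambda>t. p t h)"
    and start: "p 0 h = 0" and finish: "p 1 h = h"
begin

lemma nested_projection_pair: "0 \<le> s \<Longrightarrow> s \<le> t \<Longrightarrow> t \<le> 1 \<Longrightarrow> projection_pair (p s) (p t)"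
  by (intro projection_pair.intro projection_pair_axioms.intro projection nested) auto

text \<open>Uniform partitions suffice, since the function controlling the mesh is uniformly
  continuous.\<close>

definition node :: "nat \<Rightarrow> nat \<Rightarrow> real" where "node N j = real j / real N"

definition incr :: "nat \<Rightarrow> nat \<Rightarrow> 'h \<Rightarrow> 'h" where
  "incr N j h = p (node N (Suc j)) h - p (node N j) h"

lemma node_bounds:
  assumes "j < N"
  shows "0 \<le> node N j" "node N j \<le> node N (Suc j)" "node N (Suc j) \<le> 1"
    "node N j \<in> {0..1}" "node N (Suc j) \<in> {0..1}"
proof -
  have "real (Suc j) \<le> real N" using assms by simp
  then show 1: "0 \<le> node N j" "node N j \<le> node N (Suc j)" "node N (Suc j) \<le> 1"
    using assms by (auto simp: node_def divide_right_mono)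
  then show "node N j \<in> {0..1}" "node N (Suc j) \<in> {0..1}" by auto
qed

lemma node_mono: "i \<le> j \<Longrightarrow> node N i \<le> node N j"
  by (simp add: node_def divide_right_mono)

lemma pair_node: "j < N \<Longrightarrow> projection_pair (p (node N j)) (p (node N (Suc j)))"
  by (intro nested_projection_pair node_bounds)

lemma incr_eq_D:
  assumes "j < N"
  shows "incr N j = projection_pair.D (p (node N j)) (p (node N (Suc j)))"
  unfolding incr_def[abs_def] projection_pair.D_def[OF pair_node[OF assms], abs_def] ..

lemma incr_projection: "j < N \<Longrightarrow> orthogonal_projection (incr N j)"
  unfolding incr_def[abs_def]
  by (intro orthogonal_projection_diff projection nested node_bounds)

lemma telescope:
  fixes f :: "real \<Rightarrow> 'b::ab_group_add"
  assumes "0 < N"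
  shows "(\<Sum>j<N. f (node N (Suc j)) - f (node N j)) = f 1 - f 0"
  using sum_lessThan_telescope[of "\<lambda>j. f (node N j)" N] assms by (simp add: node_def)

lemma norm_incr_sq:
  assumes "j < N"
  shows "(norm (incr N j h))\<^sup>2 = (norm (p (node N (Suc j)) h))\<^sup>2 - (norm (p (node N j) h))\<^sup>2"
proof -
  interpret D: orthogonal_projection "incr N j" using assms by (rule incr_projection)
  have "inner (p t h) h = (norm (p t h))\<^sup>2" if "t \<in> {0..1}" for t
    using orthogonal_projection.inner_self[OF projection[OF that]] .
  then show ?thesis
    using D.inner_self[of h] node_bounds[OF assms] by (simp add: incr_def inner_diff_left)
qed

lemma norm_sq_eq_sum_incr:
  assumes "0 < N"
  shows "(norm h)\<^sup>2 = (\<Sum>j<N. (norm (incr N j h))\<^sup>2)"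
  using telescope[OF assms, of "\<lambda>t. (norm (p t h))\<^sup>2"] by (simp add: norm_incr_sq start finish)

lemma p_incr:
  assumes "j < N"
  shows "p (node N j) (incr N j h) = 0" "p (node N (Suc j)) (incr N j h) = incr N j h"
  using node_bounds[OF assms] nested[of "node N j" "node N (Suc j)" h] nested[of "node N (Suc j)" "node N (Suc j)" h]
    nested[of "node N j" "node N j" h]
  by (simp_all add: incr_def blinfun.diff_right)

lemma p_eq_self_mono: "0 \<le> s \<Longrightarrow> s \<le> t \<Longrightarrow> t \<le> 1 \<Longrightarrow> p s h = h \<Longrightarrow> p t h = h"
  using nested(1)[of s t h] by simp

lemma p_eq_zero_mono: "0 \<le> s \<Longrightarrow> s \<le> t \<Longrightarrow> t \<le> 1 \<Longrightarrow> p t h = 0 \<Longrightarrow> p s h = 0"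
  using nested(2)[of s t h] by simp

definition block_basis :: "nat \<Rightarrow> nat \<Rightarrow> nat \<Rightarrow> 'h" where
  "block_basis N j = (SOME e. orthonormal_or_zero e UNIV \<and> (\<forall>k. e k \<in> range (incr N j)) \<and>
     range (incr N j) \<subseteq> closure (span (range e)))"

lemma block_basis:
  assumes "j < N"
  shows "orthonormal_or_zero (block_basis N j) UNIV" "incr N j (block_basis N j k) = block_basis N j k"
    "range (incr N j) \<subseteq> closure (span (range (block_basis N j)))"
proof -
  interpret D: orthogonal_projection "incr N j" using assms by (rule incr_projection)
  have "\<exists>e. orthonormal_or_zero e (UNIV :: nat set) \<and> (\<forall>k. e k \<in> range (incr N j)) \<and>
     range (incr N j) \<subseteq> closure (span (range e))"
    using orthonormal_system_of_range[OF D.bounded] by metis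
  then have *: "orthonormal_or_zero (block_basis N j) UNIV \<and> (\<forall>k. block_basis N j k \<in> range (incr N j)) \<and>
     range (incr N j) \<subseteq> closure (span (range (block_basis N j)))"
    unfolding block_basis_def by (rule someI_ex)
  then show "orthonormal_or_zero (block_basis N j) UNIV"
    "range (incr N j) \<subseteq> closure (span (range (block_basis N j)))" by blast+
  obtain h where "block_basis N j k = incr N j h" using * by blast
  then show "incr N j (block_basis N j k) = block_basis N j k" by simp
qed

lemma block_basis_p:
  assumes "j < N"
  shows "p (node N j) (block_basis N j k) = 0" "p (node N (Suc j)) (block_basis N j k) = block_basis N j k"
  using p_incr[OF assms, of "block_basis N j k"] by (simp_all add: block_basis(2)[OF assms])

lemma block_basis_orthogonal:
  assumes "i < N" "j < N" "i \<noteq> j"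
  shows "inner (block_basis N i k) (block_basis N j l) = 0"
proof -
  have *: "inner (block_basis N i k) (block_basis N j l) = 0" if "i < j" "j < N" for i j k l
  proof -
    have i: "i < N" using that by simp
    have "p (node N j) (block_basis N i k) = block_basis N i k"
      using p_eq_self_mono[OF _ _ _ block_basis_p(2)[OF i]] node_bounds[OF i] node_bounds[OF that(2)]
        node_mono[of "Suc i" j N] that by simp
    then have "inner (block_basis N i k) (block_basis N j l) = inner (block_basis N i k) (p (node N j) (block_basis N j l))"
      using orthogonal_projection.sym[OF projection] node_bounds[OF that(2)] by metis
    then show ?thesis by (simp add: block_basis_p(1)[OF that(2)])
  qed
  show ?thesis
  proof (cases "i < j")
    case True
    then show ?thesis using * assms by blast
  next
    case False
    then have "j < i" using assms by simp
    then show ?thesis using *[of j i l k] assms by (simp add: inner_commute)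
  qed
qed

lemma block_parseval:
  assumes "j < N"
  shows "(\<lambda>k. (inner h (block_basis N j k))\<^sup>2) sums (norm (incr N j h))\<^sup>2"
proof -
  interpret D: orthogonal_projection "incr N j" using assms by (rule incr_projection)
  have "inner (incr N j h) (block_basis N j k) = inner h (block_basis N j k)" for k
    by (simp add: D.sym block_basis(2)[OF assms])
  then show ?thesis
    using parseval_sums[OF block_basis(1)[OF assms], of "incr N j h"] block_basis(3)[OF assms] by auto
qed

end

locale nest_with_family = continuous_nest p + orthogonal_family \<phi> A
  for p :: "real \<Rightarrow> 'h::{real_inner, banach, second_countable_topology} \<Rightarrow>\<^sub>L 'h"
    and \<phi> :: "nat \<Rightarrow> 'h" and A :: "'h \<Rightarrow>\<^sub>L 'h"
begin

text \<open>\<open>tr (\<Delta>\<^sub>j C)\<close> for the error covariance \<open>C\<close> with \<open>n\<close> modes and observations up to \<open>t\<close>,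
  written as a sum over modes; the next lemma identifies it with the sum over a basis of
  the block.\<close>

definition block_trace :: "nat \<Rightarrow> nat \<Rightarrow> real \<Rightarrow> nat \<Rightarrow> real" where
  "block_trace N j t n = (\<Sum>i<n. (norm (incr N j (residual \<phi> (p t) i)))\<^sup>2 / pivot \<phi> (p t) i)"

lemma block_trace_sums:
  assumes "j < N"
  shows "(\<lambda>k. inner (error_cov \<phi> (p t) n (block_basis N j k)) (block_basis N j k)) sums block_trace N j t n"
  unfolding inner_error_cov block_trace_def power2_eq_square[symmetric]
  by (intro sums_sum sums_divide block_parseval assms)

text \<open>Over the partition the logarithms of the pivots telescope from \<open>0\<close> at \<open>\<pi>\<^sub>0 = 0\<close> to
  \<open>ln (1 + |\<phi>\<^sub>i|\<^sup>2)\<close> at \<open>\<pi>\<^sub>1 = I\<close>. The two bounds are the Riemann sums at left and at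
  right ends.\<close>

lemma log_det_bounds:
  assumes N: "0 < N"
  shows "(\<Sum>i<n. ln (1 + (norm (\<phi> i))\<^sup>2)) \<le> (\<Sum>j<N. block_trace N j (node N j) n)"
    "(\<Sum>j<N. block_trace N j (node N (Suc j)) n) \<le> (\<Sum>i<n. ln (1 + (norm (\<phi> i))\<^sup>2))"
proof -
  have tel: "(\<Sum>j<N. \<Sum>i<n. ln (pivot \<phi> (p (node N (Suc j))) i) - ln (pivot \<phi> (p (node N j)) i))
      = (\<Sum>i<n. ln (1 + (norm (\<phi> i))\<^sup>2))"
  proof -
    have p1: "blinfun_apply (p 1) = (\<lambda>h. h)" and p0: "blinfun_apply (p 0) = (\<lambda>h. 0)"
      using start finish by auto
    have "(\<Sum>j<N. \<Sum>i<n. ln (pivot \<phi> (p (node N (Suc j))) i) - ln (pivot \<phi> (p (node N j)) i))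
        = (\<Sum>i<n. \<Sum>j<N. ln (pivot \<phi> (p (node N (Suc j))) i) - ln (pivot \<phi> (p (node N j)) i))"
      by (rule sum.swap)
    also have "\<dots> = (\<Sum>i<n. ln (pivot \<phi> (p 1) i) - ln (pivot \<phi> (p 0) i))"
      by (intro sum.cong refl telescope[OF N])
    finally show ?thesis
      unfolding p1 p0 by (simp add: residual_orthogonal_family(2)[OF orth] residual_zero_projection)
  qed
  have "ln (pivot \<phi> (p (node N (Suc j))) i) - ln (pivot \<phi> (p (node N j)) i)
      \<le> (norm (incr N j (residual \<phi> (p (node N j)) i)))\<^sup>2 / pivot \<phi> (p (node N j)) i" if "j < N" for i j
    unfolding incr_eq_D[OF that] by (rule projection_pair.ln_pivot_bounds(2)[OF pair_node[OF that]])
  then show "(\<Sum>i<n. ln (1 + (norm (\<phi> i))\<^sup>2)) \<le> (\<Sum>j<N. block_trace N j (node N j) n)"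
    unfolding tel[symmetric] block_trace_def by (intro sum_mono) auto
  have "(norm (incr N j (residual \<phi> (p (node N (Suc j))) i)))\<^sup>2 / pivot \<phi> (p (node N (Suc j))) i
      \<le> ln (pivot \<phi> (p (node N (Suc j))) i) - ln (pivot \<phi> (p (node N j)) i)" if "j < N" for i j
    unfolding incr_eq_D[OF that] by (rule projection_pair.ln_pivot_bounds(1)[OF pair_node[OF that]])
  then show "(\<Sum>j<N. block_trace N j (node N (Suc j)) n) \<le> (\<Sum>i<n. ln (1 + (norm (\<phi> i))\<^sup>2))"
    unfolding tel[symmetric] block_trace_def by (intro sum_mono) auto
qed

lemma block_trace_refinement:
  assumes j: "j < N" and a: "(\<Sum>i<n. (norm (incr N j (\<phi> i)))\<^sup>2) \<le> a"
  shows "(1 - a) * block_trace N j (node N j) n \<le> block_trace N j (node N (Suc j)) n"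
proof (rule sums_le[OF _ sums_mult[OF block_trace_sums[OF j]] block_trace_sums[OF j]])
  show "(1 - a) * inner (error_cov \<phi> (p (node N j)) n (block_basis N j k)) (block_basis N j k)
      \<le> inner (error_cov \<phi> (p (node N (Suc j))) n (block_basis N j k)) (block_basis N j k)" for k
    using a unfolding incr_eq_D[OF j]
    by (rule projection_pair.error_cov_refinement[OF pair_node[OF j]])
qed

text \<open>\<open>t \<mapsto> \<Sum>\<^sub>i |\<pi>\<^sub>t \<phi>\<^sub>i|\<^sup>2\<close> is continuous by the Weierstrass test, hence uniformly
  continuous, and its increments are the traces in question.\<close>

lemma fine_partition:
  assumes "0 < a"
  obtains N where "0 < N" "\<And>j n. j < N \<Longrightarrow> (\<Sum>i<n. (norm (incr N j (\<phi> i)))\<^sup>2) \<le> a"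
proof -
  have le: "(norm (p t (\<phi> i)))\<^sup>2 \<le> (norm (\<phi> i))\<^sup>2" if "t \<in> {0..1}" for t i
    using orthogonal_projection.norm_le[OF projection[OF that]] by (intro power_mono) auto
  define s where "s = (\<lambda>t. \<Sum>i. (norm (p t (\<phi> i)))\<^sup>2)"
  have summ_t: "summable (\<lambda>i. (norm (p t (\<phi> i)))\<^sup>2)" if "t \<in> {0..1}" for t
    using le[OF that] by (intro summable_comparison_test[OF _ summ]) auto
  have "continuous_on {0..1} s"
  proof (rule uniform_limit_theorem)
    show "\<forall>\<^sub>F n in sequentially. continuous_on {0..1} (\<lambda>t. \<Sum>i<n. (norm (p t (\<phi> i)))\<^sup>2)"
      by (intro always_eventually allI continuous_intros continuous)
    show "uniform_limit {0..1} (\<lambda>n t. \<Sum>i<n. (norm (p t (\<phi> i)))\<^sup>2) s sequentially"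
      unfolding s_def using le by (intro Weierstrass_m_test[OF _ summ]) auto
  qed simp
  then have "uniformly_continuous_on {0..1} s" by (rule compact_uniformly_continuous) simp
  then obtain d where d: "d > 0" "\<And>t u. t \<in> {0..1} \<Longrightarrow> u \<in> {0..1} \<Longrightarrow> dist u t < d \<Longrightarrow> dist (s u) (s t) < a"
    using assms unfolding uniformly_continuous_on_def by metis
  obtain m where m: "inverse (real (Suc m)) < d" using reals_Archimedean[OF d(1)] by blast
  let ?N = "Suc m"
  have "(\<Sum>i<n. (norm (incr ?N j (\<phi> i)))\<^sup>2) \<le> a" if j: "j < ?N" for j n
  proof -
    note nb = node_bounds[OF j]
    have "dist (node ?N (Suc j)) (node ?N j) = inverse (real ?N)"
      by (simp add: node_def dist_real_def field_simps)
    then have "dist (s (node ?N (Suc j))) (s (node ?N j)) < a" using m by (intro d nb) simp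
    then have "s (node ?N (Suc j)) - s (node ?N j) \<le> a" by (simp add: dist_real_def)
    moreover have "(\<lambda>i. (norm (incr ?N j (\<phi> i)))\<^sup>2) sums (s (node ?N (Suc j)) - s (node ?N j))"
      unfolding norm_incr_sq[OF j] s_def by (intro sums_diff summable_sums summ_t nb)
    then have "(\<Sum>i<n. (norm (incr ?N j (\<phi> i)))\<^sup>2) \<le> s (node ?N (Suc j)) - s (node ?N j)"
      by (metis sum_le_suminf[of _ "{..<n}"] sums_iff finite_lessThan zero_le_power2)
    ultimately show ?thesis by simp
  qed
  then show thesis using that[of ?N] by blast
qed

lemma partial_log_det_le: "(\<Sum>i<n. ln (1 + (norm (\<phi> i))\<^sup>2)) \<le> log_det"
  unfolding log_det_def by (intro sum_le_suminf summable_ln) auto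

end

section \<open>Scalar Gaussian variables\<close>

context prob_space begin

lemma real_centered_gaussian_measurable:
  "real_centered_gaussian M X \<Longrightarrow> X \<in> borel_measurable M"
  by (simp add: real_centered_gaussian_def)

lemma real_centered_gaussian_cases:
  assumes "real_centered_gaussian M X"
  obtains (zero) "AE \<omega> in M. X \<omega> = 0"
  | (scaled) \<sigma> Z where "0 < \<sigma>" "Z \<in> borel_measurable M" "distr M borel Z = std_normal_distribution"
      "X = (\<lambda>\<omega>. \<sigma> * Z \<omega>)"
proof (cases "AE \<omega> in M. X \<omega> = 0")
  case True
  then show thesis by (rule zero)
next
  case False
  then obtain \<sigma> where s: "0 < \<sigma>" and D: "distributed M lborel X (\<lambda>r. ennreal (normal_density 0 \<sigma> r))"
    using assms by (auto simp: real_centered_gaussian_def)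
  let ?Z = "\<lambda>\<omega>. X \<omega> / \<sigma>"
  have X: "X \<in> borel_measurable M" using assms by (rule real_centered_gaussian_measurable)
  have "distributed M lborel ?Z std_normal_density"
    using D normal_standard_normal_convert[OF s, of X 0] by simp
  then have "distr M lborel ?Z = std_normal_distribution"
    by (simp add: distributed_def)
  moreover have "distr M lborel ?Z = distr M borel ?Z" by (rule distr_cong) auto
  ultimately show thesis using s X by (intro scaled[of \<sigma> ?Z]) auto
qed

lemma std_normal_transfer:
  fixes g :: "real \<Rightarrow> 'c::{banach, second_countable_topology}"
  assumes "Z \<in> borel_measurable M" "distr M borel Z = std_normal_distribution" "g \<in> borel_measurable borel"
  shows "(\<integral>\<omega>. g (Z \<omega>) \<partial>M) = (\<integral>z. g z \<partial>std_normal_distribution)"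
    "integrable M (\<lambda>\<omega>. g (Z \<omega>)) \<longleftrightarrow> integrable std_normal_distribution g"
  using assms integral_distr[of Z M borel g] integrable_distr_eq[of Z M borel g] by auto

lemma real_centered_gaussian_integrable_power:
  assumes "real_centered_gaussian M X"
  shows "integrable M (\<lambda>\<omega>. X \<omega> ^ k)"
  using assms
proof (cases rule: real_centered_gaussian_cases)
  case zero
  have [measurable]: "X \<in> borel_measurable M" using assms by (rule real_centered_gaussian_measurable)
  have "integrable M (\<lambda>\<omega>. 0 ^ k :: real)" by simp
  then show ?thesis
    by (rule integrable_cong_AE_imp) (use zero in \<open>auto elim: AE_mp\<close>)
next
  case (scaled \<sigma> Z)
  have "integrable M (\<lambda>\<omega>. Z \<omega> ^ k)"
    using std_normal_transfer(2)[OF scaled(2,3), of "\<lambda>z. z ^ k"] integrable_std_normal_distribution_moment by simp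
  then show ?thesis by (simp add: scaled(4) power_mult_distrib)
qed

lemma real_centered_gaussian_moments:
  assumes "real_centered_gaussian M X"
  shows "(\<integral>\<omega>. X \<omega> \<partial>M) = 0" "(\<integral>\<omega>. X \<omega> ^ 4 \<partial>M) = 3 * (\<integral>\<omega>. (X \<omega>)\<^sup>2 \<partial>M)\<^sup>2"
    "(\<integral>\<omega>. iexp (t * X \<omega>) \<partial>M) = complex_of_real (exp (- (t\<^sup>2 * (\<integral>\<omega>. (X \<omega>)\<^sup>2 \<partial>M)) / 2))"
  using assms
proof (atomize (full), cases rule: real_centered_gaussian_cases)
  case zero
  have [measurable]: "X \<in> borel_measurable M" using assms by (rule real_centered_gaussian_measurable)
  have "(\<integral>\<omega>. X \<omega> \<partial>M) = (\<integral>\<omega>. 0 \<partial>M)" "(\<integral>\<omega>. X \<omega> ^ 4 \<partial>M) = (\<integral>\<omega>. 0 \<partial>M)"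
    "(\<integral>\<omega>. (X \<omega>)\<^sup>2 \<partial>M) = (\<integral>\<omega>. 0 \<partial>M)" "(\<integral>\<omega>. iexp (t * X \<omega>) \<partial>M) = (\<integral>\<omega>. 1 \<partial>M)"
    by (rule integral_cong_AE; use zero in \<open>auto elim: AE_mp\<close>)+
  then show "(\<integral>\<omega>. X \<omega> \<partial>M) = 0 \<and> (\<integral>\<omega>. X \<omega> ^ 4 \<partial>M) = 3 * (\<integral>\<omega>. (X \<omega>)\<^sup>2 \<partial>M)\<^sup>2 \<and>
    (\<integral>\<omega>. iexp (t * X \<omega>) \<partial>M) = complex_of_real (exp (- (t\<^sup>2 * (\<integral>\<omega>. (X \<omega>)\<^sup>2 \<partial>M)) / 2))"
    by (simp add: prob_space)
next
  case (scaled \<sigma> Z)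
  note tr = std_normal_transfer(1)[OF scaled(2,3)]
  have m1: "(\<integral>\<omega>. Z \<omega> \<partial>M) = 0"
    using tr[of "\<lambda>z. z"] integral_std_normal_distribution_moment_odd[of 1] by simp
  have m2: "(\<integral>\<omega>. (Z \<omega>)\<^sup>2 \<partial>M) = 1"
    using tr[of "\<lambda>z. z\<^sup>2"] std_normal_distribution_even_moments(1)[of 1] by simp
  have m4: "(\<integral>\<omega>. (Z \<omega>) ^ 4 \<partial>M) = 3"
    using tr[of "\<lambda>z. z ^ 4"] std_normal_distribution_even_moments(1)[of 2]
    by (simp add: fact_numeral)
  have "(\<integral>\<omega>. iexp (t * \<sigma> * Z \<omega>) \<partial>M) = char std_normal_distribution (t * \<sigma>)"
    using tr[of "\<lambda>z. iexp (t * \<sigma> * z)"] by (simp add: char_def mult.assoc)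
  then show "(\<integral>\<omega>. X \<omega> \<partial>M) = 0 \<and> (\<integral>\<omega>. X \<omega> ^ 4 \<partial>M) = 3 * (\<integral>\<omega>. (X \<omega>)\<^sup>2 \<partial>M)\<^sup>2 \<and>
    (\<integral>\<omega>. iexp (t * X \<omega>) \<partial>M) = complex_of_real (exp (- (t\<^sup>2 * (\<integral>\<omega>. (X \<omega>)\<^sup>2 \<partial>M)) / 2))"
    by (simp add: scaled(4) power_mult_distrib m1 m2 m4 char_std_normal_distribution mult.assoc)
qed

lemma gaussian_square_product_bound:
  assumes "real_centered_gaussian M X" "real_centered_gaussian M Y"
  shows "integrable M (\<lambda>\<omega>. (X \<omega>)\<^sup>2 * (Y \<omega>)\<^sup>2)"
    "(\<integral>\<omega>. (X \<omega>)\<^sup>2 * (Y \<omega>)\<^sup>2 \<partial>M) \<le> 3 * ((\<integral>\<omega>. (X \<omega>)\<^sup>2 \<partial>M) * (\<integral>\<omega>. (Y \<omega>)\<^sup>2 \<partial>M))"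
proof -
  have [measurable]: "X \<in> borel_measurable M" "Y \<in> borel_measurable M"
    using assms real_centered_gaussian_measurable by auto
  note iX = real_centered_gaussian_integrable_power[OF assms(1)]
  note iY = real_centered_gaussian_integrable_power[OF assms(2)]
  \<comment> \<open>A weighted form of \<open>2 a b \<le> a\<^sup>2 + b\<^sup>2\<close>; the weight is chosen at the end to balance the
    two fourth moments.\<close>
  have elem: "a\<^sup>2 * b\<^sup>2 \<le> (c * a ^ 4 + inverse c * b ^ 4) / 2" if "c > 0" for a b c :: real
  proof -
    have "0 \<le> inverse c * (c * a\<^sup>2 - b\<^sup>2)\<^sup>2" using that by simp
    also have "\<dots> = c * a ^ 4 + inverse c * b ^ 4 - 2 * (a\<^sup>2 * b\<^sup>2)"
      using that by (simp add: power2_eq_square power4_eq_xxxx field_simps)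
    finally show ?thesis by simp
  qed
  have half: "P \<le> (a + b) / 2 \<Longrightarrow> 0 \<le> a \<Longrightarrow> 0 \<le> b \<Longrightarrow> P \<le> a + b" for P a b :: real by simp
  show int: "integrable M (\<lambda>\<omega>. (X \<omega>)\<^sup>2 * (Y \<omega>)\<^sup>2)"
  proof (rule Bochner_Integration.integrable_bound[of M "\<lambda>\<omega>. X \<omega> ^ 4 + Y \<omega> ^ 4"])
    show "AE \<omega> in M. norm ((X \<omega>)\<^sup>2 * (Y \<omega>)\<^sup>2) \<le> norm (X \<omega> ^ 4 + Y \<omega> ^ 4)"
    proof (rule AE_I2)
      fix \<omega>
      have nn: "0 \<le> X \<omega> ^ 4" "0 \<le> Y \<omega> ^ 4" "0 \<le> (X \<omega>)\<^sup>2 * (Y \<omega>)\<^sup>2" by simp_all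
      have "(X \<omega>)\<^sup>2 * (Y \<omega>)\<^sup>2 \<le> X \<omega> ^ 4 + Y \<omega> ^ 4"
        using elem[OF zero_less_one, of "X \<omega>" "Y \<omega>"] unfolding mult_1 inverse_1 by (rule half) (rule nn)+
      then show "norm ((X \<omega>)\<^sup>2 * (Y \<omega>)\<^sup>2) \<le> norm (X \<omega> ^ 4 + Y \<omega> ^ 4)"
        using nn by (simp only: real_norm_def abs_of_nonneg add_nonneg_nonneg)
    qed
  qed (use iX iY in auto)
  define \<alpha> \<beta> where "\<alpha> = (\<integral>\<omega>. (X \<omega>)\<^sup>2 \<partial>M)" and "\<beta> = (\<integral>\<omega>. (Y \<omega>)\<^sup>2 \<partial>M)"
  have nn: "0 \<le> \<alpha>" "0 \<le> \<beta>" by (simp_all add: \<alpha>_def \<beta>_def)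
  have main: "(\<integral>\<omega>. (X \<omega>)\<^sup>2 * (Y \<omega>)\<^sup>2 \<partial>M) \<le> (c * (3 * \<alpha>\<^sup>2) + inverse c * (3 * \<beta>\<^sup>2)) / 2" if "c > 0" for c
  proof -
    have "(\<integral>\<omega>. (X \<omega>)\<^sup>2 * (Y \<omega>)\<^sup>2 \<partial>M) \<le> (\<integral>\<omega>. (c * X \<omega> ^ 4 + inverse c * Y \<omega> ^ 4) / 2 \<partial>M)"
      using int iX iY elem[OF that] by (intro integral_mono) auto
    also have "\<dots> = (c * (3 * \<alpha>\<^sup>2) + inverse c * (3 * \<beta>\<^sup>2)) / 2"
      using iX iY real_centered_gaussian_moments(2)[OF assms(1)] real_centered_gaussian_moments(2)[OF assms(2)]
      by (simp add: \<alpha>_def \<beta>_def)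
    finally show ?thesis .
  qed
  have zero: "(\<integral>\<omega>. (X \<omega>)\<^sup>2 * (Y \<omega>)\<^sup>2 \<partial>M) = 0" if "\<alpha> = 0 \<or> \<beta> = 0"
  proof -
    have "(AE \<omega> in M. (X \<omega>)\<^sup>2 = 0) \<or> (AE \<omega> in M. (Y \<omega>)\<^sup>2 = 0)"
      using that integral_nonneg_eq_0_iff_AE[of M "\<lambda>\<omega>. (X \<omega>)\<^sup>2"] integral_nonneg_eq_0_iff_AE[of M "\<lambda>\<omega>. (Y \<omega>)\<^sup>2"] iX iY
      by (auto simp: \<alpha>_def \<beta>_def)
    then have "AE \<omega> in M. (X \<omega>)\<^sup>2 * (Y \<omega>)\<^sup>2 = 0" by (auto elim: AE_mp)
    then have "(\<integral>\<omega>. (X \<omega>)\<^sup>2 * (Y \<omega>)\<^sup>2 \<partial>M) = (\<integral>\<omega>. 0 \<partial>M)" by (intro integral_cong_AE) auto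
    then show ?thesis by simp
  qed
  show "(\<integral>\<omega>. (X \<omega>)\<^sup>2 * (Y \<omega>)\<^sup>2 \<partial>M) \<le> 3 * ((\<integral>\<omega>. (X \<omega>)\<^sup>2 \<partial>M) * (\<integral>\<omega>. (Y \<omega>)\<^sup>2 \<partial>M))"
  proof (cases "\<alpha> = 0 \<or> \<beta> = 0")
    case True
    then show ?thesis using zero nn by (auto simp: \<alpha>_def \<beta>_def)
  next
    case False
    then have p: "0 < \<alpha>" "0 < \<beta>" using nn by auto
    have "((\<beta> / \<alpha>) * (3 * \<alpha>\<^sup>2) + inverse (\<beta> / \<alpha>) * (3 * \<beta>\<^sup>2)) / 2 = 3 * (\<alpha> * \<beta>)"
      using p by (simp add: field_simps power2_eq_square)
    then show ?thesis using main[of "\<beta> / \<alpha>"] p by (simp add: \<alpha>_def \<beta>_def)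
  qed
qed

text \<open>Paley-Zygmund: for \<open>S = \<Sum>\<^sub>k\<^sub><\<^sub>n g\<^sub>k\<^sup>2\<close> one has \<open>E S\<^sup>2 \<le> 3 (E S)\<^sup>2\<close>, so \<open>S\<close> exceeds half
  its mean with a probability bounded below, whatever the joint distribution. Were the
  means unbounded, \<open>f\<close> would be infinite with positive probability.\<close>

lemma gaussian_variances_summable:
  assumes g: "\<And>k. real_centered_gaussian M (g k)"
    and bound: "\<And>\<omega> n. \<omega> \<in> space M \<Longrightarrow> (\<Sum>k<n. (g k \<omega>)\<^sup>2) \<le> f \<omega>" and f[measurable]: "f \<in> borel_measurable M"
  shows "summable (\<lambda>k. \<integral>\<omega>. (g k \<omega>)\<^sup>2 \<partial>M)"
proof -
  have [measurable]: "g k \<in> borel_measurable M" for k using g real_centered_gaussian_measurable by auto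
  define a where "a = (\<lambda>k. \<integral>\<omega>. (g k \<omega>)\<^sup>2 \<partial>M)"
  have ann: "0 \<le> a k" for k by (simp add: a_def)
  have ig: "integrable M (\<lambda>\<omega>. (g k \<omega>)\<^sup>2)" for k using real_centered_gaussian_integrable_power[OF g] .
  have pz: "1 / 12 \<le> prob {\<omega>\<in>space M. (\<Sum>k<n. a k) / 2 \<le> f \<omega>}" for n
  proof (cases "(\<Sum>k<n. a k) = 0")
    case True
    have "{\<omega>\<in>space M. (\<Sum>k<n. a k) / 2 \<le> f \<omega>} = space M"
    proof -
      have "0 \<le> f \<omega>" if "\<omega> \<in> space M" for \<omega> using bound[OF that, of 0] by simp
      then show ?thesis using True by auto
    qed
    then show ?thesis by (simp add: prob_space)
  next
    case False
    define s where "s = (\<Sum>k<n. a k)"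
    define S where "S = (\<lambda>\<omega>. \<Sum>k<n. (g k \<omega>)\<^sup>2)"
    have [measurable]: "S \<in> borel_measurable M" unfolding S_def by measurable
    have s: "0 < s" using False ann by (simp add: s_def order_less_le sum_nonneg)
    define A where "A = {\<omega>\<in>space M. s / 2 \<le> S \<omega>}"
    have A[measurable]: "A \<in> sets M" unfolding A_def by measurable
    have iA: "integrable M (indicator A :: 'a \<Rightarrow> real)"
      using A by (intro integrable_real_indicator) (simp_all add: emeasure_eq_measure)
    have Snn: "0 \<le> S \<omega>" for \<omega> by (simp add: S_def sum_nonneg)
    have iS: "integrable M S" unfolding S_def using ig by auto
    have ES: "(\<integral>\<omega>. S \<omega> \<partial>M) = s" unfolding S_def s_def a_def using ig by simp
    have S2: "(S \<omega>)\<^sup>2 = (\<Sum>i<n. \<Sum>j<n. (g i \<omega>)\<^sup>2 * (g j \<omega>)\<^sup>2)" for \<omega>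
      by (simp add: S_def power2_eq_square sum_product)
    have iS2: "integrable M (\<lambda>\<omega>. (S \<omega>)\<^sup>2)"
      unfolding S2 using gaussian_square_product_bound(1)[OF g g] by auto
    have ES2: "(\<integral>\<omega>. (S \<omega>)\<^sup>2 \<partial>M) \<le> 3 * s\<^sup>2"
    proof -
      have "(\<integral>\<omega>. (S \<omega>)\<^sup>2 \<partial>M) = (\<Sum>i<n. \<Sum>j<n. \<integral>\<omega>. (g i \<omega>)\<^sup>2 * (g j \<omega>)\<^sup>2 \<partial>M)"
        unfolding S2 using gaussian_square_product_bound(1)[OF g g] by simp
      also have "\<dots> \<le> (\<Sum>i<n. \<Sum>j<n. 3 * (a i * a j))"
        unfolding a_def by (intro sum_mono gaussian_square_product_bound g)
      also have "\<dots> = 3 * s\<^sup>2"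
        by (simp only: s_def power2_eq_square sum_product sum_distrib_left[symmetric])
      finally show ?thesis .
    qed
    \<comment> \<open>On \<open>A\<close> the bound \<open>S \<le> S\<^sup>2 / (12 s) + 3 s\<close> is used: with \<open>E S\<^sup>2 \<le> 3 s\<^sup>2\<close> its first term
      costs \<open>s / 4\<close>, which leaves \<open>s / 4 \<le> 3 s P(A)\<close>.\<close>
    have "(\<integral>\<omega>. S \<omega> \<partial>M) \<le> (\<integral>\<omega>. s / 2 + ((S \<omega>)\<^sup>2 / (12 * s) + 3 * s * indicator A \<omega>) \<partial>M)"
    proof (rule integral_mono)
      fix \<omega> assume w: "\<omega> \<in> space M"
      show "S \<omega> \<le> s / 2 + ((S \<omega>)\<^sup>2 / (12 * s) + 3 * s * indicator A \<omega>)" 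
      proof (cases "\<omega> \<in> A")
        case True
        have "0 \<le> (S \<omega> - 6 * s)\<^sup>2 / (12 * s)" using s by simp
        also have "\<dots> = (S \<omega>)\<^sup>2 / (12 * s) + 3 * s - S \<omega>"
          using s by (simp add: power2_eq_square field_simps)
        finally show ?thesis using True s by (simp add: A_def)
      next
        case False
        then have "S \<omega> \<le> s / 2" using w by (simp add: A_def)
        moreover have "0 \<le> (S \<omega>)\<^sup>2 / (12 * s)" using s by simp
        ultimately show ?thesis using False by simp
      qed
    qed (use iS iS2 iA in auto)
    also have "\<dots> = s / 2 + ((\<integral>\<omega>. (S \<omega>)\<^sup>2 \<partial>M) / (12 * s) + 3 * s * prob A)"
      using iS2 iA by (simp add: prob_space)
    also have "\<dots> \<le> s / 2 + (s / 4 + 3 * s * prob A)"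
    proof -
      have "(\<integral>\<omega>. (S \<omega>)\<^sup>2 \<partial>M) / (12 * s) \<le> 3 * s\<^sup>2 / (12 * s)"
        using ES2 s by (intro divide_right_mono) auto
      also have "\<dots> = s / 4" using s by (simp add: power2_eq_square)
      finally show ?thesis by simp
    qed
    finally have "s * (1 / 12) \<le> s * prob A" by (simp add: ES)
    then have "1 / 12 \<le> prob A" using s by (simp only: mult_le_cancel_left_pos)
    also have "prob A \<le> prob {\<omega>\<in>space M. s / 2 \<le> f \<omega>}"
      using bound[of _ n] by (intro finite_measure_mono) (auto simp: S_def A_def intro: order_trans)
    finally show ?thesis by (simp add: s_def)
  qed
  have "\<exists>c. \<forall>n. (\<Sum>k<n. a k) \<le> c"
  proof (rule ccontr)
    assume unb: "\<not> ?thesis"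
    let ?B = "\<lambda>m::nat. {\<omega>\<in>space M. real m \<le> f \<omega>}"
    have "1 / 12 \<le> prob (?B m)" for m
    proof -
      obtain n where "2 * real m < (\<Sum>k<n. a k)" using unb by (meson not_le)
      then have "prob {\<omega>\<in>space M. (\<Sum>k<n. a k) / 2 \<le> f \<omega>} \<le> prob (?B m)"
        by (intro finite_measure_mono) auto
      then show ?thesis using pz[of n] by simp
    qed
    moreover have "(\<lambda>m. prob (?B m)) \<longlonglongrightarrow> prob (\<Inter>m. ?B m)"
      by (intro finite_Lim_measure_decseq) (auto simp: decseq_def)
    moreover have "(\<Inter>m. ?B m) = {}" by auto (metis reals_Archimedean2 not_le)
    ultimately have "1 / 12 \<le> (0::real)" by (intro LIMSEQ_le_const) auto
    then show False by simp
  qed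
  then show ?thesis
    using ann unfolding a_def by (auto intro: summableI_nonneg_bounded)
qed

end

section \<open>Orthogonality to a generated sigma-algebra\<close>

context prob_space begin

lemma Re_iexp: "Re (iexp x) = cos x" and Im_iexp: "Im (iexp x) = sin x"
  by (simp_all only: cis_conv_exp[symmetric] cis.sel)

lemma integrable_mult_of_squares:
  fixes f g :: "'a \<Rightarrow> real"
  assumes [measurable]: "f \<in> borel_measurable M" "g \<in> borel_measurable M"
    and "integrable M (\<lambda>\<omega>. (f \<omega>)\<^sup>2)" "integrable M (\<lambda>\<omega>. (g \<omega>)\<^sup>2)"
  shows "integrable M (\<lambda>\<omega>. f \<omega> * g \<omega>)"
proof (rule Bochner_Integration.integrable_bound[of M "\<lambda>\<omega>. (f \<omega>)\<^sup>2 + (g \<omega>)\<^sup>2"])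
  show "AE \<omega> in M. norm (f \<omega> * g \<omega>) \<le> norm ((f \<omega>)\<^sup>2 + (g \<omega>)\<^sup>2)"
  proof (rule AE_I2)
    fix \<omega>
    have "2 * \<bar>f \<omega>\<bar> * \<bar>g \<omega>\<bar> \<le> \<bar>f \<omega>\<bar>\<^sup>2 + \<bar>g \<omega>\<bar>\<^sup>2" by (rule sum_squares_bound)
    moreover have "0 \<le> \<bar>f \<omega>\<bar> * \<bar>g \<omega>\<bar>" by simp
    ultimately have "\<bar>f \<omega>\<bar> * \<bar>g \<omega>\<bar> \<le> (f \<omega>)\<^sup>2 + (g \<omega>)\<^sup>2" by (simp only: power2_abs)
    then show "norm (f \<omega> * g \<omega>) \<le> norm ((f \<omega>)\<^sup>2 + (g \<omega>)\<^sup>2)" by (simp add: abs_mult)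
  qed
qed (use assms in auto)

lemma integrable_of_square:
  fixes f :: "'a \<Rightarrow> real"
  assumes "f \<in> borel_measurable M" "integrable M (\<lambda>\<omega>. (f \<omega>)\<^sup>2)"
  shows "integrable M f"
  using integrable_mult_of_squares[of f "\<lambda>_. 1"] assms by simp

lemma integrable_mult_bounded:
  fixes f g :: "'a \<Rightarrow> real"
  assumes "integrable M f" "g \<in> borel_measurable M" "\<And>\<omega>. \<bar>g \<omega>\<bar> \<le> 1"
  shows "integrable M (\<lambda>\<omega>. f \<omega> * g \<omega>)"
  using assms by (intro Bochner_Integration.integrable_bound[OF assms(1)]) (auto simp: abs_mult mult_left_le)

text \<open>The positive and the negative part of \<open>f\<close> have the same integral, and weighted with
  them the variable \<open>Y\<close> has the same Fourier transform. After normalisation these are the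
  characteristic functions of two probability measures on the line, and Levy's uniqueness
  theorem applies.\<close>

lemma vanishing_of_fourier_transform:
  fixes f Y :: "'a \<Rightarrow> real"
  assumes f: "integrable M f" and Y[measurable]: "Y \<in> borel_measurable M"
    and c: "\<And>s. (\<integral>\<omega>. f \<omega> * cos (s * Y \<omega>) \<partial>M) = 0" and s: "\<And>s. (\<integral>\<omega>. f \<omega> * sin (s * Y \<omega>) \<partial>M) = 0"
    and B[measurable]: "B \<in> sets borel"
  shows "(\<integral>\<omega>. f \<omega> * indicator B (Y \<omega>) \<partial>M) = 0"
proof -
  have [measurable]: "f \<in> borel_measurable M" using f by auto
  define fp fm where "fp = (\<lambda>\<omega>. max 0 (f \<omega>))" and "fm = (\<lambda>\<omega>. max 0 (- f \<omega>))"
  have [measurable]: "fp \<in> borel_measurable M" "fm \<in> borel_measurable M" by (auto simp: fp_def fm_def)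
  have pm: "f \<omega> = fp \<omega> - fm \<omega>" "0 \<le> fp \<omega>" "0 \<le> fm \<omega>" for \<omega> by (auto simp: fp_def fm_def)
  have ip: "integrable M fp" "integrable M fm" unfolding fp_def fm_def using f by auto
  define K where "K = (\<integral>\<omega>. fp \<omega> \<partial>M)"
  have K2: "(\<integral>\<omega>. fm \<omega> \<partial>M) = K"
    using c[of 0] ip by (simp add: pm(1) K_def)
  have K0: "0 \<le> K" by (simp add: K_def pm)
  show ?thesis
  proof (cases "K = 0")
    case True
    then have "AE \<omega> in M. fp \<omega> = 0" "AE \<omega> in M. fm \<omega> = 0"
      using integral_nonneg_eq_0_iff_AE[of M fp] integral_nonneg_eq_0_iff_AE[of M fm] ip pm K2 by (auto simp: K_def)
    then have "(\<integral>\<omega>. f \<omega> * indicator B (Y \<omega>) \<partial>M) = (\<integral>\<omega>. 0 \<partial>M)"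
      by (intro integral_cong_AE) (auto simp: pm(1))
    then show ?thesis by simp
  next
    case False
    then have K: "0 < K" using K0 by simp
    define law where "law = (\<lambda>g :: 'a \<Rightarrow> real. distr (density M (\<lambda>\<omega>. ennreal (g \<omega> / K))) borel Y)"
    have rd: "real_distribution (law g)"
      if "integrable M g" "\<And>\<omega>. 0 \<le> g \<omega>" "(\<integral>\<omega>. g \<omega> \<partial>M) = K" for g
    proof -
      have [measurable]: "g \<in> borel_measurable M" using that by auto
      have "emeasure (density M (\<lambda>\<omega>. ennreal (g \<omega> / K))) (space M) = (\<integral>\<^sup>+\<omega>. ennreal (g \<omega> / K) \<partial>M)"
        by (subst emeasure_density) (auto intro!: nn_integral_cong)
      also have "\<dots> = ennreal (\<integral>\<omega>. g \<omega> / K \<partial>M)"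
        using that K by (intro nn_integral_eq_integral) auto
      also have "\<dots> = 1" using that K by simp
      finally have "prob_space (density M (\<lambda>\<omega>. ennreal (g \<omega> / K)))" by (intro prob_spaceI) simp
      then have "prob_space (law g)" unfolding law_def by (rule prob_space.prob_space_distr) simp
      then show ?thesis by (simp add: real_distribution_def real_distribution_axioms_def law_def)
    qed
    have int: "(\<integral>y. h y \<partial>law g) = (\<integral>\<omega>. (g \<omega> / K) *\<^sub>R h (Y \<omega>) \<partial>M)"
      if "integrable M g" "\<And>\<omega>. 0 \<le> g \<omega>" "h \<in> borel_measurable borel"
      for g and h :: "real \<Rightarrow> 'z::{banach, second_countable_topology}"
    proof -
      have [measurable]: "g \<in> borel_measurable M" "h \<in> borel_measurable borel" using that by auto
      show ?thesis unfolding law_def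
        using K that by (subst integral_distr) (auto simp: integral_density)
    qed
    have "char (law fp) t = char (law fm) t" for t
    proof -
      have ch: "char (law g) t = Complex (\<integral>\<omega>. g \<omega> * cos (t * Y \<omega>) \<partial>M) (\<integral>\<omega>. g \<omega> * sin (t * Y \<omega>) \<partial>M) / complex_of_real K"
        if "integrable M g" "\<And>\<omega>. 0 \<le> g \<omega>" for g
      proof -
        have [measurable]: "g \<in> borel_measurable M" using that by auto
        have iF: "integrable M (\<lambda>\<omega>. (g \<omega> / K) *\<^sub>R iexp (t * Y \<omega>))"
        proof (rule Bochner_Integration.integrable_bound[of M "\<lambda>\<omega>. g \<omega> / K"])
          show "integrable M (\<lambda>\<omega>. g \<omega> / K)" using that by simp
          show "(\<lambda>\<omega>. (g \<omega> / K) *\<^sub>R iexp (t * Y \<omega>)) \<in> borel_measurable M" by measurable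
          show "AE \<omega> in M. norm ((g \<omega> / K) *\<^sub>R iexp (t * Y \<omega>)) \<le> norm (g \<omega> / K)"
            by (rule AE_I2) (simp only: norm_scaleR norm_exp_i_times, simp)
        qed
        have "char (law g) t = (\<integral>\<omega>. (g \<omega> / K) *\<^sub>R iexp (t * Y \<omega>) \<partial>M)"
          unfolding char_def using that by (subst int) auto
        moreover have "Re (\<integral>\<omega>. (g \<omega> / K) *\<^sub>R iexp (t * Y \<omega>) \<partial>M) = (\<integral>\<omega>. g \<omega> * cos (t * Y \<omega>) \<partial>M) / K"
          unfolding integral_Re[OF iF, symmetric] complex.sel scaleR_complex.simps Re_iexp by simp
        moreover have "Im (\<integral>\<omega>. (g \<omega> / K) *\<^sub>R iexp (t * Y \<omega>) \<partial>M) = (\<integral>\<omega>. g \<omega> * sin (t * Y \<omega>) \<partial>M) / K"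
          unfolding integral_Im[OF iF, symmetric] complex.sel scaleR_complex.simps Im_iexp by simp
        ultimately show ?thesis
          by (intro complex_eqI) (simp_all only: complex.sel Re_divide_of_real Im_divide_of_real)
      qed
      have "(\<integral>\<omega>. fp \<omega> * cos (t * Y \<omega>) \<partial>M) = (\<integral>\<omega>. fm \<omega> * cos (t * Y \<omega>) \<partial>M)"
        using c[of t] ip integrable_mult_bounded[of fp "\<lambda>\<omega>. cos (t * Y \<omega>)"] integrable_mult_bounded[of fm "\<lambda>\<omega>. cos (t * Y \<omega>)"]
        by (simp add: pm(1) left_diff_distrib)
      moreover have "(\<integral>\<omega>. fp \<omega> * sin (t * Y \<omega>) \<partial>M) = (\<integral>\<omega>. fm \<omega> * sin (t * Y \<omega>) \<partial>M)"
        using s[of t] ip integrable_mult_bounded[of fp "\<lambda>\<omega>. sin (t * Y \<omega>)"] integrable_mult_bounded[of fm "\<lambda>\<omega>. sin (t * Y \<omega>)"]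
        by (simp add: pm(1) left_diff_distrib)
      ultimately show ?thesis using ip pm by (simp add: ch)
    qed
    then have "law fp = law fm"
      using ip pm K2 by (intro Levy_uniqueness rd ext) (auto simp: K_def)
    then have "(\<integral>y. (indicator B y :: real) \<partial>law fp) = (\<integral>y. (indicator B y :: real) \<partial>law fm)" by simp
    then have "(\<integral>\<omega>. fp \<omega> * indicator B (Y \<omega>) \<partial>M) = (\<integral>\<omega>. fm \<omega> * indicator B (Y \<omega>) \<partial>M)"
      using ip pm K by (subst (asm) (1 2) int) auto
    then show ?thesis
      using ip integrable_mult_bounded[of fp "\<lambda>\<omega>. indicator B (Y \<omega>)"] integrable_mult_bounded[of fm "\<lambda>\<omega>. indicator B (Y \<omega>)"]
      by (simp add: pm(1) left_diff_distrib)
  qed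
qed

text \<open>One coordinate at a time: the addition theorems split off \<open>Y j\<close>, the one-dimensional
  case replaces its trigonometric functions by an indicator, and that indicator is
  absorbed into \<open>f\<close>.\<close>

lemma vanishing_on_cylinders:
  fixes f :: "'a \<Rightarrow> real" and Y :: "'j \<Rightarrow> 'a \<Rightarrow> real"
  assumes "finite J" "integrable M f" "\<And>j. j \<in> J \<Longrightarrow> Y j \<in> borel_measurable M"
    "\<And>j. j \<in> J \<Longrightarrow> B j \<in> sets borel"
    "\<And>s. (\<integral>\<omega>. f \<omega> * cos (\<Sum>j\<in>J. s j * Y j \<omega>) \<partial>M) = 0"
    "\<And>s. (\<integral>\<omega>. f \<omega> * sin (\<Sum>j\<in>J. s j * Y j \<omega>) \<partial>M) = 0"
  shows "(\<integral>\<omega>. f \<omega> * (\<Prod>j\<in>J. indicator (B j) (Y j \<omega>)) \<partial>M) = 0"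
  using assms
proof (induction J arbitrary: f rule: finite_induct)
  case empty
  then show ?case by simp
next
  case (insert j J)
  note f = insert.prems(1)
  have [measurable]: "Y i \<in> borel_measurable M" if "i \<in> insert j J" for i using insert.prems(2) that .
  have Yj[measurable]: "Y j \<in> borel_measurable M" and Bj[measurable]: "B j \<in> sets borel" using insert.prems by auto
  let ?g = "\<lambda>\<omega>. f \<omega> * indicator (B j) (Y j \<omega>)"
  have ig: "integrable M ?g" using f by (intro integrable_mult_bounded) auto
  have key: "(\<integral>\<omega>. ?g \<omega> * cos (\<Sum>i\<in>J. s i * Y i \<omega>) \<partial>M) = 0 \<and> (\<integral>\<omega>. ?g \<omega> * sin (\<Sum>i\<in>J. s i * Y i \<omega>) \<partial>M) = 0" for s
  proof -
    define S where "S = (\<lambda>\<omega>. \<Sum>i\<in>J. s i * Y i \<omega>)"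
    have S[measurable]: "S \<in> borel_measurable M" unfolding S_def by measurable
    have upd: "(\<Sum>i\<in>insert j J. (s(j := t)) i * Y i \<omega>) = t * Y j \<omega> + S \<omega>" for t \<omega>
    proof -
      have "(\<Sum>i\<in>J. (s(j := t)) i * Y i \<omega>) = S \<omega>"
        unfolding S_def using insert.hyps by (intro sum.cong) auto
      then show ?thesis using insert.hyps by simp
    qed
    have z: "(\<integral>\<omega>. f \<omega> * cos (t * Y j \<omega> + S \<omega>) \<partial>M) = 0" "(\<integral>\<omega>. f \<omega> * sin (t * Y j \<omega> + S \<omega>) \<partial>M) = 0" for t
      using insert.prems(4)[of "s(j := t)"] insert.prems(5)[of "s(j := t)"] by (simp_all only: upd)
    have ii: "integrable M (\<lambda>\<omega>. f \<omega> * cos (t * Y j \<omega> + S \<omega>))" "integrable M (\<lambda>\<omega>. f \<omega> * sin (t * Y j \<omega> + S \<omega>))" for t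
      using f by (auto intro!: integrable_mult_bounded)
    have cc: "f \<omega> * cos (S \<omega>) * cos (t * Y j \<omega>) = (f \<omega> * cos (t * Y j \<omega> + S \<omega>) + f \<omega> * cos ((- t) * Y j \<omega> + S \<omega>)) / 2"
      and cs: "f \<omega> * cos (S \<omega>) * sin (t * Y j \<omega>) = (f \<omega> * sin (t * Y j \<omega> + S \<omega>) - f \<omega> * sin ((- t) * Y j \<omega> + S \<omega>)) / 2"
      and sc: "f \<omega> * sin (S \<omega>) * cos (t * Y j \<omega>) = (f \<omega> * sin (t * Y j \<omega> + S \<omega>) + f \<omega> * sin ((- t) * Y j \<omega> + S \<omega>)) / 2"
      and ss: "f \<omega> * sin (S \<omega>) * sin (t * Y j \<omega>) = (f \<omega> * cos ((- t) * Y j \<omega> + S \<omega>) - f \<omega> * cos (t * Y j \<omega> + S \<omega>)) / 2"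
      for t \<omega> by (simp_all add: cos_add sin_add cos_diff sin_diff algebra_simps)
    have 1: "(\<integral>\<omega>. (f \<omega> * cos (S \<omega>)) * indicator (B j) (Y j \<omega>) \<partial>M) = 0"
    proof (rule vanishing_of_fourier_transform)
      show "(\<integral>\<omega>. f \<omega> * cos (S \<omega>) * cos (t * Y j \<omega>) \<partial>M) = 0" "(\<integral>\<omega>. f \<omega> * cos (S \<omega>) * sin (t * Y j \<omega>) \<partial>M) = 0" for t
        unfolding cc cs using ii[of t] ii[of "- t"] z[of t] z[of "- t"] by simp_all
    qed (use f in \<open>auto intro!: integrable_mult_bounded\<close>)
    have 2: "(\<integral>\<omega>. (f \<omega> * sin (S \<omega>)) * indicator (B j) (Y j \<omega>) \<partial>M) = 0"
    proof (rule vanishing_of_fourier_transform)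
      show "(\<integral>\<omega>. f \<omega> * sin (S \<omega>) * cos (t * Y j \<omega>) \<partial>M) = 0" "(\<integral>\<omega>. f \<omega> * sin (S \<omega>) * sin (t * Y j \<omega>) \<partial>M) = 0" for t
        unfolding sc ss using ii[of t] ii[of "- t"] z[of t] z[of "- t"] by simp_all
    qed (use f in \<open>auto intro!: integrable_mult_bounded\<close>)
    show ?thesis using 1 2 by (simp add: S_def mult_ac)
  qed
  have "(\<integral>\<omega>. ?g \<omega> * (\<Prod>i\<in>J. indicator (B i) (Y i \<omega>)) \<partial>M) = 0"
    using insert.prems(2,3) key ig by (intro insert.IH) auto
  then show ?case using insert.hyps by (simp add: mult.assoc)
qed

text \<open>Differentiate the characteristic function of \<open>a X + \<eta>\<close> at \<open>a = 0\<close>, under the integral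
  on the left. In particular both expectations vanish when \<open>X\<close> and \<open>\<eta>\<close> are uncorrelated.\<close>

lemma jointly_gaussian_covariance:
  fixes X \<eta> :: "'a \<Rightarrow> real"
  assumes iX: "integrable M (\<lambda>\<omega>. (X \<omega>)\<^sup>2)" and i\<eta>: "integrable M (\<lambda>\<omega>. (\<eta> \<omega>)\<^sup>2)"
    and [measurable]: "X \<in> borel_measurable M" "\<eta> \<in> borel_measurable M"
    and ch: "\<And>a. (\<integral>\<omega>. iexp (a * X \<omega> + \<eta> \<omega>) \<partial>M) = complex_of_real (exp (- (\<integral>\<omega>. (a * X \<omega> + \<eta> \<omega>)\<^sup>2 \<partial>M) / 2))"
  shows "(\<integral>\<omega>. X \<omega> * cos (\<eta> \<omega>) \<partial>M) = 0"
    "(\<integral>\<omega>. X \<omega> * sin (\<eta> \<omega>) \<partial>M) = (\<integral>\<omega>. X \<omega> * \<eta> \<omega> \<partial>M) * exp (- (\<integral>\<omega>. (\<eta> \<omega>)\<^sup>2 \<partial>M) / 2)"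
proof -
  have absX: "integrable M (\<lambda>\<omega>. \<bar>X \<omega>\<bar>)"
    using integrable_of_square[OF _ iX] by simp
  have iXe: "integrable M (\<lambda>\<omega>. X \<omega> * \<eta> \<omega>)"
    using iX i\<eta> by (intro integrable_mult_of_squares) auto
  define \<alpha> \<beta> \<delta> where "\<alpha> = (\<integral>\<omega>. (X \<omega>)\<^sup>2 \<partial>M)" and "\<beta> = (\<integral>\<omega>. X \<omega> * \<eta> \<omega> \<partial>M)" and "\<delta> = (\<integral>\<omega>. (\<eta> \<omega>)\<^sup>2 \<partial>M)"
  define q where "q = (\<lambda>a. exp (- (a\<^sup>2 * \<alpha> + 2 * a * \<beta> + \<delta>) / 2))"
  have Q: "(\<integral>\<omega>. (a * X \<omega> + \<eta> \<omega>)\<^sup>2 \<partial>M) = a\<^sup>2 * \<alpha> + 2 * a * \<beta> + \<delta>" for a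
  proof -
    have "(\<integral>\<omega>. (a * X \<omega> + \<eta> \<omega>)\<^sup>2 \<partial>M) = (\<integral>\<omega>. a\<^sup>2 * (X \<omega>)\<^sup>2 + 2 * a * (X \<omega> * \<eta> \<omega>) + (\<eta> \<omega>)\<^sup>2 \<partial>M)"
      by (intro Bochner_Integration.integral_cong refl) (simp add: power2_sum power_mult_distrib mult_ac)
    then show ?thesis using iX i\<eta> iXe by (simp add: \<alpha>_def \<beta>_def \<delta>_def)
  qed
  have ci: "integrable M (\<lambda>\<omega>. cos (a * X \<omega> + \<eta> \<omega>))" "integrable M (\<lambda>\<omega>. sin (a * X \<omega> + \<eta> \<omega>))" for a
    by (rule integrable_const_bound[of _ 1], auto)+
  have E: "(\<integral>\<omega>. cos (a * X \<omega> + \<eta> \<omega>) \<partial>M) = q a" "(\<integral>\<omega>. sin (a * X \<omega> + \<eta> \<omega>) \<partial>M) = 0" for a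
  proof -
    have "integrable M (\<lambda>\<omega>. iexp (a * X \<omega> + \<eta> \<omega>))" by (intro integrable_iexp) auto
    then have "(\<integral>\<omega>. Re (iexp (a * X \<omega> + \<eta> \<omega>)) \<partial>M) = Re (\<integral>\<omega>. iexp (a * X \<omega> + \<eta> \<omega>) \<partial>M)"
      "(\<integral>\<omega>. Im (iexp (a * X \<omega> + \<eta> \<omega>)) \<partial>M) = Im (\<integral>\<omega>. iexp (a * X \<omega> + \<eta> \<omega>) \<partial>M)"
      by (rule integral_Re, rule integral_Im)
    then show "(\<integral>\<omega>. cos (a * X \<omega> + \<eta> \<omega>) \<partial>M) = q a" "(\<integral>\<omega>. sin (a * X \<omega> + \<eta> \<omega>) \<partial>M) = 0"
      unfolding ch Q Re_iexp Im_iexp by (simp_all add: q_def)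
  qed
  define a where "a = (\<lambda>n. inverse (real (Suc n)))"
  have a0: "a \<longlonglongrightarrow> 0" "a n \<noteq> 0" for n using LIMSEQ_inverse_real_of_nat by (simp_all add: a_def)
  have af: "filterlim a (at 0) sequentially" using a0 by (simp add: filterlim_at)
  have lim: "(\<lambda>n. \<integral>\<omega>. (h (a n * X \<omega> + \<eta> \<omega>) - h (\<eta> \<omega>)) / a n \<partial>M) \<longlonglongrightarrow> (\<integral>\<omega>. h' (\<eta> \<omega>) * X \<omega> \<partial>M)"
    if h: "\<And>x. (h has_real_derivative h' x) (at x)" "\<And>x. \<bar>h' x\<bar> \<le> 1"
      and [measurable]: "h \<in> borel_measurable borel" "h' \<in> borel_measurable borel" for h h' :: "real \<Rightarrow> real"
  proof (rule integral_dominated_convergence[where w = "\<lambda>\<omega>. \<bar>X \<omega>\<bar>"])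
    show "AE \<omega> in M. (\<lambda>n. (h (a n * X \<omega> + \<eta> \<omega>) - h (\<eta> \<omega>)) / a n) \<longlonglongrightarrow> h' (\<eta> \<omega>) * X \<omega>"
    proof (rule AE_I2)
      fix \<omega>
      have "((\<lambda>t. h (t * X \<omega> + \<eta> \<omega>)) has_real_derivative h' (0 * X \<omega> + \<eta> \<omega>) * X \<omega>) (at 0)"
        by (rule DERIV_chain2[OF h(1)]) (auto intro!: derivative_eq_intros)
      then have "((\<lambda>t. (h (t * X \<omega> + \<eta> \<omega>) - h (\<eta> \<omega>)) / t) \<longlongrightarrow> h' (\<eta> \<omega>) * X \<omega>) (at 0)"
        by (simp add: DERIV_def)
      then show "(\<lambda>n. (h (a n * X \<omega> + \<eta> \<omega>) - h (\<eta> \<omega>)) / a n) \<longlonglongrightarrow> h' (\<eta> \<omega>) * X \<omega>"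
        by (rule filterlim_compose[OF _ af])
    qed
    show "AE \<omega> in M. norm ((h (a n * X \<omega> + \<eta> \<omega>) - h (\<eta> \<omega>)) / a n) \<le> \<bar>X \<omega>\<bar>" for n
    proof (rule AE_I2)
      fix \<omega>
      have "norm (h (a n * X \<omega> + \<eta> \<omega>) - h (\<eta> \<omega>)) \<le> 1 * norm ((a n * X \<omega> + \<eta> \<omega>) - \<eta> \<omega>)"
        by (rule field_differentiable_bound[of UNIV h h']) (use h in auto)
      then show "norm ((h (a n * X \<omega> + \<eta> \<omega>) - h (\<eta> \<omega>)) / a n) \<le> \<bar>X \<omega>\<bar>"
        using a0(2)[of n] by (simp add: abs_mult divide_le_eq mult.commute)
    qed
  qed (use absX in auto)
  have "(\<lambda>n. \<integral>\<omega>. (sin (a n * X \<omega> + \<eta> \<omega>) - sin (\<eta> \<omega>)) / a n \<partial>M) \<longlonglongrightarrow> (\<integral>\<omega>. cos (\<eta> \<omega>) * X \<omega> \<partial>M)"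
    by (rule lim) (auto intro!: derivative_eq_intros)
  moreover have "(\<integral>\<omega>. (sin (a n * X \<omega> + \<eta> \<omega>) - sin (\<eta> \<omega>)) / a n \<partial>M) = 0" for n
    using ci(2)[of "a n"] ci(2)[of 0] E(2)[of "a n"] E(2)[of 0] by simp
  ultimately have "(\<lambda>n. 0 :: real) \<longlonglongrightarrow> (\<integral>\<omega>. cos (\<eta> \<omega>) * X \<omega> \<partial>M)" by (simp only:)
  then show "(\<integral>\<omega>. X \<omega> * cos (\<eta> \<omega>) \<partial>M) = 0"
    by (simp add: LIMSEQ_const_iff mult.commute)
  have "(\<lambda>n. \<integral>\<omega>. (cos (a n * X \<omega> + \<eta> \<omega>) - cos (\<eta> \<omega>)) / a n \<partial>M) \<longlonglongrightarrow> (\<integral>\<omega>. - sin (\<eta> \<omega>) * X \<omega> \<partial>M)"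
    by (rule lim) (auto intro!: derivative_eq_intros)
  moreover have "(\<integral>\<omega>. (cos (a n * X \<omega> + \<eta> \<omega>) - cos (\<eta> \<omega>)) / a n \<partial>M) = (q (a n) - q 0) / a n" for n
    using ci(1)[of "a n"] ci(1)[of 0] E(1)[of "a n"] E(1)[of 0] by simp
  moreover have "(\<lambda>n. (q (a n) - q 0) / a n) \<longlonglongrightarrow> - \<beta> * exp (- \<delta> / 2)"
  proof -
    have "(q has_real_derivative - \<beta> * exp (- \<delta> / 2)) (at 0)"
      unfolding q_def by (auto intro!: derivative_eq_intros)
    then have "((\<lambda>t. (q t - q 0) / t) \<longlongrightarrow> - \<beta> * exp (- \<delta> / 2)) (at 0)" by (simp add: DERIV_def)
    then show ?thesis by (rule filterlim_compose[OF _ af])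
  qed
  ultimately have "(\<integral>\<omega>. - sin (\<eta> \<omega>) * X \<omega> \<partial>M) = - \<beta> * exp (- \<delta> / 2)"
    using LIMSEQ_unique by (simp only:)
  then show "(\<integral>\<omega>. X \<omega> * sin (\<eta> \<omega>) \<partial>M) = (\<integral>\<omega>. X \<omega> * \<eta> \<omega> \<partial>M) * exp (- (\<integral>\<omega>. (\<eta> \<omega>)\<^sup>2 \<partial>M) / 2)"
    by (simp add: \<beta>_def \<delta>_def mult.commute)
qed

end

text \<open>The trigonometric functions of a linear space of variables determine everything that is
  measurable with respect to them: orthogonality passes to indicators of cylinder sets by
  the Fourier argument, to the generated sigma-algebra by Dynkin's lemma, and to \<open>g\<close>
  because the conditional expectation of \<open>Z\<close> vanishes.

  Linear combinations are indexed by pairs of a variable and a Borel set, since a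
  cylinder set may constrain the same variable by several Borel sets.\<close>

lemma (in prob_space) orthogonal_of_generated:
  fixes Z g :: "'a \<Rightarrow> real" and \<Y> :: "('a \<Rightarrow> real) set"
  assumes Z: "integrable M Z"
    and meas: "\<And>\<eta>. \<eta> \<in> \<Y> \<Longrightarrow> \<eta> \<in> borel_measurable M"
    and lin: "\<And>K s. finite K \<Longrightarrow> K \<subseteq> \<Y> \<times> (UNIV :: real set set) \<Longrightarrow> (\<lambda>\<omega>. \<Sum>k\<in>K. s k * fst k \<omega>) \<in> \<Y>"
    and c: "\<And>\<eta>. \<eta> \<in> \<Y> \<Longrightarrow> (\<integral>\<omega>. Z \<omega> * cos (\<eta> \<omega>) \<partial>M) = 0"
    and s: "\<And>\<eta>. \<eta> \<in> \<Y> \<Longrightarrow> (\<integral>\<omega>. Z \<omega> * sin (\<eta> \<omega>) \<partial>M) = 0"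
    and F: "F = sigma (space M) ({\<eta> -` B \<inter> space M | \<eta> B. \<eta> \<in> \<Y> \<and> B \<in> sets borel} \<union> null_sets M)"
    and g: "g \<in> borel_measurable F" and gZ: "integrable M (\<lambda>\<omega>. g \<omega> * Z \<omega>)"
  shows "(\<integral>\<omega>. g \<omega> * Z \<omega> \<partial>M) = 0"
proof -
  have [measurable]: "Z \<in> borel_measurable M" using Z by auto
  define gen where "gen = {\<eta> -` B \<inter> space M | \<eta> B. \<eta> \<in> \<Y> \<and> B \<in> sets borel} \<union> null_sets M"
  define cyl where "cyl = (\<lambda>K :: (('a \<Rightarrow> real) \<times> real set) set. {\<omega>\<in>space M. \<forall>k\<in>K. fst k \<omega> \<in> snd k})"
  define good where "good = (\<lambda>K. finite K \<and> K \<subseteq> \<Y> \<times> (sets borel :: real set set))"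
  define \<C> where "\<C> = {cyl K | K. good K} \<union> null_sets M"
  have genM: "gen \<subseteq> sets M" using meas by (auto simp: gen_def intro: measurable_sets)
  have genP: "gen \<subseteq> Pow (space M)" using genM sets.sets_into_space by blast
  have setsF: "sets F = sigma_sets (space M) gen" and spF: "space F = space M"
    unfolding F gen_def[symmetric] using genP by simp_all
  have cylM: "cyl K \<in> sets M" if "good K" for K
  proof -
    have fin: "finite K" and k: "\<And>k. k \<in> K \<Longrightarrow> fst k \<in> borel_measurable M \<and> snd k \<in> sets borel"
      using that meas by (auto simp: good_def)
    have "{\<omega>\<in>space M. fst k \<omega> \<in> snd k} \<in> sets M" if "k \<in> K" for k
    proof -
      have "fst k -` snd k \<inter> space M \<in> sets M" using k[OF that] measurable_sets by blast
      moreover have "fst k -` snd k \<inter> space M = {\<omega>\<in>space M. fst k \<omega> \<in> snd k}" by auto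
      ultimately show ?thesis by simp
    qed
    then show ?thesis unfolding cyl_def using fin by (intro sets.sets_Collect_finite_All) auto
  qed
  have PiM: "\<C> \<subseteq> sets M" using cylM by (auto simp: \<C>_def)
  have stable: "Int_stable \<C>"
  proof (rule Int_stableI)
    fix A B assume AB: "A \<in> \<C>" "B \<in> \<C>"
    show "A \<inter> B \<in> \<C>"
    proof (cases "A \<in> null_sets M \<or> B \<in> null_sets M")
      case True
      then have "A \<inter> B \<in> null_sets M"
        using AB PiM by (meson null_set_Int1 null_set_Int2 subsetD)
      then show ?thesis by (simp add: \<C>_def)
    next
      case False
      then obtain K L where "A = cyl K" "good K" "B = cyl L" "good L" using AB by (auto simp: \<C>_def)
      then have "A \<inter> B = cyl (K \<union> L)" "good (K \<union> L)" by (auto simp: cyl_def good_def)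
      then show ?thesis unfolding \<C>_def by blast
    qed
  qed
  have "gen \<subseteq> \<C>"
  proof
    fix A assume "A \<in> gen"
    then consider \<eta> B where "A = \<eta> -` B \<inter> space M" "\<eta> \<in> \<Y>" "B \<in> sets borel" | "A \<in> null_sets M"
      unfolding gen_def by blast
    then show "A \<in> \<C>"
    proof cases
      case 1
      then have "A = cyl {(\<eta>, B)}" "good {(\<eta>, B)}" by (auto simp: cyl_def good_def)
      then show ?thesis unfolding \<C>_def by blast
    qed (simp add: \<C>_def)
  qed
  then have FPi: "sets F \<subseteq> sigma_sets (space M) \<C>" unfolding setsF by (rule sigma_sets_mono')
  have cylZ: "(\<integral>\<omega>. indicator (cyl K) \<omega> * Z \<omega> \<partial>M) = 0" if K: "good K" for K
  proof -
    have "(\<integral>\<omega>. Z \<omega> * (\<Prod>k\<in>K. indicator (snd k) (fst k \<omega>)) \<partial>M) = 0"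
    proof (rule vanishing_on_cylinders)
      fix t :: "('a \<Rightarrow> real) \<times> real set \<Rightarrow> real"
      have "(\<lambda>\<omega>. \<Sum>k\<in>K. t k * fst k \<omega>) \<in> \<Y>"
        using K by (intro lin) (auto simp: good_def)
      then show "(\<integral>\<omega>. Z \<omega> * cos (\<Sum>k\<in>K. t k * fst k \<omega>) \<partial>M) = 0" "(\<integral>\<omega>. Z \<omega> * sin (\<Sum>k\<in>K. t k * fst k \<omega>) \<partial>M) = 0"
        by (rule c, rule s)
    qed (use K Z meas in \<open>auto simp: good_def\<close>)
    moreover have "(\<integral>\<omega>. indicator (cyl K) \<omega> * Z \<omega> \<partial>M) = (\<integral>\<omega>. Z \<omega> * (\<Prod>k\<in>K. indicator (snd k) (fst k \<omega>)) \<partial>M)"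
    proof (intro Bochner_Integration.integral_cong refl)
      fix \<omega> assume w: "\<omega> \<in> space M"
      have "(\<Prod>k\<in>K. indicator (snd k) (fst k \<omega>)) = (indicator (cyl K) \<omega> :: real)"
      proof (cases "\<omega> \<in> cyl K")
        case True
        then show ?thesis by (auto simp: cyl_def intro!: prod.neutral)
      next
        case False
        then obtain k where "k \<in> K" "fst k \<omega> \<notin> snd k" using w by (auto simp: cyl_def)
        then show ?thesis using False K by (auto simp: good_def indicator_def intro!: prod_zero bexI[of _ k])
      qed
      then show "indicator (cyl K) \<omega> * Z \<omega> = Z \<omega> * (\<Prod>k\<in>K. indicator (snd k) (fst k \<omega>))" by simp
    qed
    ultimately show ?thesis by simp
  qed
  have EZ: "(\<integral>\<omega>. Z \<omega> \<partial>M) = 0"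
  proof -
    have "(\<integral>\<omega>. indicator (cyl {}) \<omega> * Z \<omega> \<partial>M) = 0" by (rule cylZ) (simp add: good_def)
    moreover have "(\<integral>\<omega>. indicator (cyl {}) \<omega> * Z \<omega> \<partial>M) = (\<integral>\<omega>. Z \<omega> \<partial>M)"
      by (intro Bochner_Integration.integral_cong refl) (simp add: cyl_def)
    ultimately show ?thesis by simp
  qed
  have sub: "sigma_sets (space M) \<C> \<subseteq> sets M" using PiM by (rule sets.sigma_sets_subset)
  have int: "integrable M (\<lambda>\<omega>. indicator A \<omega> * Z \<omega>)" if "A \<in> sets M" for A
    using integrable_mult_indicator[OF that Z] by simp
  have CPow: "\<C> \<subseteq> Pow (space M)" using PiM sets.sets_into_space by blast
  have all: "A \<in> sets M \<and> (\<integral>\<omega>. indicator A \<omega> * Z \<omega> \<partial>M) = 0" if "A \<in> sigma_sets (space M) \<C>" for A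
    using that
  proof (induction rule: sigma_sets_induct_disjoint[OF stable CPow, consumes 1, case_names basic empty compl union])
    case (basic A)
    show ?case
    proof (cases "A \<in> null_sets M")
      case True
      then have "AE \<omega> in M. \<omega> \<notin> A" by (rule AE_not_in)
      then have "(\<integral>\<omega>. indicator A \<omega> * Z \<omega> \<partial>M) = (\<integral>\<omega>. 0 \<partial>M)"
        using True by (intro integral_cong_AE) auto
      then show ?thesis using True by auto
    next
      case False
      then show ?thesis using basic cylZ cylM by (auto simp: \<C>_def)
    qed
  next
    case empty
    show ?case by simp
  next
    case (compl A)
    have "(\<integral>\<omega>. indicator (space M - A) \<omega> * Z \<omega> \<partial>M) = (\<integral>\<omega>. Z \<omega> - indicator A \<omega> * Z \<omega> \<partial>M)"
      by (intro Bochner_Integration.integral_cong refl) (auto simp: indicator_def)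
    also have "\<dots> = 0" using compl Z int EZ by simp
    finally show ?case using compl by auto
  next
    case (union A)
    have "(LINT \<omega>:(\<Union>i. A i)|M. Z \<omega>) = (\<Sum>i. (LINT \<omega>:(A i)|M. Z \<omega>))"
    proof (rule lebesgue_integral_countable_add)
      show "set_integrable M (\<Union>i. A i) Z"
        unfolding set_integrable_def using union Z by (intro integrable_mult_indicator) auto
    qed (use union in \<open>auto simp: disjoint_family_on_def\<close>)
    then show ?case using union by (auto simp: set_lebesgue_integral_def)
  qed
  have subalg: "subalgebra M F"
    unfolding subalgebra_def spF setsF using genM by (simp add: sets.sigma_sets_subset)
  interpret F: finite_measure_subalgebra M F
    by standard (rule subalg)
  have "AE \<omega> in M. real_cond_exp M F Z \<omega> = 0"
  proof (rule F.real_cond_exp_charact)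
    fix A assume "A \<in> sets F"
    then show "(LINT \<omega>:A|M. Z \<omega>) = (LINT \<omega>:A|M. 0)"
      using all FPi by (auto simp: set_lebesgue_integral_def)
  qed (use Z in auto)
  have "(\<integral>\<omega>. g \<omega> * Z \<omega> \<partial>M) = (\<integral>\<omega>. g \<omega> * real_cond_exp M F Z \<omega> \<partial>M)"
    using gZ g by (intro F.real_cond_exp_intg(2)[symmetric]) auto
  also have "\<dots> = (\<integral>\<omega>. 0 \<partial>M)"
  proof (rule integral_cong_AE)
    have "g \<in> borel_measurable M" using g subalg by (rule measurable_from_subalg[rotated])
    then show "(\<lambda>\<omega>. g \<omega> * real_cond_exp M F Z \<omega>) \<in> borel_measurable M" by measurable
  qed (use \<open>AE \<omega> in M. real_cond_exp M F Z \<omega> = 0\<close> in auto)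
  finally show ?thesis by simp
qed

section \<open>Square integrable variables with values in a Hilbert space\<close>

context
  fixes M :: "'a measure"
begin

lemma square_integrable_measurable:
  "square_integrable M f \<Longrightarrow> f \<in> borel_measurable M"
  by (simp add: square_integrable_def)

lemma square_integrable_scaleR:
  fixes f :: "'a \<Rightarrow> 'h::{real_inner, second_countable_topology}"
  assumes "square_integrable M f"
  shows "square_integrable M (\<lambda>\<omega>. c *\<^sub>R f \<omega>)"
  using assms by (auto simp: square_integrable_def power_mult_distrib)

lemma square_integrable_add:
  fixes f g :: "'a \<Rightarrow> 'h::{real_inner, second_countable_topology}"
  assumes "square_integrable M f" "square_integrable M g"
  shows "square_integrable M (\<lambda>\<omega>. f \<omega> + g \<omega>)"
proof -
  have [measurable]: "f \<in> borel_measurable M" "g \<in> borel_measurable M"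
    using assms by (auto simp: square_integrable_def)
  have "integrable M (\<lambda>\<omega>. (norm (f \<omega> + g \<omega>))\<^sup>2)"
  proof (rule Bochner_Integration.integrable_bound[of M "\<lambda>\<omega>. 2 * (norm (f \<omega>))\<^sup>2 + 2 * (norm (g \<omega>))\<^sup>2"])
    show "AE \<omega> in M. norm ((norm (f \<omega> + g \<omega>))\<^sup>2) \<le> norm (2 * (norm (f \<omega>))\<^sup>2 + 2 * (norm (g \<omega>))\<^sup>2)"
    proof (rule AE_I2)
      fix \<omega>
      have "0 \<le> (norm (f \<omega> - g \<omega>))\<^sup>2" by simp
      then have "(norm (f \<omega> + g \<omega>))\<^sup>2 \<le> 2 * (norm (f \<omega>))\<^sup>2 + 2 * (norm (g \<omega>))\<^sup>2"
        by (simp add: power2_norm_eq_inner inner_add_left inner_add_right inner_diff_left inner_diff_right inner_commute)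
      then show "norm ((norm (f \<omega> + g \<omega>))\<^sup>2) \<le> norm (2 * (norm (f \<omega>))\<^sup>2 + 2 * (norm (g \<omega>))\<^sup>2)" by simp
    qed
  qed (use assms in \<open>auto simp: square_integrable_def\<close>)
  then show ?thesis by (simp add: square_integrable_def)
qed

lemma square_integrable_diff:
  fixes f g :: "'a \<Rightarrow> 'h::{real_inner, second_countable_topology}"
  assumes "square_integrable M f" "square_integrable M g"
  shows "square_integrable M (\<lambda>\<omega>. f \<omega> - g \<omega>)"
  using square_integrable_add[OF assms(1) square_integrable_scaleR[OF assms(2), of "-1"]] by simp

lemma integrable_inner_square_integrable:
  fixes f g :: "'a \<Rightarrow> 'h::{real_inner, second_countable_topology}"
  assumes f: "square_integrable M f" and g: "square_integrable M g"
  shows "integrable M (\<lambda>\<omega>. inner (f \<omega>) (g \<omega>))"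
proof -
  have "integrable M (\<lambda>\<omega>. ((norm (f \<omega> + g \<omega>))\<^sup>2 - (norm (f \<omega>))\<^sup>2 - (norm (g \<omega>))\<^sup>2) / 2)"
    using f g square_integrable_add[OF f g] by (auto simp: square_integrable_def)
  moreover have "((norm (f \<omega> + g \<omega>))\<^sup>2 - (norm (f \<omega>))\<^sup>2 - (norm (g \<omega>))\<^sup>2) / 2 = inner (f \<omega>) (g \<omega>)" for \<omega>
    by (simp add: power2_norm_eq_inner inner_add_left inner_add_right inner_commute)
  ultimately show ?thesis by simp
qed

lemma square_integrable_inner:
  fixes v :: "'a \<Rightarrow> 'h::{real_inner, second_countable_topology}"
  assumes v: "square_integrable M v"
  shows "square_integrable M (\<lambda>\<omega>. inner (v \<omega>) h)"
    "(\<integral>\<omega>. (inner (v \<omega>) h)\<^sup>2 \<partial>M) \<le> (\<integral>\<omega>. (norm (v \<omega>))\<^sup>2 \<partial>M) * (norm h)\<^sup>2"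
proof -
  have [measurable]: "v \<in> borel_measurable M" using v by (rule square_integrable_measurable)
  have nv: "integrable M (\<lambda>\<omega>. (norm (v \<omega>))\<^sup>2 * (norm h)\<^sup>2)" using v by (simp add: square_integrable_def)
  have le: "(inner (v \<omega>) h)\<^sup>2 \<le> (norm (v \<omega>))\<^sup>2 * (norm h)\<^sup>2" for \<omega>
    using Cauchy_Schwarz_ineq[of "v \<omega>" h] by (simp add: power2_norm_eq_inner)
  have int: "integrable M (\<lambda>\<omega>. (inner (v \<omega>) h)\<^sup>2)"
    by (rule Bochner_Integration.integrable_bound[OF nv], measurable) (use le in auto)
  then show "square_integrable M (\<lambda>\<omega>. inner (v \<omega>) h)" by (simp add: square_integrable_def)
  have "(\<integral>\<omega>. (inner (v \<omega>) h)\<^sup>2 \<partial>M) \<le> (\<integral>\<omega>. (norm (v \<omega>))\<^sup>2 * (norm h)\<^sup>2 \<partial>M)"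
    using int nv le by (intro integral_mono) auto
  then show "(\<integral>\<omega>. (inner (v \<omega>) h)\<^sup>2 \<partial>M) \<le> (\<integral>\<omega>. (norm (v \<omega>))\<^sup>2 \<partial>M) * (norm h)\<^sup>2" by simp
qed

lemma integral_norm_add_scaleR_sq:
  fixes f g :: "'a \<Rightarrow> 'h::{real_inner, second_countable_topology}"
  assumes f: "square_integrable M f" and g: "square_integrable M g"
  shows "(\<integral>\<omega>. (norm (f \<omega> + t *\<^sub>R g \<omega>))\<^sup>2 \<partial>M)
    = (\<integral>\<omega>. (norm (f \<omega>))\<^sup>2 \<partial>M) + 2 * t * (\<integral>\<omega>. inner (f \<omega>) (g \<omega>) \<partial>M) + t\<^sup>2 * (\<integral>\<omega>. (norm (g \<omega>))\<^sup>2 \<partial>M)"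
proof -
  have "(\<integral>\<omega>. (norm (f \<omega> + t *\<^sub>R g \<omega>))\<^sup>2 \<partial>M)
      = (\<integral>\<omega>. (norm (f \<omega>))\<^sup>2 + 2 * t * inner (f \<omega>) (g \<omega>) + t\<^sup>2 * (norm (g \<omega>))\<^sup>2 \<partial>M)"
    by (intro Bochner_Integration.integral_cong refl)
       (simp add: power2_norm_eq_inner inner_add_left inner_add_right inner_commute power2_eq_square[of t] algebra_simps)
  then show ?thesis
    using f g integrable_inner_square_integrable[OF f g] by (simp add: square_integrable_def)
qed

lemma fatou_square:
  fixes g :: "'a \<Rightarrow> 'h::{real_inner, second_countable_topology}"
  assumes gn: "\<And>n. square_integrable M (h n)" and g[measurable]: "g \<in> borel_measurable M"
    and lim: "AE \<omega> in M. (\<lambda>n. h n \<omega>) \<longlonglongrightarrow> g \<omega>"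
    and bound: "\<forall>\<^sub>F n in sequentially. (\<integral>\<omega>. (norm (h n \<omega>))\<^sup>2 \<partial>M) \<le> C"
  shows "square_integrable M g" "(\<integral>\<omega>. (norm (g \<omega>))\<^sup>2 \<partial>M) \<le> C"
proof -
  have [measurable]: "h n \<in> borel_measurable M" for n using gn by (rule square_integrable_measurable)
  obtain n where "(\<integral>\<omega>. (norm (h n \<omega>))\<^sup>2 \<partial>M) \<le> C" using bound by (auto simp: eventually_sequentially)
  then have C: "0 \<le> C" by (rule order_trans[rotated]) simp
  have "(\<integral>\<^sup>+\<omega>. ennreal ((norm (g \<omega>))\<^sup>2) \<partial>M) = (\<integral>\<^sup>+\<omega>. liminf (\<lambda>n. ennreal ((norm (h n \<omega>))\<^sup>2)) \<partial>M)"
  proof (rule nn_integral_cong_AE)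
    show "AE \<omega> in M. ennreal ((norm (g \<omega>))\<^sup>2) = liminf (\<lambda>n. ennreal ((norm (h n \<omega>))\<^sup>2))"
      using lim
    proof eventually_elim
      case (elim \<omega>)
      have "(\<lambda>n. ennreal ((norm (h n \<omega>))\<^sup>2)) \<longlonglongrightarrow> ennreal ((norm (g \<omega>))\<^sup>2)"
        by (intro tendsto_ennrealI tendsto_intros elim)
      then show ?case by (rule lim_imp_Liminf[OF sequentially_bot, symmetric])
    qed
  qed
  also have "\<dots> \<le> liminf (\<lambda>n. \<integral>\<^sup>+\<omega>. ennreal ((norm (h n \<omega>))\<^sup>2) \<partial>M)"
    by (rule nn_integral_liminf) simp
  also have "\<dots> \<le> ennreal C"
  proof (rule Liminf_le[OF sequentially_bot])
    show "\<forall>\<^sub>F n in sequentially. (\<integral>\<^sup>+\<omega>. ennreal ((norm (h n \<omega>))\<^sup>2) \<partial>M) \<le> ennreal C"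
      using bound
    proof eventually_elim
      case (elim n)
      have "(\<integral>\<^sup>+\<omega>. ennreal ((norm (h n \<omega>))\<^sup>2) \<partial>M) = ennreal (\<integral>\<omega>. (norm (h n \<omega>))\<^sup>2 \<partial>M)"
        using gn[of n] by (intro nn_integral_eq_integral) (auto simp: square_integrable_def)
      then show ?case using elim by (simp add: ennreal_leI)
    qed
  qed
  finally have le: "(\<integral>\<^sup>+\<omega>. ennreal ((norm (g \<omega>))\<^sup>2) \<partial>M) \<le> ennreal C" .
  then have "integrable M (\<lambda>\<omega>. (norm (g \<omega>))\<^sup>2)"
    by (intro integrableI_bounded) (auto intro: le_less_trans)
  then show "square_integrable M g" by (simp add: square_integrable_def)
  have "ennreal (\<integral>\<omega>. (norm (g \<omega>))\<^sup>2 \<partial>M) \<le> ennreal C"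
    using le nn_integral_eq_integral[OF \<open>integrable M (\<lambda>\<omega>. (norm (g \<omega>))\<^sup>2)\<close>] by simp
  then show "(\<integral>\<omega>. (norm (g \<omega>))\<^sup>2 \<partial>M) \<le> C" using C by simp
qed

end

text \<open>The parallelogram law, arranged for minimising sequences in a convex set.\<close>

lemma midpoint_identity:
  fixes x a b :: "'h::real_inner"
  shows "(norm (a - b))\<^sup>2 = 2 * (norm (x - a))\<^sup>2 + 2 * (norm (x - b))\<^sup>2
    - 4 * (norm (x - ((1 / 2) *\<^sub>R a + (1 / 2) *\<^sub>R b)))\<^sup>2"
proof -
  define p q where "p = x - a" and "q = x - b"
  have "(1 / 2) *\<^sub>R (p + q) = (1 / 2) *\<^sub>R (x + x) - ((1 / 2) *\<^sub>R a + (1 / 2) *\<^sub>R b)"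
    by (simp add: p_def q_def scaleR_add_right scaleR_diff_right)
  then have "x - ((1 / 2) *\<^sub>R a + (1 / 2) *\<^sub>R b) = (1 / 2) *\<^sub>R (p + q)" by simp
  then have "4 * (norm (x - ((1 / 2) *\<^sub>R a + (1 / 2) *\<^sub>R b)))\<^sup>2 = (norm (p + q))\<^sup>2"
    by (simp add: power_mult_distrib power_divide)
  moreover have ab: "a - b = q - p" by (simp add: p_def q_def)
  moreover have "(norm (q - p))\<^sup>2 + (norm (p + q))\<^sup>2 = 2 * (norm p)\<^sup>2 + 2 * (norm q)\<^sup>2"
    by (simp add: power2_norm_eq_inner inner_add_left inner_add_right inner_diff_left inner_diff_right inner_commute)
  ultimately show ?thesis unfolding p_def[symmetric] q_def[symmetric] ab by linarith
qed

lemma linear_term_zero: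
  fixes b c :: real
  assumes q: "\<And>t. 0 \<le> 2 * t * b + t\<^sup>2 * c" and c: "0 \<le> c"
  shows "b = 0"
proof -
  have "0 \<le> 2 * (- b / (c + 1)) * b + (- b / (c + 1))\<^sup>2 * c" by (rule q)
  also have "\<dots> = - (b\<^sup>2 * ((c + 2) / (c + 1)\<^sup>2))"
    using c by (simp add: power2_eq_square divide_simps) (simp add: algebra_simps)
  finally have "b\<^sup>2 * ((c + 2) / (c + 1)\<^sup>2) \<le> 0" by simp
  moreover have "0 < (c + 2) / (c + 1)\<^sup>2" using c by (intro divide_pos_pos) auto
  ultimately have "b\<^sup>2 \<le> 0" by (metis mult_le_0_iff not_le)
  then show ?thesis by simp
qed

text \<open>The projection theorem, for functions instead of classes: a minimising sequence is
  Cauchy in mean square, a subsequence converges almost surely, and Fatou's lemma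
  identifies the limit. Closedness of \<open>V\<close> need therefore only be known for sequences that
  converge both almost surely and in mean square.\<close>

lemma (in prob_space) L2_projection_exists:
  fixes x :: "'a \<Rightarrow> 'h::{real_inner, banach, second_countable_topology}" and V :: "('a \<Rightarrow> 'h) set"
  assumes x: "square_integrable M x"
    and Vsq: "\<And>v. v \<in> V \<Longrightarrow> square_integrable M v" and V0: "V \<noteq> {}"
    and lin: "\<And>u v a b. u \<in> V \<Longrightarrow> v \<in> V \<Longrightarrow> (\<lambda>\<omega>. a *\<^sub>R u \<omega> + b *\<^sub>R v \<omega>) \<in> V"
    and closed: "\<And>v z. (\<And>n :: nat. v n \<in> V) \<Longrightarrow> square_integrable M z \<Longrightarrow> AE \<omega> in M. (\<lambda>n. v n \<omega>) \<longlonglongrightarrow> z \<omega> \<Longrightarrow>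
        (\<lambda>n. \<integral>\<omega>. (norm (v n \<omega> - z \<omega>))\<^sup>2 \<partial>M) \<longlonglongrightarrow> 0 \<Longrightarrow> z \<in> V"
  shows "\<exists>z. is_L2_projection M V x z"
proof -
  define N where "N = (\<lambda>v. \<integral>\<omega>. (norm (x \<omega> - v \<omega>))\<^sup>2 \<partial>M)"
  define d where "d = (INF v\<in>V. N v)"
  have Nnn: "0 \<le> N v" for v by (simp add: N_def)
  have bdd: "bdd_below (N ` V)" using Nnn by (auto intro!: bdd_belowI[of _ 0])
  have dle: "d \<le> N v" if "v \<in> V" for v unfolding d_def using bdd that by (rule cINF_lower)
  have "\<exists>v\<in>V. N v < d + inverse (real (Suc n))" for n
  proof -
    have "Inf (N ` V) < d + inverse (real (Suc n))" by (simp add: d_def)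
    then show ?thesis using V0 by (subst (asm) cInf_less_iff) (auto simp: bdd)
  qed
  then obtain v where v: "\<And>n. v n \<in> V" and Nv: "\<And>n. N (v n) < d + inverse (real (Suc n))" by metis
  note sqv = Vsq[OF v]
  have [measurable]: "x \<in> borel_measurable M" "v n \<in> borel_measurable M" for n
    using x sqv by (auto simp: square_integrable_def)
  have para: "(\<integral>\<omega>. (norm (v m \<omega> - v n \<omega>))\<^sup>2 \<partial>M) \<le> 2 * inverse (real (Suc m)) + 2 * inverse (real (Suc n))" for m n
  proof -
    let ?u = "\<lambda>\<omega>. (1 / 2) *\<^sub>R v m \<omega> + (1 / 2) *\<^sub>R v n \<omega>"
    have u: "?u \<in> V" using v by (intro lin)
    have i: "integrable M (\<lambda>\<omega>. (norm (x \<omega> - u \<omega>))\<^sup>2)" if "square_integrable M u" for u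
      using square_integrable_diff[OF x that] by (simp add: square_integrable_def)
    have "(\<integral>\<omega>. (norm (v m \<omega> - v n \<omega>))\<^sup>2 \<partial>M)
        = (\<integral>\<omega>. 2 * (norm (x \<omega> - v m \<omega>))\<^sup>2 + 2 * (norm (x \<omega> - v n \<omega>))\<^sup>2 - 4 * (norm (x \<omega> - ?u \<omega>))\<^sup>2 \<partial>M)"
      by (intro Bochner_Integration.integral_cong refl midpoint_identity)
    also have "\<dots> = 2 * N (v m) + 2 * N (v n) - 4 * N ?u"
      using i[OF sqv[of m]] i[OF sqv[of n]] i[OF Vsq[OF u]] by (simp add: N_def)
    also have "\<dots> \<le> 2 * inverse (real (Suc m)) + 2 * inverse (real (Suc n))"
      using Nv[of m] Nv[of n] dle[OF u] by simp
    finally show ?thesis .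
  qed
  have intv: "integrable M (v n)" for n
  proof -
    have "integrable M (\<lambda>\<omega>. norm (v n \<omega>))"
    proof (rule integrable_of_square)
      show "integrable M (\<lambda>\<omega>. (norm (v n \<omega>))\<^sup>2)" using sqv[of n] unfolding square_integrable_def by blast
    qed measurable
    then show ?thesis by (simp only: integrable_norm_iff[OF \<open>v n \<in> borel_measurable M\<close>])
  qed
  have L1: "\<exists>K. \<forall>i\<ge>K. \<forall>j\<ge>K. LINT \<omega>|M. norm (v i \<omega> - v j \<omega>) < e" if e: "e > 0" for e
  proof -
    obtain K where K: "inverse (real (Suc K)) < e\<^sup>2 / 4" using reals_Archimedean[of "e\<^sup>2 / 4"] e by auto
    have "LINT \<omega>|M. norm (v i \<omega> - v j \<omega>) < e" if "i \<ge> K" "j \<ge> K" for i j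
    proof -
      have sq: "integrable M (\<lambda>\<omega>. (norm (v i \<omega> - v j \<omega>))\<^sup>2)"
        using square_integrable_diff[OF sqv[of i] sqv[of j]] by (simp add: square_integrable_def)
      have "(LINT \<omega>|M. norm (v i \<omega> - v j \<omega>)) \<le> (LINT \<omega>|M. ((norm (v i \<omega> - v j \<omega>))\<^sup>2 / e + e) / 2)"
      proof (rule integral_mono)
        fix \<omega>
        have "0 \<le> (norm (v i \<omega> - v j \<omega>) - e)\<^sup>2 / e" using e by simp
        then show "norm (v i \<omega> - v j \<omega>) \<le> ((norm (v i \<omega> - v j \<omega>))\<^sup>2 / e + e) / 2"
          using e by (simp add: power2_eq_square field_simps)
      qed (use sq intv in auto)
      also have "\<dots> = ((LINT \<omega>|M. (norm (v i \<omega> - v j \<omega>))\<^sup>2) / e + e) / 2"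
        using sq by (simp add: prob_space)
      also have "(LINT \<omega>|M. (norm (v i \<omega> - v j \<omega>))\<^sup>2) < e\<^sup>2"
      proof -
        have "inverse (real (Suc i)) \<le> inverse (real (Suc K))" "inverse (real (Suc j)) \<le> inverse (real (Suc K))"
          using that by (auto intro!: le_imp_inverse_le)
        then show ?thesis using para[of i j] K by linarith
      qed
      then have "((LINT \<omega>|M. (norm (v i \<omega> - v j \<omega>))\<^sup>2) / e + e) / 2 < (e\<^sup>2 / e + e) / 2"
        using e by (intro divide_strict_right_mono add_strict_right_mono) auto
      also have "\<dots> = e" using e by (simp add: power2_eq_square)
      finally show ?thesis .
    qed
    then show ?thesis by blast
  qed
  obtain r where r: "strict_mono r" "AE \<omega> in M. Cauchy (\<lambda>i. v (r i) \<omega>)"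
    using cauchy_L1_AE_cauchy_subseq[OF intv L1] by blast
  define z where "z = (\<lambda>\<omega>. lim (\<lambda>i. v (r i) \<omega>))"
  have [measurable]: "z \<in> borel_measurable M" unfolding z_def by measurable
  have lim: "AE \<omega> in M. (\<lambda>i. v (r i) \<omega>) \<longlonglongrightarrow> z \<omega>"
    using r(2) by eventually_elim (simp add: z_def Cauchy_convergent_iff convergent_LIMSEQ_iff)
  have rge: "inverse (real (Suc (r n))) \<le> inverse (real (Suc n))" for n
    using seq_suble[OF r(1), of n] by (intro le_imp_inverse_le) auto
  have dist: "square_integrable M (\<lambda>\<omega>. v (r n) \<omega> - z \<omega>) \<and> (\<integral>\<omega>. (norm (v (r n) \<omega> - z \<omega>))\<^sup>2 \<partial>M) \<le> 4 * inverse (real (Suc n))" for n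
  proof -
    have b: "\<forall>\<^sub>F m in sequentially. (\<integral>\<omega>. (norm (v (r n) \<omega> - v (r m) \<omega>))\<^sup>2 \<partial>M) \<le> 4 * inverse (real (Suc n))"
      unfolding eventually_sequentially
    proof (intro exI[of _ n] allI impI)
      fix m assume "n \<le> m"
      then have "inverse (real (Suc m)) \<le> inverse (real (Suc n))" by (intro le_imp_inverse_le) auto
      then show "(\<integral>\<omega>. (norm (v (r n) \<omega> - v (r m) \<omega>))\<^sup>2 \<partial>M) \<le> 4 * inverse (real (Suc n))"
        using para[of "r n" "r m"] rge[of n] rge[of m] by linarith
    qed
    have l: "AE \<omega> in M. (\<lambda>m. v (r n) \<omega> - v (r m) \<omega>) \<longlonglongrightarrow> v (r n) \<omega> - z \<omega>"
      using lim by eventually_elim (intro tendsto_intros)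
    show ?thesis
      using fatou_square[OF square_integrable_diff[OF sqv sqv] _ l b] by auto
  qed
  have zsq: "square_integrable M z"
    using square_integrable_diff[OF sqv[of "r 0"] conjunct1[OF dist[of 0]]] by simp
  have zV: "z \<in> V"
  proof (rule closed[OF _ zsq lim])
    show "(\<lambda>n. \<integral>\<omega>. (norm (v (r n) \<omega> - z \<omega>))\<^sup>2 \<partial>M) \<longlonglongrightarrow> 0"
    proof (rule tendsto_sandwich[OF _ _ tendsto_const])
      show "(\<lambda>n. 4 * inverse (real (Suc n))) \<longlonglongrightarrow> 0"
        using tendsto_mult_right_zero[OF LIMSEQ_inverse_real_of_nat] by blast
    qed (use dist in auto)
  qed (rule v)
  have Nz: "N z \<le> d + \<epsilon>" if "\<epsilon> > 0" for \<epsilon>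
    unfolding N_def
  proof (rule fatou_square(2))
    show "square_integrable M (\<lambda>\<omega>. x \<omega> - v (r n) \<omega>)" for n by (rule square_integrable_diff[OF x sqv])
    show "AE \<omega> in M. (\<lambda>n. x \<omega> - v (r n) \<omega>) \<longlonglongrightarrow> x \<omega> - z \<omega>"
      using lim by eventually_elim (intro tendsto_intros)
    have "\<forall>\<^sub>F n in sequentially. inverse (real (Suc n)) < \<epsilon>"
      using that by (intro order_tendstoD[OF LIMSEQ_inverse_real_of_nat])
    then show "\<forall>\<^sub>F n in sequentially. (\<integral>\<omega>. (norm (x \<omega> - v (r n) \<omega>))\<^sup>2 \<partial>M) \<le> d + \<epsilon>"
    proof eventually_elim
      case (elim n)
      then show ?case using Nv[of "r n"] rge[of n] unfolding N_def by linarith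
    qed
  qed simp
  then have Nzd: "N z \<le> d" by (rule field_le_epsilon)
  have "(\<integral>\<omega>. inner (x \<omega> - z \<omega>) (u \<omega>) \<partial>M) = 0" if u: "u \<in> V" for u
  proof -
    let ?\<beta> = "\<integral>\<omega>. inner (x \<omega> - z \<omega>) (u \<omega>) \<partial>M" and ?\<gamma> = "\<integral>\<omega>. (norm (u \<omega>))\<^sup>2 \<partial>M"
    have q: "0 \<le> 2 * t * ?\<beta> + t\<^sup>2 * ?\<gamma>" for t
    proof -
      have "(\<lambda>\<omega>. 1 *\<^sub>R z \<omega> + (- t) *\<^sub>R u \<omega>) \<in> V" by (intro lin zV u)
      from dle[OF this] have "d \<le> N (\<lambda>\<omega>. z \<omega> - t *\<^sub>R u \<omega>)" by simp
      also have "N (\<lambda>\<omega>. z \<omega> - t *\<^sub>R u \<omega>) = (\<integral>\<omega>. (norm ((x \<omega> - z \<omega>) + t *\<^sub>R u \<omega>))\<^sup>2 \<partial>M)"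
        by (simp add: N_def algebra_simps)
      also have "\<dots> = N z + 2 * t * ?\<beta> + t\<^sup>2 * ?\<gamma>"
        unfolding N_def by (rule integral_norm_add_scaleR_sq[OF square_integrable_diff[OF x zsq] Vsq[OF u]])
      finally show ?thesis using Nzd by simp
    qed
    have "?\<beta> = 0" by (rule linear_term_zero[OF q]) simp
    then show ?thesis by simp
  qed
  then show ?thesis using zV unfolding is_L2_projection_def by blast
qed

lemma (in prob_space) L2_projection_minimises:
  fixes x :: "'a \<Rightarrow> 'h::{real_inner, banach, second_countable_topology}" and V :: "('a \<Rightarrow> 'h) set"
  assumes x: "square_integrable M x"
    and Vsq: "\<And>v. v \<in> V \<Longrightarrow> square_integrable M v"
    and lin: "\<And>u v a b. u \<in> V \<Longrightarrow> v \<in> V \<Longrightarrow> (\<lambda>\<omega>. a *\<^sub>R u \<omega> + b *\<^sub>R v \<omega>) \<in> V"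
    and z: "is_L2_projection M V x z" and v: "v \<in> V"
  shows "(\<integral>\<omega>. (norm (x \<omega> - z \<omega>))\<^sup>2 \<partial>M) \<le> (\<integral>\<omega>. (norm (x \<omega> - v \<omega>))\<^sup>2 \<partial>M)"
proof -
  have zV: "z \<in> V" using z by (simp add: is_L2_projection_def)
  have "(\<lambda>\<omega>. 1 *\<^sub>R z \<omega> + (- 1) *\<^sub>R v \<omega>) \<in> V" by (intro lin zV v)
  then have zv: "(\<lambda>\<omega>. z \<omega> - v \<omega>) \<in> V" by simp
  then have "(\<integral>\<omega>. inner (x \<omega> - z \<omega>) (z \<omega> - v \<omega>) \<partial>M) = 0" using z by (simp add: is_L2_projection_def)
  then have "(\<integral>\<omega>. (norm (x \<omega> - v \<omega>))\<^sup>2 \<partial>M) = (\<integral>\<omega>. (norm (x \<omega> - z \<omega>))\<^sup>2 \<partial>M) + (\<integral>\<omega>. (norm (z \<omega> - v \<omega>))\<^sup>2 \<partial>M)"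
    using integral_norm_add_scaleR_sq[OF square_integrable_diff[OF x Vsq[OF zV]] Vsq[OF zv], of 1] by simp
  then show ?thesis by simp
qed

section \<open>A signal observed in white noise\<close>

lemma projection_flow_continuous_nest:
  assumes "projection_flow \<iota> p"
  shows "continuous_nest p"
proof -
  note flow = assms[unfolded projection_flow_def]
  have idem: "p t (p t h) = p t h" and sym: "inner (p t h) k = inner h (p t k)" if "t \<in> {0..1}" for t h k
    using flow that by blast+
  have up: "p t (p s h) = p s h" if "0 \<le> s" "s \<le> t" "t \<le> 1" for s t h
  proof (cases "s = t")
    case True
    then show ?thesis using idem that by simp
  next
    case False
    then have "range (p s) \<subset> range (p t)" using flow that by auto
    then obtain k where "p s h = p t k" by blast
    then show ?thesis using idem[of t k] that by simp
  qed
  show ?thesis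
  proof (rule continuous_nest.intro)
    fix t :: real assume t: "t \<in> {0..1}"
    show "orthogonal_projection (p t)"
      by (rule orthogonal_projection.intro)
         (use idem[OF t] sym[OF t] in \<open>auto simp: linear_iff blinfun.add_right blinfun.scaleR_right\<close>)
  next
    fix s t :: real and h assume st: "0 \<le> s" "s \<le> t" "t \<le> 1"
    show "p t (p s h) = p s h" by (rule up[OF st])
    have "inner (p s (p t h)) k = inner (p s h) k" for k
      using sym[of s "p t h" k] sym[of t h "p s k"] sym[of s h k] up[OF st, of k] st by simp
    then show "p s (p t h) = p s h" by (metis vector_eq_rdot)
  qed (use flow in auto)
qed

lemma inner_dual_embed:
  fixes \<iota> :: "'h::{real_inner, banach, second_countable_topology} \<Rightarrow>\<^sub>L 'w::real_normed_vector"
  shows "inner h (dual_embed \<iota> l) = l (\<iota> h)"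
proof -
  have "bounded_linear (\<lambda>h. l (\<iota> h))"
    by (intro bounded_linear_compose[OF blinfun.bounded_linear_right] blinfun.bounded_linear_right)
  then obtain k where k: "\<forall>h. inner h k = l (\<iota> h)" using riesz_representation by blast
  have "\<forall>h. inner h (dual_embed \<iota> l) = l (\<iota> h)"
    unfolding dual_embed_def
  proof (rule theI[of _ k])
    fix k' assume "\<forall>h. inner h k' = l (\<iota> h)"
    then show "k' = k" using k by (metis vector_eq_ldot)
  qed (rule k)
  then show ?thesis by blast
qed

lemma dual_embed_combination:
  fixes \<iota> :: "'h::{real_inner, banach, second_countable_topology} \<Rightarrow>\<^sub>L 'w::real_normed_vector"
  shows "dual_embed \<iota> (a *\<^sub>R l + b *\<^sub>R l') = a *\<^sub>R dual_embed \<iota> l + b *\<^sub>R dual_embed \<iota> l'"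
proof -
  have "inner h (dual_embed \<iota> (a *\<^sub>R l + b *\<^sub>R l')) = inner h (a *\<^sub>R dual_embed \<iota> l + b *\<^sub>R dual_embed \<iota> l')" for h
    by (simp add: inner_dual_embed inner_add_right blinfun.add_left blinfun.scaleR_left)
  then show ?thesis by (metis vector_eq_ldot)
qed

text \<open>Real or complex functions of the two variables have a common type, so that expectations
  of products factor.\<close>

lemma (in prob_space) independent_rv_compose:
  fixes X :: "'a \<Rightarrow> 'b::topological_space" and Y :: "'a \<Rightarrow> 'c::topological_space"
    and f :: "'b \<Rightarrow> 'd::topological_space" and g :: "'c \<Rightarrow> 'd"
  assumes ind: "independent_rv M X Y" and f: "f \<in> borel_measurable borel" and g: "g \<in> borel_measurable borel"
  shows "indep_var borel (\<lambda>\<omega>. f (X \<omega>)) borel (\<lambda>\<omega>. g (Y \<omega>))"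
proof -
  have X: "X \<in> borel_measurable M" and Y: "Y \<in> borel_measurable M"
  proof -
    have "{X -` A \<inter> space M | A. A \<in> sets borel} \<subseteq> events" "{Y -` B \<inter> space M | B. B \<in> sets borel} \<subseteq> events"
      using ind unfolding independent_rv_def indep_set_def indep_sets_def by (auto split: bool.splits)
    then show "X \<in> borel_measurable M" "Y \<in> borel_measurable M" by (auto intro!: measurableI)
  qed
  let ?F = "{(\<lambda>\<omega>. f (X \<omega>)) -` A \<inter> space M | A. A \<in> sets borel}"
  let ?G = "{(\<lambda>\<omega>. g (Y \<omega>)) -` A \<inter> space M | A. A \<in> sets borel}"
  have sub: "?F \<subseteq> {X -` A \<inter> space M | A. A \<in> sets borel}" "?G \<subseteq> {Y -` A \<inter> space M | A. A \<in> sets borel}"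
  proof safe
    fix A :: "'d set" assume "A \<in> sets borel"
    then have "f -` A \<in> sets borel" using measurable_sets[OF f] by simp
    then show "\<exists>A'. (\<lambda>\<omega>. f (X \<omega>)) -` A \<inter> space M = X -` A' \<inter> space M \<and> A' \<in> sets borel"
      by (intro exI[of _ "f -` A"]) auto
  next
    fix A :: "'d set" assume "A \<in> sets borel"
    then have "g -` A \<in> sets borel" using measurable_sets[OF g] by simp
    then show "\<exists>A'. (\<lambda>\<omega>. g (Y \<omega>)) -` A \<inter> space M = Y -` A' \<inter> space M \<and> A' \<in> sets borel"
      by (intro exI[of _ "g -` A"]) auto
  qed
  have "indep_set ?F ?G"
    using ind sub unfolding independent_rv_def indep_set_def
    by (elim indep_sets_mono_sets) (auto split: bool.splits)
  moreover have "Int_stable ?F" "Int_stable ?G"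
  proof -
    have *: "Int_stable {h -` A \<inter> space M | A. A \<in> sets borel}" for h :: "'a \<Rightarrow> 'z::topological_space"
    proof (rule Int_stableI, safe)
      fix A B :: "'z set" assume "A \<in> sets borel" "B \<in> sets borel"
      then show "\<exists>C. h -` A \<inter> space M \<inter> (h -` B \<inter> space M) = h -` C \<inter> space M \<and> C \<in> sets borel"
        by (intro exI[of _ "A \<inter> B"]) auto
    qed
    show "Int_stable ?F" "Int_stable ?G" by (rule *)+
  qed
  ultimately have "indep_set (sigma_sets (space M) ?F) (sigma_sets (space M) ?G)"
    by (intro indep_set_sigma_sets)
  then show ?thesis
    unfolding indep_var_eq using measurable_compose[OF X f] measurable_compose[OF Y g] by simp
qed

text \<open>The modes satisfy \<open>\<gamma> R = \<Sum>\<^sub>i \<phi>\<^sub>i \<otimes> \<phi>\<^sub>i\<close>; the signal is square integrable, Gaussian or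
  not.\<close>

locale signal_in_noise = abstract_wiener_space M \<iota> w + nest_with_family p \<phi> A
  for M :: "'a measure"
    and \<iota> :: "'h::{real_inner, banach, second_countable_topology} \<Rightarrow>\<^sub>L 'w::banach"
    and w :: "'a \<Rightarrow> 'w"
    and p :: "real \<Rightarrow> 'h \<Rightarrow>\<^sub>L 'h"
    and \<phi> :: "nat \<Rightarrow> 'h" and A :: "'h \<Rightarrow>\<^sub>L 'h" +
  fixes x :: "'a \<Rightarrow> 'h" and y :: "'a \<Rightarrow> 'w" and R :: "'h \<Rightarrow>\<^sub>L 'h" and \<gamma> :: real
  assumes flow: "projection_flow \<iota> p"
    and \<gamma>: "0 < \<gamma>"
    and indep: "independent_rv M x w"
    and corr: "correlation_operator M x R"
    and A_eq: "A = \<gamma> *\<^sub>R R"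
    and x_sq: "square_integrable M x"
    and y_eq: "y = (\<lambda>\<omega>. sqrt \<gamma> *\<^sub>R \<iota> (x \<omega>) + w \<omega>)"
begin

lemma x_measurable [measurable]: "x \<in> borel_measurable M"
  using x_sq by (rule square_integrable_measurable)

lemma w_measurable [measurable]: "w \<in> borel_measurable M"
  using gaussian by (simp add: centered_gaussian_def)

lemma functional_measurable: "blinfun_apply l \<in> borel_measurable borel" for l :: "'z::real_normed_vector \<Rightarrow>\<^sub>L real"
  by (intro borel_measurable_continuous_onI continuous_intros)

lemma noise_gaussian: "real_centered_gaussian M (\<lambda>\<omega>. blinfun_apply l (w \<omega>))" for l :: "'w \<Rightarrow>\<^sub>L real"
  using gaussian by (simp add: centered_gaussian_def)

lemma noise_measurable [measurable]: "(\<lambda>\<omega>. blinfun_apply l (w \<omega>)) \<in> borel_measurable M" for l :: "'w \<Rightarrow>\<^sub>L real"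
  using noise_gaussian by (rule real_centered_gaussian_measurable)

lemma noise_square: "integrable M (\<lambda>\<omega>. (blinfun_apply l (w \<omega>))\<^sup>2)" for l :: "'w \<Rightarrow>\<^sub>L real"
  using noise_gaussian by (rule real_centered_gaussian_integrable_power)

lemma signal_square: "integrable M (\<lambda>\<omega>. (inner (x \<omega>) h)\<^sup>2)"
  using square_integrable_inner(1)[OF x_sq] by (simp add: square_integrable_def)

lemma signal_noise_uncorrelated: "(\<integral>\<omega>. inner (x \<omega>) h * blinfun_apply l (w \<omega>) \<partial>M) = 0"
  for l :: "'w \<Rightarrow>\<^sub>L real"
proof -
  have "indep_var borel (\<lambda>\<omega>. inner (x \<omega>) h) borel (\<lambda>\<omega>. blinfun_apply l (w \<omega>))"
    by (intro independent_rv_compose[OF indep] functional_measurable) simp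
  then have "(\<integral>\<omega>. inner (x \<omega>) h * blinfun_apply l (w \<omega>) \<partial>M)
      = (\<integral>\<omega>. inner (x \<omega>) h \<partial>M) * (\<integral>\<omega>. blinfun_apply l (w \<omega>) \<partial>M)"
    by (rule indep_var_lebesgue_integral)
       (rule integrable_of_square; (rule signal_square noise_square | measurable))+
  then show ?thesis by (simp add: real_centered_gaussian_moments(1)[OF noise_gaussian])
qed

text \<open>Signal and noise are uncorrelated, so the second moments of all linear functionals, and
  with them the linear theory, depend on \<open>R\<close> only.\<close>

lemma second_moment:
  "(\<integral>\<omega>. (inner (x \<omega>) h + blinfun_apply l (w \<omega>))\<^sup>2 \<partial>M) = inner (R h) h + (norm (dual_embed \<iota> l))\<^sup>2"
    (is ?eq)
  "integrable M (\<lambda>\<omega>. (inner (x \<omega>) h + blinfun_apply l (w \<omega>))\<^sup>2)" (is ?int)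
proof -
  have cross: "integrable M (\<lambda>\<omega>. inner (x \<omega>) h * blinfun_apply l (w \<omega>))"
    by (intro integrable_mult_of_squares signal_square noise_square) auto
  have sq: "(inner (x \<omega>) h + blinfun_apply l (w \<omega>))\<^sup>2
      = (inner (x \<omega>) h)\<^sup>2 + 2 * (inner (x \<omega>) h * blinfun_apply l (w \<omega>)) + (blinfun_apply l (w \<omega>))\<^sup>2" for \<omega>
    by (simp add: power2_sum)
  show ?int unfolding sq using cross signal_square noise_square by simp
  have "(\<integral>\<omega>. (inner (x \<omega>) h)\<^sup>2 \<partial>M) = inner (R h) h"
    using corr by (simp add: correlation_operator_def power2_eq_square)
  moreover have "(\<integral>\<omega>. (blinfun_apply l (w \<omega>))\<^sup>2 \<partial>M) = (norm (dual_embed \<iota> l))\<^sup>2"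
    using covariance[of l l] by (simp add: power2_eq_square[of "blinfun_apply _ _"] power2_norm_eq_inner)
  ultimately show ?eq unfolding sq using cross signal_square noise_square
    by (simp add: signal_noise_uncorrelated)
qed

text \<open>\<open>H\<close> is dense in \<open>\<Omega>\<close>, so a functional is determined by its Riesz representative.\<close>

lemma dual_embed_inj: "dual_embed \<iota> l = dual_embed \<iota> l' \<longleftrightarrow> l = l'"
proof
  assume eq: "dual_embed \<iota> l = dual_embed \<iota> l'"
  have "closed {v. blinfun_apply l v = blinfun_apply l' v}"
    by (intro closed_Collect_eq continuous_intros)
  moreover have "range \<iota> \<subseteq> {v. blinfun_apply l v = blinfun_apply l' v}"
    using eq inner_dual_embed[of _ \<iota> l] inner_dual_embed[of _ \<iota> l'] by auto
  ultimately have "closure (range \<iota>) \<subseteq> {v. blinfun_apply l v = blinfun_apply l' v}"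
    by (rule closure_minimal[rotated])
  then show "l = l'" using embed_dense by (intro blinfun_eqI) auto
qed simp

lemma dual_embed_dual_proj:
  assumes "t \<in> {0..1}"
  shows "dual_embed \<iota> (dual_proj \<iota> (p t) l) = p t (dual_embed \<iota> l)"
proof -
  have "p t (dual_embed \<iota> l) \<in> range (dual_embed \<iota>)"
    using flow assms unfolding projection_flow_def by blast
  then obtain l' where l': "dual_embed \<iota> l' = p t (dual_embed \<iota> l)" by (metis imageE)
  show ?thesis unfolding dual_proj_def
    by (rule theI[of _ l']) (use l' dual_embed_inj in metis)+
qed

lemma functional_y: "blinfun_apply l (y \<omega>) = sqrt \<gamma> * inner (x \<omega>) (dual_embed \<iota> l) + blinfun_apply l (w \<omega>)"
  by (simp add: y_eq blinfun.add_right blinfun.scaleR_right inner_dual_embed)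

definition obs_space :: "real \<Rightarrow> ('a \<Rightarrow> real) set" where
  "obs_space t = range (\<lambda>l \<omega>. blinfun_apply (dual_proj \<iota> (p t) l) (y \<omega>))"

text \<open>The observations up to \<open>t\<close> are the functionals of \<open>y\<close> whose representatives lie in the
  range of \<open>\<pi>\<^sub>t\<close>; in this form they are visibly a linear space that increases with \<open>t\<close>.\<close>

lemma obs_space_iff:
  assumes "t \<in> {0..1}"
  shows "\<eta> \<in> obs_space t \<longleftrightarrow> (\<exists>l. p t (dual_embed \<iota> l) = dual_embed \<iota> l \<and> \<eta> = (\<lambda>\<omega>. blinfun_apply l (y \<omega>)))"
proof
  assume "\<eta> \<in> obs_space t"
  then obtain l where l: "\<eta> = (\<lambda>\<omega>. blinfun_apply (dual_proj \<iota> (p t) l) (y \<omega>))" by (auto simp: obs_space_def)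
  have "p t (dual_embed \<iota> (dual_proj \<iota> (p t) l)) = dual_embed \<iota> (dual_proj \<iota> (p t) l)"
    using orthogonal_projection.idem[OF projection[OF assms]] dual_embed_dual_proj[OF assms] by simp
  then show "\<exists>l. p t (dual_embed \<iota> l) = dual_embed \<iota> l \<and> \<eta> = (\<lambda>\<omega>. blinfun_apply l (y \<omega>))" using l by blast
next
  assume "\<exists>l. p t (dual_embed \<iota> l) = dual_embed \<iota> l \<and> \<eta> = (\<lambda>\<omega>. blinfun_apply l (y \<omega>))"
  then obtain l where l: "p t (dual_embed \<iota> l) = dual_embed \<iota> l" "\<eta> = (\<lambda>\<omega>. blinfun_apply l (y \<omega>))" by blast
  then have "dual_proj \<iota> (p t) l = l" using dual_embed_dual_proj[OF assms, of l] dual_embed_inj by simp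
  then show "\<eta> \<in> obs_space t" using l unfolding obs_space_def by (metis rangeI)
qed

lemma obs_space_combination:
  assumes t: "t \<in> {0..1}" and "\<eta> \<in> obs_space t" "\<eta>' \<in> obs_space t"
  shows "(\<lambda>\<omega>. a * \<eta> \<omega> + b * \<eta>' \<omega>) \<in> obs_space t"
proof -
  obtain l l' where l: "p t (dual_embed \<iota> l) = dual_embed \<iota> l" "\<eta> = (\<lambda>\<omega>. blinfun_apply l (y \<omega>))"
    "p t (dual_embed \<iota> l') = dual_embed \<iota> l'" "\<eta>' = (\<lambda>\<omega>. blinfun_apply l' (y \<omega>))"
    using assms by (auto simp: obs_space_iff[OF t])
  then show ?thesis unfolding obs_space_iff[OF t]
    by (intro exI[of _ "a *\<^sub>R l + b *\<^sub>R l'"])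
       (simp add: dual_embed_combination blinfun.add_right blinfun.scaleR_right blinfun.add_left blinfun.scaleR_left)
qed

lemma obs_space_zero: "t \<in> {0..1} \<Longrightarrow> (\<lambda>\<omega>. 0) \<in> obs_space t"
  using obs_space_combination[of t "\<lambda>\<omega>. blinfun_apply (dual_proj \<iota> (p t) 0) (y \<omega>)" _ 0 0]
  unfolding obs_space_def by auto

lemma obs_space_mono:
  assumes "0 \<le> s" "s \<le> t" "t \<le> 1"
  shows "obs_space s \<subseteq> obs_space t"
  using obs_space_iff[of s] obs_space_iff[of t] p_eq_self_mono[OF assms] assms by auto

lemma obs_space_sum:
  assumes t: "t \<in> {0..1}" and "finite K" "\<And>k. k \<in> K \<Longrightarrow> \<eta> k \<in> obs_space t"
  shows "(\<lambda>\<omega>. \<Sum>k\<in>K. c k * \<eta> k \<omega>) \<in> obs_space t"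
  using assms(2,3)
proof (induction K rule: finite_induct)
  case empty
  then show ?case using obs_space_zero[OF t] by simp
next
  case (insert k K)
  then show ?case using obs_space_combination[OF t, of "\<eta> k" "\<lambda>\<omega>. \<Sum>k\<in>K. c k * \<eta> k \<omega>" "c k" 1] by simp
qed

lemma y_functional_square_integrable: "square_integrable M (\<lambda>\<omega>. blinfun_apply l (y \<omega>))"
  for l :: "'w \<Rightarrow>\<^sub>L real"
proof -
  have "(\<lambda>\<omega>. blinfun_apply l (y \<omega>)) = (\<lambda>\<omega>. inner (x \<omega>) (sqrt \<gamma> *\<^sub>R dual_embed \<iota> l) + blinfun_apply l (w \<omega>))"
    by (simp add: functional_y)
  moreover have "(\<lambda>\<omega>. inner (x \<omega>) (sqrt \<gamma> *\<^sub>R dual_embed \<iota> l) + blinfun_apply l (w \<omega>)) \<in> borel_measurable M"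
    by measurable
  ultimately show ?thesis
    using second_moment(2)[of "sqrt \<gamma> *\<^sub>R dual_embed \<iota> l" l] by (simp only: square_integrable_def real_norm_def power2_abs)
qed

lemma obs_space_square_integrable: "\<eta> \<in> obs_space t \<Longrightarrow> square_integrable M \<eta>"
  unfolding obs_space_def using y_functional_square_integrable by auto

text \<open>The mean square error of estimating \<open>(x, e)\<close> by the functional of \<open>y\<close> represented by
  \<open>u\<close>. Up to the factor \<open>\<gamma>\<close> and the scaling \<open>u \<mapsto> \<surd>\<gamma> u\<close> it is the cost for the full
  covariance \<open>K = \<gamma> R\<close> instead of \<open>K\<^sub>n\<close>.\<close>

definition cost :: "'h \<Rightarrow> 'h \<Rightarrow> real" where
  "cost e u = inner (R (e - sqrt \<gamma> *\<^sub>R u)) (e - sqrt \<gamma> *\<^sub>R u) + (norm u)\<^sup>2"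

lemma coordinate_error:
  "(\<integral>\<omega>. (inner (x \<omega>) e - blinfun_apply l (y \<omega>))\<^sup>2 \<partial>M) = cost e (dual_embed \<iota> l)"
proof -
  have m: "dual_embed \<iota> (- l) = - dual_embed \<iota> l"
    using dual_embed_combination[of \<iota> "-1" l 0 l] by simp
  have "inner (x \<omega>) e - blinfun_apply l (y \<omega>)
      = inner (x \<omega>) (e - sqrt \<gamma> *\<^sub>R dual_embed \<iota> l) + blinfun_apply (- l) (w \<omega>)" for \<omega>
    by (simp add: functional_y inner_diff_right blinfun.minus_left)
  then show ?thesis by (simp only: second_moment m cost_def norm_minus_cancel)
qed

lemma R_form_sums: "(\<lambda>i. (inner (\<phi> i) h)\<^sup>2) sums (\<gamma> * inner (R h) h)"
  using bounded_linear.sums[OF bounded_linear_inner_left A, of h h]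
  by (simp add: A_eq blinfun.scaleR_left power2_eq_square)

lemma gram_op_le: "inner (gram_op \<phi> n h) h \<le> \<gamma> * inner (R h) h"
  unfolding inner_gram_op power2_eq_square[symmetric]
  using R_form_sums[of h] by (metis sum_le_suminf[of _ "{..<n}"] sums_iff finite_lessThan zero_le_power2)

lemma R_nonneg: "0 \<le> inner (R h) h"
  using gram_op_le[of 0 h] \<gamma> by (simp add: inner_gram_op zero_le_mult_iff)

text \<open>Truncating the signal to \<open>n\<close> modes only lowers the cost.\<close>

lemma cost_lower_bound:
  assumes t: "t \<in> {0..1}" and u: "p t u = u"
  shows "inner (error_cov \<phi> (p t) n e) e \<le> \<gamma> * cost e u"
proof -
  interpret P: orthogonal_projection "p t" using t by (rule projection)
  have "inner (error_cov \<phi> (p t) n e) e \<le> P.causal_cost \<phi> n e (sqrt \<gamma> *\<^sub>R u)"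
    by (rule P.causal_cost_ge) (simp add: P.scale u)
  also have "\<dots> \<le> \<gamma> * cost e u"
    using gram_op_le[of n "e - sqrt \<gamma> *\<^sub>R u"] \<gamma>
    by (simp add: P.causal_cost_def cost_def distrib_left power_mult_distrib)
  finally show ?thesis .
qed

lemma cost_continuous: "continuous_on UNIV (\<lambda>h. cost e (p t h))"
  unfolding cost_def by (intro continuous_intros)

text \<open>The minimiser for the truncated signal is nearly optimal for the full one, since the
  neglected modes contribute at most \<open>|e - u|\<^sup>2 \<Sum>\<^sub>i\<^sub>\<ge>\<^sub>n |\<phi>\<^sub>i|\<^sup>2\<close> and the minimisers are
  bounded uniformly in \<open>n\<close>. It need not represent a functional on \<open>\<Omega>\<close>; density of \<open>\<Omega>\<^sup>*\<close>
  in \<open>H\<close> and continuity of the cost supply one that does.\<close>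

lemma cost_near_optimal:
  assumes t: "t \<in> {0..1}" and eps: "0 < \<epsilon>"
  shows "\<forall>\<^sub>F n in sequentially. \<exists>l. p t (dual_embed \<iota> l) = dual_embed \<iota> l \<and>
     \<gamma> * cost e (dual_embed \<iota> l) \<le> inner (error_cov \<phi> (p t) n e) e + \<epsilon>"
proof -
  interpret P: orthogonal_projection "p t" using t by (rule projection)
  \<comment> \<open>A bound for \<open>|e - u|\<close>, uniform in \<open>n\<close>.\<close>
  define c where "c = norm e + sqrt (\<gamma> * inner (R e) e)"
  have c0: "0 \<le> c" using R_nonneg \<gamma> by (simp add: c_def)
  have "(\<lambda>n. c\<^sup>2 * (\<Sum>i. (norm (\<phi> (i + n)))\<^sup>2)) \<longlonglongrightarrow> c\<^sup>2 * 0"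
    by (intro tendsto_intros suminf_exist_split2 summ)
  then have "\<forall>\<^sub>F n in sequentially. c\<^sup>2 * (\<Sum>i. (norm (\<phi> (i + n)))\<^sup>2) < \<epsilon> / 2"
    using eps by (intro order_tendstoD) auto
  then show ?thesis
  proof eventually_elim
    case (elim n)
    let ?C = "error_cov \<phi> (p t) n e"
    let ?u = "p t ?C"
    have nu: "(norm ?u)\<^sup>2 \<le> \<gamma> * inner (R e) e"
    proof -
      have "(norm ?u)\<^sup>2 \<le> P.causal_cost \<phi> n e ?u" by (simp add: P.causal_cost_def gram_op_nonneg)
      also have "\<dots> = inner ?C e" by (rule P.causal_cost_at_minimiser)
      also have "\<dots> \<le> inner (gram_op \<phi> n e) e" by (rule P.error_cov_le_gram_op)
      finally show ?thesis using gram_op_le[of n e] by simp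
    qed
    have nd: "(norm (e - ?u))\<^sup>2 \<le> c\<^sup>2"
    proof -
      have "norm (e - ?u) \<le> norm e + norm ?u" by (rule norm_triangle_ineq4)
      also have "norm ?u \<le> sqrt (\<gamma> * inner (R e) e)" using nu by (rule real_le_rsqrt)
      finally show ?thesis by (intro power_mono) (simp_all add: c_def)
    qed
    let ?d = "e - ?u"
    have tail: "\<gamma> * inner (R ?d) ?d - inner (gram_op \<phi> n ?d) ?d \<le> \<epsilon> / 2"
    proof -
      have s1: "(\<lambda>i. (inner (\<phi> (i + n)) ?d)\<^sup>2) sums (\<gamma> * inner (R ?d) ?d - inner (gram_op \<phi> n ?d) ?d)"
        unfolding inner_gram_op power2_eq_square[symmetric] by (subst sums_iff_shift) (simp add: R_form_sums)
      have s2: "(\<lambda>i. c\<^sup>2 * (norm (\<phi> (i + n)))\<^sup>2) sums (c\<^sup>2 * (\<Sum>i. (norm (\<phi> (i + n)))\<^sup>2))"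
        by (intro sums_mult summable_sums summable_ignore_initial_segment summ)
      have le: "(inner (\<phi> (i + n)) ?d)\<^sup>2 \<le> c\<^sup>2 * (norm (\<phi> (i + n)))\<^sup>2" for i
      proof -
        have "(inner (\<phi> (i + n)) ?d)\<^sup>2 \<le> (norm (\<phi> (i + n)) * norm ?d)\<^sup>2"
          by (metis Cauchy_Schwarz_ineq2 abs_le_square_iff abs_mult abs_norm_cancel)
        also have "\<dots> \<le> c\<^sup>2 * (norm (\<phi> (i + n)))\<^sup>2"
          using mult_right_mono[OF nd, of "(norm (\<phi> (i + n)))\<^sup>2"] by (simp add: power_mult_distrib mult.commute)
        finally show ?thesis .
      qed
      have "\<gamma> * inner (R ?d) ?d - inner (gram_op \<phi> n ?d) ?d \<le> c\<^sup>2 * (\<Sum>i. (norm (\<phi> (i + n)))\<^sup>2)"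
        by (rule sums_le[OF le s1 s2])
      then show ?thesis using elim by simp
    qed
    \<comment> \<open>The scaling turns the minimiser \<open>u\<close> into the representative of a functional of \<open>y\<close>.\<close>
    define h0 where "h0 = inverse (sqrt \<gamma>) *\<^sub>R ?C"
    have s0: "sqrt \<gamma> *\<^sub>R p t h0 = ?u" using \<gamma> by (simp add: h0_def P.scale)
    have "(norm (p t h0))\<^sup>2 * \<gamma> = (norm ?u)\<^sup>2"
      unfolding s0[symmetric] using \<gamma> by (simp add: power_mult_distrib)
    then have "\<gamma> * cost e (p t h0) = \<gamma> * inner (R ?d) ?d + (norm ?u)\<^sup>2"
      by (simp add: cost_def s0 distrib_left mult.commute)
    also have "\<dots> \<le> P.causal_cost \<phi> n e ?u + \<epsilon> / 2" using tail by (simp add: P.causal_cost_def)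
    also have "P.causal_cost \<phi> n e ?u = inner ?C e" by (rule P.causal_cost_at_minimiser)
    finally have near: "\<gamma> * cost e (p t h0) \<le> inner ?C e + \<epsilon> / 2" .
    let ?S = "{h. \<gamma> * cost e (p t h) < inner ?C e + \<epsilon>}"
    have "open ?S" using cost_continuous by (intro open_Collect_less continuous_intros) auto
    moreover have "h0 \<in> ?S" using near eps by simp
    ultimately have "?S \<inter> range (dual_embed \<iota>) \<noteq> {}"
      using dual_dense open_Int_closure_eq_empty[of ?S "range (dual_embed \<iota>)"] by auto
    then obtain l where l: "\<gamma> * cost e (p t (dual_embed \<iota> l)) < inner ?C e + \<epsilon>" by auto
    show ?case
      by (rule exI[of _ "dual_proj \<iota> (p t) l"]) (use l in \<open>simp add: dual_embed_dual_proj[OF t]\<close>)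
  qed
qed

end

section \<open>Riemann sum bounds for the causal error\<close>

context signal_in_noise begin

lemma block_error_sums:
  assumes v: "square_integrable M v" and j: "j < N"
  shows "(\<lambda>k. \<integral>\<omega>. (inner (v \<omega>) (block_basis N j k))\<^sup>2 \<partial>M) sums (\<integral>\<omega>. (norm (incr N j (v \<omega>)))\<^sup>2 \<partial>M)"
proof -
  interpret D: orthogonal_projection "incr N j" using j by (rule incr_projection)
  let ?e = "block_basis N j"
  have [measurable]: "v \<in> borel_measurable M" using v by (rule square_integrable_measurable)
  have Dm: "incr N j \<in> borel_measurable borel"
    unfolding incr_def[abs_def] by (intro borel_measurable_continuous_onI continuous_intros)
  have [measurable]: "(\<lambda>\<omega>. incr N j (v \<omega>)) \<in> borel_measurable M"
    by (rule measurable_compose[OF _ Dm]) measurable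
  have part: "(\<Sum>k<n. (inner (v \<omega>) (?e k))\<^sup>2) \<le> (norm (v \<omega>))\<^sup>2" for n \<omega>
    using bessel_inequality[of ?e "{..<n}"] block_basis(1)[OF j] orthonormal_or_zero_subset by blast
  have nv: "integrable M (\<lambda>\<omega>. (norm (v \<omega>))\<^sup>2)" using v by (simp add: square_integrable_def)
  have int: "integrable M (\<lambda>\<omega>. (inner (v \<omega>) (?e k))\<^sup>2)" for k
  proof (rule Bochner_Integration.integrable_bound[OF nv])
    show "AE \<omega> in M. norm ((inner (v \<omega>) (?e k))\<^sup>2) \<le> norm ((norm (v \<omega>))\<^sup>2)"
    proof (rule AE_I2)
      fix \<omega>
      have "(inner (v \<omega>) (?e k))\<^sup>2 \<le> (\<Sum>k<Suc k. (inner (v \<omega>) (?e k))\<^sup>2)"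
        by (rule member_le_sum) auto
      then show "norm ((inner (v \<omega>) (?e k))\<^sup>2) \<le> norm ((norm (v \<omega>))\<^sup>2)"
        using part[of \<omega> "Suc k"] by simp
    qed
  qed measurable
  have "(\<lambda>n. \<integral>\<omega>. (\<Sum>k<n. (inner (v \<omega>) (?e k))\<^sup>2) \<partial>M) \<longlonglongrightarrow> (\<integral>\<omega>. (norm (incr N j (v \<omega>)))\<^sup>2 \<partial>M)"
  proof (rule integral_dominated_convergence[OF _ _ nv])
    show "AE \<omega> in M. (\<lambda>n. \<Sum>k<n. (inner (v \<omega>) (?e k))\<^sup>2) \<longlonglongrightarrow> (norm (incr N j (v \<omega>)))\<^sup>2"
      using block_parseval[OF j] by (simp add: sums_def)
    show "AE \<omega> in M. norm (\<Sum>k<n. (inner (v \<omega>) (?e k))\<^sup>2) \<le> (norm (v \<omega>))\<^sup>2" for n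
      using part by (intro AE_I2) (simp add: sum_nonneg)
  qed measurable
  then show ?thesis using int by (simp add: sums_def)
qed

lemma mse_eq_sum_blocks:
  assumes v: "square_integrable M v" and N: "0 < N"
  shows "(\<integral>\<omega>. (norm (v \<omega>))\<^sup>2 \<partial>M) = (\<Sum>j<N. \<integral>\<omega>. (norm (incr N j (v \<omega>)))\<^sup>2 \<partial>M)"
proof -
  have [measurable]: "v \<in> borel_measurable M" using v by (rule square_integrable_measurable)
  have "integrable M (\<lambda>\<omega>. (norm (incr N j (v \<omega>)))\<^sup>2)" if j: "j < N" for j
  proof (rule Bochner_Integration.integrable_bound)
    show "integrable M (\<lambda>\<omega>. (norm (v \<omega>))\<^sup>2)" using v by (simp add: square_integrable_def)
    have "incr N j \<in> borel_measurable borel"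
      unfolding incr_def[abs_def] by (intro borel_measurable_continuous_onI continuous_intros)
    then have "(\<lambda>\<omega>. incr N j (v \<omega>)) \<in> borel_measurable M"
      by (rule measurable_compose[rotated]) measurable
    then show "(\<lambda>\<omega>. (norm (incr N j (v \<omega>)))\<^sup>2) \<in> borel_measurable M" by measurable
    show "AE \<omega> in M. norm ((norm (incr N j (v \<omega>)))\<^sup>2) \<le> norm ((norm (v \<omega>))\<^sup>2)"
      using orthogonal_projection.norm_le[OF incr_projection[OF j]]
      by (intro AE_I2) (simp add: power_mono)
  qed
  then show ?thesis
    by (subst norm_sq_eq_sum_incr[OF N]) (rule Bochner_Integration.integral_sum, auto)
qed

text \<open>Used with an estimator \<open>v\<close> whose coordinates in block \<open>j\<close> depend on the observations up
  to the right end of the block; the hypothesis says that such a coordinate errs at least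
  as much as the best linear estimate.\<close>

lemma mse_lower_bound:
  assumes v: "square_integrable M v"
    and coord: "\<And>N j k n. j < N \<Longrightarrow>
      inner (error_cov \<phi> (p (node N (Suc j))) n (block_basis N j k)) (block_basis N j k)
        \<le> \<gamma> * (\<integral>\<omega>. (inner (x \<omega>) (block_basis N j k) - inner (v \<omega>) (block_basis N j k))\<^sup>2 \<partial>M)"
  shows "log_det \<le> \<gamma> * (\<integral>\<omega>. (norm (x \<omega> - v \<omega>))\<^sup>2 \<partial>M)"
proof -
  let ?E = "\<gamma> * (\<integral>\<omega>. (norm (x \<omega> - v \<omega>))\<^sup>2 \<partial>M)"
  have d: "square_integrable M (\<lambda>\<omega>. x \<omega> - v \<omega>)" by (rule square_integrable_diff[OF x_sq v])
  \<comment> \<open>\<open>a\<close> bounds the trace of the covariance in each block; it is sent to \<open>0\<close> at the end.\<close>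
  have bound: "(1 - a) * log_det \<le> ?E" if a: "0 < a" "a < 1" for a
  proof -
    obtain N where N: "0 < N" "\<And>j n. j < N \<Longrightarrow> (\<Sum>i<n. (norm (incr N j (\<phi> i)))\<^sup>2) \<le> a"
      using fine_partition[OF a(1)] by metis
    have "(1 - a) * (\<Sum>i<n. ln (1 + (norm (\<phi> i))\<^sup>2)) \<le> ?E" for n
    proof -
      have "(1 - a) * (\<Sum>i<n. ln (1 + (norm (\<phi> i))\<^sup>2)) \<le> (1 - a) * (\<Sum>j<N. block_trace N j (node N j) n)"
        using a by (intro mult_left_mono log_det_bounds N) auto
      also have "\<dots> \<le> (\<Sum>j<N. block_trace N j (node N (Suc j)) n)"
        unfolding sum_distrib_left by (intro sum_mono block_trace_refinement N) auto
      also have "\<dots> \<le> (\<Sum>j<N. \<gamma> * (\<integral>\<omega>. (norm (incr N j (x \<omega> - v \<omega>)))\<^sup>2 \<partial>M))"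
      proof (rule sum_mono)
        fix j assume "j \<in> {..<N}"
        then have j: "j < N" by simp
        show "block_trace N j (node N (Suc j)) n \<le> \<gamma> * (\<integral>\<omega>. (norm (incr N j (x \<omega> - v \<omega>)))\<^sup>2 \<partial>M)"
          using coord[OF j] by (intro sums_le[OF _ block_trace_sums[OF j] sums_mult[OF block_error_sums[OF d j]]])
            (simp add: inner_diff_left)
      qed
      also have "\<dots> = ?E" by (simp add: sum_distrib_left[symmetric] mse_eq_sum_blocks[OF d N(1)])
      finally show ?thesis .
    qed
    moreover have "(\<lambda>n. (1 - a) * (\<Sum>i<n. ln (1 + (norm (\<phi> i))\<^sup>2))) \<longlonglongrightarrow> (1 - a) * log_det"
      unfolding log_det_def by (intro tendsto_intros summable_LIMSEQ summable_ln)
    ultimately show ?thesis by (intro LIMSEQ_le_const2) auto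
  qed
  have "(\<lambda>n. (1 - inverse (real (Suc n))) * log_det) \<longlonglongrightarrow> (1 - 0) * log_det"
    by (intro tendsto_intros LIMSEQ_inverse_real_of_nat)
  moreover have "(1 - inverse (real (Suc n))) * log_det \<le> ?E" if "1 \<le> n" for n
    using that by (intro bound) (auto simp: divide_simps)
  ultimately show ?thesis by (intro LIMSEQ_le_const2[of _ "(1 - 0) * log_det", simplified]) auto
qed

text \<open>The coordinates in block \<open>j\<close> are estimated by \<open>l j k\<close>, later required to use the
  observations up to the left end of the block only. Finitely many coordinates suffice up
  to a small error.\<close>

definition delayed_estimator :: "nat \<Rightarrow> nat \<Rightarrow> (nat \<Rightarrow> nat \<Rightarrow> 'w \<Rightarrow>\<^sub>L real) \<Rightarrow> 'a \<Rightarrow> 'h" where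
  "delayed_estimator N m l \<omega> = (\<Sum>j<N. \<Sum>k<m. blinfun_apply (l j k) (y \<omega>) *\<^sub>R block_basis N j k)"

lemma delayed_estimator_square_integrable: "square_integrable M (delayed_estimator N m l)"
proof -
  have 1: "square_integrable M (\<lambda>\<omega>. f \<omega> *\<^sub>R h)" if f: "square_integrable M f" for f :: "'a \<Rightarrow> real" and h :: 'h
    using f by (auto simp: square_integrable_def power_mult_distrib)
  have sum: "square_integrable M (\<lambda>\<omega>. \<Sum>i\<in>I. g i \<omega>)" if "finite I" "\<And>i. i \<in> I \<Longrightarrow> square_integrable M (g i)"
    for I :: "nat set" and g :: "nat \<Rightarrow> 'a \<Rightarrow> 'h"
    using that
  proof (induction I rule: finite_induct)
    case empty
    then show ?case by (simp add: square_integrable_def)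
  next
    case (insert i I)
    then show ?case using square_integrable_add[of M "g i" "\<lambda>\<omega>. \<Sum>i\<in>I. g i \<omega>"] by simp
  qed
  show ?thesis
    unfolding delayed_estimator_def[abs_def] by (intro sum 1 y_functional_square_integrable finite_lessThan)
qed

text \<open>A block that begins before \<open>t\<close> uses observations from before \<open>t\<close>; a block that begins
  after \<open>t\<close> is orthogonal to the range of \<open>\<pi>\<^sub>t\<close>.\<close>

lemma delayed_estimator_causal:
  assumes l: "\<And>j k. j < N \<Longrightarrow> k < m \<Longrightarrow> p (node N j) (dual_embed \<iota> (l j k)) = dual_embed \<iota> (l j k)"
    and t: "t \<in> {0..1}"
  shows "(\<lambda>\<omega>. inner (delayed_estimator N m l \<omega>) (p t h)) \<in> obs_space t"
proof -
  have summand: "(\<lambda>\<omega>. inner (block_basis N j k) (p t h) * blinfun_apply (l j k) (y \<omega>)) \<in> obs_space t"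
    if j: "j < N" and k: "k < m" for j k
  proof (cases "node N j \<le> t")
    case True
    have "(\<lambda>\<omega>. blinfun_apply (l j k) (y \<omega>)) \<in> obs_space (node N j)"
      using l[OF j k] obs_space_iff[OF node_bounds(4)[OF j]] by blast
    then have "(\<lambda>\<omega>. blinfun_apply (l j k) (y \<omega>)) \<in> obs_space t"
      using obs_space_mono[OF node_bounds(1)[OF j] True] t by auto
    then show ?thesis
      using obs_space_combination[OF t _ obs_space_zero[OF t], of _ _ 0] by fastforce
  next
    case False
    have "p t (block_basis N j k) = 0"
      using p_eq_zero_mono[of t "node N j"] block_basis_p(1)[OF j] t False node_bounds[OF j] by auto
    then have "inner (block_basis N j k) (p t h) = 0"
      using orthogonal_projection.sym[OF projection[OF t]] by (metis inner_zero_left)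
    then show ?thesis using obs_space_zero[OF t] by simp
  qed
  have "(\<lambda>\<omega>. inner (delayed_estimator N m l \<omega>) (p t h))
      = (\<lambda>\<omega>. \<Sum>j<N. 1 * (\<Sum>k<m. 1 * (inner (block_basis N j k) (p t h) * blinfun_apply (l j k) (y \<omega>))))"
    by (simp add: delayed_estimator_def inner_sum_left mult.commute)
  also have "\<dots> \<in> obs_space t"
    by (rule obs_space_sum[OF t], simp, rule obs_space_sum[OF t]) (auto intro: summand)
  finally show ?thesis .
qed

lemma obs_space_subset_closed_span: "obs_space t \<subseteq> L2_closed_span M (obs_space t)"
proof
  fix \<eta> assume \<eta>: "\<eta> \<in> obs_space t"
  show "\<eta> \<in> L2_closed_span M (obs_space t)"
    unfolding L2_closed_span_def
  proof (intro CollectI conjI allI impI)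
    show sq: "square_integrable M \<eta>" using \<eta> by (rule obs_space_square_integrable)
    fix \<epsilon> :: real assume "\<epsilon> > 0"
    then show "\<exists>F c. finite F \<and> F \<subseteq> obs_space t \<and> square_integrable M (\<lambda>\<omega>. \<Sum>g\<in>F. c g * g \<omega>) \<and>
        (\<integral>\<omega>. (\<eta> \<omega> - (\<Sum>g\<in>F. c g * g \<omega>))\<^sup>2 \<partial>M) < \<epsilon>"
      using \<eta> sq by (intro exI[of _ "{\<eta>}"] exI[of _ "\<lambda>_. 1"]) simp
  qed
qed

lemma obs_filtration_eq:
  "obs_filtration M \<iota> p y t =
     sigma (space M) ({\<eta> -` B \<inter> space M | \<eta> B. \<eta> \<in> obs_space t \<and> B \<in> sets borel} \<union> null_sets M)"
proof -
  have "{(\<lambda>\<omega>. blinfun_apply (dual_proj \<iota> (p t) l) (y \<omega>)) -` B \<inter> space M | l B. B \<in> sets borel}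
      = {\<eta> -` B \<inter> space M | \<eta> B. \<eta> \<in> obs_space t \<and> B \<in> sets borel}"
    unfolding obs_space_def by blast
  then show ?thesis unfolding obs_filtration_def by simp
qed

lemma obs_filtration_generators:
  "{\<eta> -` B \<inter> space M | \<eta> B. \<eta> \<in> obs_space t \<and> B \<in> sets borel} \<union> null_sets M \<subseteq> sets M"
  using obs_space_square_integrable[of _ t]
  by (auto dest!: square_integrable_measurable intro: measurable_sets)

lemma space_obs_filtration: "space (obs_filtration M \<iota> p y t) = space M"
  and sets_obs_filtration: "sets (obs_filtration M \<iota> p y t) = sigma_sets (space M)
     ({\<eta> -` B \<inter> space M | \<eta> B. \<eta> \<in> obs_space t \<and> B \<in> sets borel} \<union> null_sets M)"
proof -
  have "{\<eta> -` B \<inter> space M | \<eta> B. \<eta> \<in> obs_space t \<and> B \<in> sets borel} \<union> null_sets M \<subseteq> Pow (space M)"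
    using obs_filtration_generators sets.sets_into_space by blast
  then show "space (obs_filtration M \<iota> p y t) = space M"
    "sets (obs_filtration M \<iota> p y t) = sigma_sets (space M)
     ({\<eta> -` B \<inter> space M | \<eta> B. \<eta> \<in> obs_space t \<and> B \<in> sets borel} \<union> null_sets M)"
    unfolding obs_filtration_eq by simp_all
qed

lemma obs_space_subset_measurable: "obs_space t \<subseteq> borel_measurable (obs_filtration M \<iota> p y t)"
proof
  fix \<eta> assume \<eta>: "\<eta> \<in> obs_space t"
  show "\<eta> \<in> borel_measurable (obs_filtration M \<iota> p y t)"
  proof (rule measurableI)
    fix B :: "real set" assume "B \<in> sets borel"
    then show "\<eta> -` B \<inter> space (obs_filtration M \<iota> p y t) \<in> sets (obs_filtration M \<iota> p y t)"
      unfolding space_obs_filtration sets_obs_filtration using \<eta> by (intro sigma_sets.Basic) blast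
  qed simp
qed

lemma delayed_estimator_in_spaces:
  assumes "\<And>j k. j < N \<Longrightarrow> k < m \<Longrightarrow> p (node N j) (dual_embed \<iota> (l j k)) = dual_embed \<iota> (l j k)"
  shows "delayed_estimator N m l \<in> adapted_space M \<iota> p y" "delayed_estimator N m l \<in> linear_causal_space M \<iota> p y"
proof -
  have "(\<lambda>\<omega>. inner (delayed_estimator N m l \<omega>) (p t h)) \<in> obs_space t" if "t \<in> {0..1}" for t h
    using assms that by (rule delayed_estimator_causal)
  then have "(\<lambda>\<omega>. inner (delayed_estimator N m l \<omega>) (p t h)) \<in> borel_measurable (obs_filtration M \<iota> p y t)"
    "(\<lambda>\<omega>. inner (delayed_estimator N m l \<omega>) (p t h)) \<in> L2_closed_span M (obs_space t)" if "t \<in> {0..1}" for t h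
    using that obs_space_subset_measurable[of t] obs_space_subset_closed_span[of t] by blast+
  then show "delayed_estimator N m l \<in> adapted_space M \<iota> p y" "delayed_estimator N m l \<in> linear_causal_space M \<iota> p y"
    unfolding adapted_space_def linear_causal_space_def obs_space_def[symmetric]
    using delayed_estimator_square_integrable by auto
qed

lemma cost_nonneg: "0 \<le> cost e u"
  using R_nonneg by (simp add: cost_def)

lemma delayed_estimator_coordinate:
  assumes j: "j < N"
  shows "inner (delayed_estimator N m l \<omega>) (block_basis N j k)
    = (if k < m then blinfun_apply (l j k) (y \<omega>) * (norm (block_basis N j k))\<^sup>2 else 0)"
proof -
  have "inner (delayed_estimator N m l \<omega>) (block_basis N j k)
      = (\<Sum>i<N. \<Sum>q<m. blinfun_apply (l i q) (y \<omega>) * inner (block_basis N i q) (block_basis N j k))"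
    by (simp add: delayed_estimator_def inner_sum_left)
  also have "\<dots> = (\<Sum>i<N. if i = j then (\<Sum>q<m. blinfun_apply (l j q) (y \<omega>) * inner (block_basis N j q) (block_basis N j k)) else 0)"
    using block_basis_orthogonal[OF _ j] by (intro sum.cong refl) auto
  also have "\<dots> = (\<Sum>q<m. blinfun_apply (l j q) (y \<omega>) * inner (block_basis N j q) (block_basis N j k))"
    using j by simp
  also have "\<dots> = (\<Sum>q<m. if q = k then blinfun_apply (l j k) (y \<omega>) * (norm (block_basis N j k))\<^sup>2 else 0)"
    using block_basis(1)[OF j] by (intro sum.cong refl) (auto simp: orthonormal_or_zero_def power2_norm_eq_inner)
  finally show ?thesis by simp
qed

text \<open>The inequality, instead of an equation, allows for zero vectors in the basis of the
  block.\<close>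

lemma delayed_estimator_error:
  assumes j: "j < N"
  shows "k < m \<Longrightarrow> (\<integral>\<omega>. (inner (x \<omega> - delayed_estimator N m l \<omega>) (block_basis N j k))\<^sup>2 \<partial>M)
      \<le> cost (block_basis N j k) (dual_embed \<iota> (l j k))"
    "m \<le> k \<Longrightarrow> (\<integral>\<omega>. (inner (x \<omega> - delayed_estimator N m l \<omega>) (block_basis N j k))\<^sup>2 \<partial>M)
      = inner (R (block_basis N j k)) (block_basis N j k)"
proof -
  let ?e = "block_basis N j k"
  show "(\<integral>\<omega>. (inner (x \<omega> - delayed_estimator N m l \<omega>) ?e)\<^sup>2 \<partial>M) \<le> cost ?e (dual_embed \<iota> (l j k))" if "k < m"
  proof (cases "?e = 0")
    case True
    then show ?thesis using cost_nonneg by simp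
  next
    case False
    then have "norm ?e = 1" using block_basis(1)[OF j] by (auto simp: orthonormal_or_zero_def)
    then show ?thesis
      using that coordinate_error[of ?e "l j k"]
      by (simp add: inner_diff_left delayed_estimator_coordinate[OF j])
  qed
  show "(\<integral>\<omega>. (inner (x \<omega> - delayed_estimator N m l \<omega>) ?e)\<^sup>2 \<partial>M) = inner (R ?e) ?e" if "m \<le> k"
    using that corr
    by (simp add: inner_diff_left delayed_estimator_coordinate[OF j] correlation_operator_def power2_eq_square)
qed

lemma log_det_nonneg: "0 \<le> log_det"
  unfolding log_det_def by (rule suminf_nonneg[OF summable_ln]) simp

text \<open>The delayed estimator for a fine partition. It is linear as well as adapted, and so
  serves both parts of the formula.\<close>

lemma mse_upper_bound:
  assumes eps: "0 < \<epsilon>"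
  obtains z where "z \<in> adapted_space M \<iota> p y" "z \<in> linear_causal_space M \<iota> p y"
    "\<gamma> * (\<integral>\<omega>. (norm (x \<omega> - z \<omega>))\<^sup>2 \<partial>M) \<le> log_det + \<epsilon>"
proof -
  \<comment> \<open>One third of \<open>\<epsilon>\<close> each for the mesh of the partition, the coordinates left out, and the
    near-optimal functionals. The value of \<open>a\<close> ensures \<open>log_det \<le> (1 - a) (log_det + d)\<close>.\<close>
  define d where "d = \<epsilon> / 3"
  have d: "0 < d" using eps by (simp add: d_def)
  define a where "a = d / (log_det + 2 * d)"
  have a0: "0 < a" and a1: "1 - a = (log_det + d) / (log_det + 2 * d)"
    using log_det_nonneg d by (auto simp: a_def field_simps)
  have a2: "0 < 1 - a" using log_det_nonneg d by (simp add: a1)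
  obtain N where N: "0 < N" "\<And>j n. j < N \<Longrightarrow> (\<Sum>i<n. (norm (incr N j (\<phi> i)))\<^sup>2) \<le> a"
    using fine_partition[OF a0] by metis
  have f: "(\<Sum>j<N. block_trace N j (node N j) n) \<le> log_det + d" for n
  proof -
    have "(1 - a) * (\<Sum>j<N. block_trace N j (node N j) n) \<le> (\<Sum>j<N. block_trace N j (node N (Suc j)) n)"
      unfolding sum_distrib_left by (intro sum_mono block_trace_refinement N) auto
    also have "\<dots> \<le> log_det"
      using log_det_bounds(2)[OF N(1), of n] partial_log_det_le[of n] by linarith
    also have "log_det \<le> (1 - a) * (log_det + d)"
    proof -
      have "log_det * (log_det + 2 * d) \<le> (log_det + d) * (log_det + d)"
        using zero_le_square[of d] by (simp add: algebra_simps)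
      then show ?thesis unfolding a1 using log_det_nonneg d by (simp add: le_divide_eq)
    qed
    finally show ?thesis using a2 by simp
  qed
  define Rk where "Rk = (\<lambda>j k. inner (R (block_basis N j k)) (block_basis N j k))"
  define S where "S = (\<lambda>j. \<integral>\<omega>. (norm (incr N j (x \<omega>)))\<^sup>2 \<partial>M)"
  have Rs: "Rk j sums S j" if "j < N" for j
    using block_error_sums[OF x_sq that] corr
    by (simp add: Rk_def[abs_def] S_def correlation_operator_def power2_eq_square)
  \<comment> \<open>Beyond the first \<open>m\<close> coordinates of each block the estimate is \<open>0\<close>, at the cost of a
    tail of the trace of \<open>R\<close>.\<close>
  have "(\<lambda>m. \<Sum>j<N. \<gamma> * (S j - (\<Sum>k<m. Rk j k))) \<longlonglongrightarrow> (\<Sum>j<N. \<gamma> * (S j - S j))"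
    using Rs unfolding sums_def by (intro tendsto_intros) auto
  then have "\<forall>\<^sub>F m in sequentially. (\<Sum>j<N. \<gamma> * (S j - (\<Sum>k<m. Rk j k))) < d"
    using d by (intro order_tendstoD) auto
  then obtain m where m: "(\<Sum>j<N. \<gamma> * (S j - (\<Sum>k<m. Rk j k))) < d"
    by (auto simp: eventually_sequentially)
  \<comment> \<open>\<open>N m\<close> coordinates share the error \<open>d\<close>; the added \<open>1\<close> covers \<open>m = 0\<close>.\<close>
  define \<delta> where "\<delta> = d / (real N * real m + 1)"
  have \<delta>: "0 < \<delta>" using d by (simp add: \<delta>_def add_nonneg_pos)
  have "\<forall>\<^sub>F n in sequentially. \<forall>jk\<in>{..<N} \<times> {..<m}. \<exists>l. p (node N (fst jk)) (dual_embed \<iota> l) = dual_embed \<iota> l \<and>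
      \<gamma> * cost (block_basis N (fst jk) (snd jk)) (dual_embed \<iota> l)
        \<le> inner (error_cov \<phi> (p (node N (fst jk))) n (block_basis N (fst jk) (snd jk))) (block_basis N (fst jk) (snd jk)) + \<delta>"
    using node_bounds(4) by (intro eventually_ball_finite ballI cost_near_optimal \<delta>) auto
  then obtain n where n: "\<forall>jk\<in>{..<N} \<times> {..<m}. \<exists>l. p (node N (fst jk)) (dual_embed \<iota> l) = dual_embed \<iota> l \<and>
      \<gamma> * cost (block_basis N (fst jk) (snd jk)) (dual_embed \<iota> l)
        \<le> inner (error_cov \<phi> (p (node N (fst jk))) n (block_basis N (fst jk) (snd jk))) (block_basis N (fst jk) (snd jk)) + \<delta>"
    by (auto simp: eventually_sequentially)
  then obtain L where L: "\<And>jk. jk \<in> {..<N} \<times> {..<m} \<Longrightarrow> p (node N (fst jk)) (dual_embed \<iota> (L jk)) = dual_embed \<iota> (L jk) \<and>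
      \<gamma> * cost (block_basis N (fst jk) (snd jk)) (dual_embed \<iota> (L jk))
        \<le> inner (error_cov \<phi> (p (node N (fst jk))) n (block_basis N (fst jk) (snd jk))) (block_basis N (fst jk) (snd jk)) + \<delta>"
    by metis
  define l where "l = (\<lambda>j k. L (j, k))"
  have l: "p (node N j) (dual_embed \<iota> (l j k)) = dual_embed \<iota> (l j k)"
    "\<gamma> * cost (block_basis N j k) (dual_embed \<iota> (l j k))
      \<le> inner (error_cov \<phi> (p (node N j)) n (block_basis N j k)) (block_basis N j k) + \<delta>"
    if "j < N" "k < m" for j k using L[of "(j, k)"] that by (auto simp: l_def)
  let ?z = "delayed_estimator N m l"
  have dz: "square_integrable M (\<lambda>\<omega>. x \<omega> - ?z \<omega>)"
    by (rule square_integrable_diff[OF x_sq delayed_estimator_square_integrable])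
  have block: "\<gamma> * (\<integral>\<omega>. (norm (incr N j (x \<omega> - ?z \<omega>)))\<^sup>2 \<partial>M)
      \<le> block_trace N j (node N j) n + real m * \<delta> + \<gamma> * (S j - (\<Sum>k<m. Rk j k))" if j: "j < N" for j
  proof -
    define E where "E = (\<lambda>k. \<integral>\<omega>. (inner (x \<omega> - ?z \<omega>) (block_basis N j k))\<^sup>2 \<partial>M)"
    have Es: "E sums (\<integral>\<omega>. (norm (incr N j (x \<omega> - ?z \<omega>)))\<^sup>2 \<partial>M)" (is "E sums ?T")
      unfolding E_def by (rule block_error_sums[OF dz j])
    have "(\<lambda>k. E (k + m)) sums (?T - (\<Sum>k<m. E k))" using Es by (subst sums_iff_shift) simp
    moreover have "(\<lambda>k. Rk j (k + m)) sums (S j - (\<Sum>k<m. Rk j k))" using Rs[OF j] by (subst sums_iff_shift) simp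
    moreover have "E (k + m) = Rk j (k + m)" for k
      unfolding E_def Rk_def by (rule delayed_estimator_error(2)[OF j]) simp
    ultimately have tail: "?T - (\<Sum>k<m. E k) = S j - (\<Sum>k<m. Rk j k)" using sums_unique2 by auto
    have "\<gamma> * (\<Sum>k<m. E k) \<le> (\<Sum>k<m. inner (error_cov \<phi> (p (node N j)) n (block_basis N j k)) (block_basis N j k) + \<delta>)"
      unfolding sum_distrib_left
    proof (rule sum_mono)
      fix k assume "k \<in> {..<m}"
      then have k: "k < m" by simp
      have "\<gamma> * E k \<le> \<gamma> * cost (block_basis N j k) (dual_embed \<iota> (l j k))"
        unfolding E_def using \<gamma> by (intro mult_left_mono delayed_estimator_error(1)[OF j k]) auto
      then show "\<gamma> * E k \<le> inner (error_cov \<phi> (p (node N j)) n (block_basis N j k)) (block_basis N j k) + \<delta>"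
        using l(2)[OF j k] by simp
    qed
    also have "\<dots> = (\<Sum>k<m. inner (error_cov \<phi> (p (node N j)) n (block_basis N j k)) (block_basis N j k)) + real m * \<delta>"
      by (simp add: sum.distrib)
    also have "(\<Sum>k<m. inner (error_cov \<phi> (p (node N j)) n (block_basis N j k)) (block_basis N j k))
        \<le> block_trace N j (node N j) n"
      unfolding sums_unique[OF block_trace_sums[OF j]]
      using orthogonal_projection.error_cov_nonneg[OF projection[OF node_bounds(4)[OF j]]]
      by (intro sum_le_suminf sums_summable[OF block_trace_sums[OF j]]) auto
    finally have "\<gamma> * (\<Sum>k<m. E k) \<le> block_trace N j (node N j) n + real m * \<delta>" by simp
    moreover have "?T = (\<Sum>k<m. E k) + (S j - (\<Sum>k<m. Rk j k))" using tail by simp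
    ultimately show ?thesis by (simp add: distrib_left)
  qed
  have "\<gamma> * (\<integral>\<omega>. (norm (x \<omega> - ?z \<omega>))\<^sup>2 \<partial>M) = (\<Sum>j<N. \<gamma> * (\<integral>\<omega>. (norm (incr N j (x \<omega> - ?z \<omega>)))\<^sup>2 \<partial>M))"
    by (simp add: mse_eq_sum_blocks[OF dz N(1)] sum_distrib_left)
  also have "\<dots> \<le> (\<Sum>j<N. block_trace N j (node N j) n + real m * \<delta> + \<gamma> * (S j - (\<Sum>k<m. Rk j k)))"
    using block by (intro sum_mono) auto
  also have "\<dots> = (\<Sum>j<N. block_trace N j (node N j) n) + real N * (real m * \<delta>) + (\<Sum>j<N. \<gamma> * (S j - (\<Sum>k<m. Rk j k)))"
    by (simp add: sum.distrib)
  also have "\<dots> \<le> (log_det + d) + d + d"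
  proof -
    have "real N * (real m * \<delta>) \<le> d"
    proof -
      define q where "q = real N * real m"
      have "0 \<le> q" by (simp add: q_def)
      then have "q * (d / (q + 1)) \<le> d" using d by (simp add: divide_le_eq)
      then show ?thesis by (simp add: \<delta>_def q_def mult.assoc)
    qed
    then show ?thesis using f[of n] m by linarith
  qed
  also have "\<dots> = log_det + \<epsilon>" by (simp add: d_def)
  finally show thesis using that delayed_estimator_in_spaces[of N m l] l(1) by blast
qed

end

section \<open>Lower bounds for linear and for Gaussian estimation\<close>

lemma (in prob_space) L2_cauchy_schwarz:
  fixes f g :: "'a \<Rightarrow> real"
  assumes f: "square_integrable M f" and g: "square_integrable M g"
  shows "(\<integral>\<omega>. f \<omega> * g \<omega> \<partial>M)\<^sup>2 \<le> (\<integral>\<omega>. (f \<omega>)\<^sup>2 \<partial>M) * (\<integral>\<omega>. (g \<omega>)\<^sup>2 \<partial>M)"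
proof (rule discriminant_bound)
  fix s t :: real
  have "0 \<le> (\<integral>\<omega>. (norm (s *\<^sub>R f \<omega> + (- t) *\<^sub>R g \<omega>))\<^sup>2 \<partial>M)" by simp
  also have "\<dots> = s\<^sup>2 * (\<integral>\<omega>. (f \<omega>)\<^sup>2 \<partial>M) - 2 * s * t * (\<integral>\<omega>. f \<omega> * g \<omega> \<partial>M) + t\<^sup>2 * (\<integral>\<omega>. (g \<omega>)\<^sup>2 \<partial>M)"
    unfolding integral_norm_add_scaleR_sq[OF square_integrable_scaleR[OF f] g]
    by (simp add: power_mult_distrib mult.assoc)
  finally show "0 \<le> s\<^sup>2 * (\<integral>\<omega>. (f \<omega>)\<^sup>2 \<partial>M) - 2 * s * t * (\<integral>\<omega>. f \<omega> * g \<omega> \<partial>M) + t\<^sup>2 * (\<integral>\<omega>. (g \<omega>)\<^sup>2 \<partial>M)" .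
qed

lemma (in prob_space) integral_sq_add_le:
  fixes f g :: "'a \<Rightarrow> real"
  assumes f: "square_integrable M f" and g: "square_integrable M g" and s: "0 < s"
  shows "(\<integral>\<omega>. (f \<omega> + g \<omega>)\<^sup>2 \<partial>M) \<le> (1 + s) * (\<integral>\<omega>. (f \<omega>)\<^sup>2 \<partial>M) + (1 + inverse s) * (\<integral>\<omega>. (g \<omega>)\<^sup>2 \<partial>M)"
proof -
  have "(\<integral>\<omega>. (f \<omega> + g \<omega>)\<^sup>2 \<partial>M) \<le> (\<integral>\<omega>. (1 + s) * (f \<omega>)\<^sup>2 + (1 + inverse s) * (g \<omega>)\<^sup>2 \<partial>M)"
  proof (rule integral_mono)
    fix \<omega>
    have "0 \<le> inverse s * (s * f \<omega> - g \<omega>)\<^sup>2" using s by simp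
    also have "\<dots> = (1 + s) * (f \<omega>)\<^sup>2 + (1 + inverse s) * (g \<omega>)\<^sup>2 - (f \<omega> + g \<omega>)\<^sup>2"
      using s by (simp add: power2_eq_square field_simps)
    finally show "(f \<omega> + g \<omega>)\<^sup>2 \<le> (1 + s) * (f \<omega>)\<^sup>2 + (1 + inverse s) * (g \<omega>)\<^sup>2" by simp
  qed (use f g square_integrable_add[OF f g] in \<open>auto simp: square_integrable_def\<close>)
  also have "\<dots> = (1 + s) * (\<integral>\<omega>. (f \<omega>)\<^sup>2 \<partial>M) + (1 + inverse s) * (\<integral>\<omega>. (g \<omega>)\<^sup>2 \<partial>M)"
    using f g by (simp add: square_integrable_def)
  finally show ?thesis .
qed

text \<open>A lower bound for the distance to a set passes to its closure in mean square.\<close>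

lemma (in prob_space) approximation_error:
  fixes f g :: "'a \<Rightarrow> real"
  assumes f: "square_integrable M f" and g: "square_integrable M g"
    and Ysq: "\<And>\<eta>. \<eta> \<in> \<Y> \<Longrightarrow> square_integrable M \<eta>"
    and lower: "\<And>\<eta>. \<eta> \<in> \<Y> \<Longrightarrow> c \<le> (\<integral>\<omega>. (f \<omega> - \<eta> \<omega>)\<^sup>2 \<partial>M)"
    and approx: "\<And>\<epsilon>. 0 < \<epsilon> \<Longrightarrow> \<exists>\<eta>\<in>\<Y>. (\<integral>\<omega>. (g \<omega> - \<eta> \<omega>)\<^sup>2 \<partial>M) < \<epsilon>"
  shows "c \<le> (\<integral>\<omega>. (f \<omega> - g \<omega>)\<^sup>2 \<partial>M)"
proof -
  let ?I = "\<integral>\<omega>. (f \<omega> - g \<omega>)\<^sup>2 \<partial>M"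
  have "c \<le> ?I + \<epsilon>" if e: "0 < \<epsilon>" for \<epsilon>
  proof -
    define I where "I = ?I"
    have I0: "0 \<le> I" by (simp add: I_def)
    define s where "s = (\<epsilon> / 2) / (I + 1)"
    have s: "0 < s" using e I0 by (simp add: s_def)
    have "s * I \<le> s * (I + 1)" using s by simp
    also have "\<dots> = \<epsilon> / 2"
      unfolding s_def using I0 by (subst times_divide_eq_left, subst nonzero_mult_div_cancel_right) auto
    finally have "s * ?I \<le> \<epsilon> / 2" by (simp add: I_def)
    define u where "u = 1 + inverse s"
    have u: "0 < u" using s by (simp add: u_def add_pos_pos)
    obtain \<eta> where \<eta>: "\<eta> \<in> \<Y>" "(\<integral>\<omega>. (g \<omega> - \<eta> \<omega>)\<^sup>2 \<partial>M) < (\<epsilon> / 2) / u"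
      using approx[of "(\<epsilon> / 2) / u"] e u by auto
    have "c \<le> (\<integral>\<omega>. (f \<omega> - \<eta> \<omega>)\<^sup>2 \<partial>M)" by (rule lower[OF \<eta>(1)])
    also have "\<dots> \<le> (1 + s) * ?I + (1 + inverse s) * (\<integral>\<omega>. (g \<omega> - \<eta> \<omega>)\<^sup>2 \<partial>M)"
      using integral_sq_add_le[OF square_integrable_diff[OF f g] square_integrable_diff[OF g Ysq[OF \<eta>(1)]] s] by simp
    also have "(1 + inverse s) * (\<integral>\<omega>. (g \<omega> - \<eta> \<omega>)\<^sup>2 \<partial>M) \<le> \<epsilon> / 2"
    proof -
      have "u * (\<integral>\<omega>. (g \<omega> - \<eta> \<omega>)\<^sup>2 \<partial>M) \<le> u * ((\<epsilon> / 2) / u)"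
        using \<eta>(2) u by (intro mult_left_mono) auto
      also have "\<dots> = \<epsilon> / 2" using u by (subst times_divide_eq_right, subst nonzero_mult_div_cancel_left) auto
      finally show ?thesis by (simp only: u_def)
    qed
    finally show ?thesis using \<open>s * ?I \<le> \<epsilon> / 2\<close> by (simp add: distrib_right)
  qed
  then show ?thesis by (rule field_le_epsilon)
qed

context signal_in_noise begin

text \<open>\<open>obs_space t\<close> is already a linear space, so closing it suffices.\<close>

lemma L2_closed_span_iff:
  assumes t: "t \<in> {0..1}"
  shows "f \<in> L2_closed_span M (obs_space t) \<longleftrightarrow> square_integrable M f \<and>
    (\<forall>\<epsilon>>0. \<exists>\<eta>\<in>obs_space t. (\<integral>\<omega>. (f \<omega> - \<eta> \<omega>)\<^sup>2 \<partial>M) < \<epsilon>)"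
proof
  assume f: "f \<in> L2_closed_span M (obs_space t)"
  show "square_integrable M f \<and> (\<forall>\<epsilon>>0. \<exists>\<eta>\<in>obs_space t. (\<integral>\<omega>. (f \<omega> - \<eta> \<omega>)\<^sup>2 \<partial>M) < \<epsilon>)"
  proof (intro conjI allI impI)
    show "square_integrable M f" using f by (simp add: L2_closed_span_def)
    fix \<epsilon> :: real assume "0 < \<epsilon>"
    then obtain F c where F: "finite F" "F \<subseteq> obs_space t" "(\<integral>\<omega>. (f \<omega> - (\<Sum>g\<in>F. c g * g \<omega>))\<^sup>2 \<partial>M) < \<epsilon>"
      using f unfolding L2_closed_span_def by blast
    then have "(\<lambda>\<omega>. \<Sum>g\<in>F. c g * g \<omega>) \<in> obs_space t" by (intro obs_space_sum[OF t]) auto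
    then show "\<exists>\<eta>\<in>obs_space t. (\<integral>\<omega>. (f \<omega> - \<eta> \<omega>)\<^sup>2 \<partial>M) < \<epsilon>"
      using F(3) by (intro bexI[of _ "\<lambda>\<omega>. \<Sum>g\<in>F. c g * g \<omega>"])
  qed
next
  assume f: "square_integrable M f \<and> (\<forall>\<epsilon>>0. \<exists>\<eta>\<in>obs_space t. (\<integral>\<omega>. (f \<omega> - \<eta> \<omega>)\<^sup>2 \<partial>M) < \<epsilon>)"
  show "f \<in> L2_closed_span M (obs_space t)"
    unfolding L2_closed_span_def
  proof (intro CollectI conjI allI impI)
    fix \<epsilon> :: real assume "0 < \<epsilon>"
    then obtain \<eta> where "\<eta> \<in> obs_space t" "(\<integral>\<omega>. (f \<omega> - \<eta> \<omega>)\<^sup>2 \<partial>M) < \<epsilon>" using f by blast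
    then show "\<exists>F c. finite F \<and> F \<subseteq> obs_space t \<and> square_integrable M (\<lambda>\<omega>. \<Sum>g\<in>F. c g * g \<omega>) \<and>
        (\<integral>\<omega>. (f \<omega> - (\<Sum>g\<in>F. c g * g \<omega>))\<^sup>2 \<partial>M) < \<epsilon>"
      using obs_space_square_integrable by (intro exI[of _ "{\<eta>}"] exI[of _ "\<lambda>_. 1"]) simp
  qed (use f in blast)
qed

lemma signal_coordinate_square_integrable: "square_integrable M (\<lambda>\<omega>. inner (x \<omega>) h)"
  using signal_square by (simp add: square_integrable_def)

lemma linear_observation_error:
  assumes t: "t \<in> {0..1}" and \<eta>: "\<eta> \<in> obs_space t"
  shows "inner (error_cov \<phi> (p t) n e) e / \<gamma> \<le> (\<integral>\<omega>. (inner (x \<omega>) e - \<eta> \<omega>)\<^sup>2 \<partial>M)"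
proof -
  obtain l where "p t (dual_embed \<iota> l) = dual_embed \<iota> l" "\<eta> = (\<lambda>\<omega>. blinfun_apply l (y \<omega>))"
    using \<eta> by (auto simp: obs_space_iff[OF t])
  then show ?thesis
    using cost_lower_bound[OF t, of "dual_embed \<iota> l" n e] \<gamma> by (simp add: coordinate_error divide_le_eq mult.commute)
qed

lemma closed_span_error:
  assumes t: "t \<in> {0..1}" and g: "g \<in> L2_closed_span M (obs_space t)"
  shows "inner (error_cov \<phi> (p t) n e) e / \<gamma> \<le> (\<integral>\<omega>. (inner (x \<omega>) e - g \<omega>)\<^sup>2 \<partial>M)"
  using g unfolding L2_closed_span_iff[OF t]
  by (intro approximation_error[OF signal_coordinate_square_integrable _ obs_space_square_integrable linear_observation_error[OF t]])
     blast+

lemma dual_embed_approx: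
  assumes "0 < \<epsilon>"
  obtains l where "norm (dual_embed \<iota> l - h) < \<epsilon>"
proof -
  have "h \<in> closure (range (dual_embed \<iota>))" using dual_dense by simp
  then obtain l where "dist (dual_embed \<iota> l) h < \<epsilon>"
    using assms unfolding closure_approachable by blast
  then show thesis using that by (simp add: dist_norm)
qed

text \<open>Causality is tested on \<open>\<pi>\<^sub>t \<Omega>\<^sup>*\<close> only; the basis vectors of a block are limits of such
  vectors.\<close>

lemma linear_causal_coordinate:
  assumes v: "v \<in> linear_causal_space M \<iota> p y" and t: "t \<in> {0..1}" and e: "p t e = e"
  shows "(\<lambda>\<omega>. inner (v \<omega>) e) \<in> L2_closed_span M (obs_space t)"
  unfolding L2_closed_span_iff[OF t]
proof (intro conjI allI impI)
  interpret P: orthogonal_projection "p t" using t by (rule projection)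
  have vsq: "square_integrable M v" using v by (simp add: linear_causal_space_def)
  show sq: "square_integrable M (\<lambda>\<omega>. inner (v \<omega>) e)" by (rule square_integrable_inner[OF vsq])
  fix \<epsilon> :: real assume eps: "0 < \<epsilon>"
  define K where "K = (\<integral>\<omega>. (norm (v \<omega>))\<^sup>2 \<partial>M)"
  have K0: "0 \<le> K" by (simp add: K_def)
  define r where "r = sqrt ((\<epsilon> / 4) / (K + 1))"
  have r: "0 < r" "r\<^sup>2 = (\<epsilon> / 4) / (K + 1)" using eps K0 unfolding r_def by simp_all
  obtain l where l: "norm (dual_embed \<iota> l - e) < r" using dual_embed_approx[OF r(1)] by blast
  let ?d = "p t (dual_embed \<iota> l)"
  have "norm (?d - e) \<le> norm (dual_embed \<iota> l - e)"
    using P.norm_le[of "dual_embed \<iota> l - e"] e by (simp add: P.diff)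
  then have nd: "(norm (e - ?d))\<^sup>2 \<le> r\<^sup>2" using l by (intro power_mono) (simp_all add: norm_minus_commute)
  have "(\<lambda>\<omega>. inner (v \<omega>) ?d) \<in> L2_closed_span M (obs_space t)"
    using v t by (simp add: linear_causal_space_def obs_space_def)
  then obtain \<eta> where \<eta>: "\<eta> \<in> obs_space t" "(\<integral>\<omega>. (inner (v \<omega>) ?d - \<eta> \<omega>)\<^sup>2 \<partial>M) < \<epsilon> / 4"
    unfolding L2_closed_span_iff[OF t] using eps by (meson divide_pos_pos zero_less_numeral)
  have "(\<integral>\<omega>. (inner (v \<omega>) (e - ?d) + (inner (v \<omega>) ?d - \<eta> \<omega>))\<^sup>2 \<partial>M)
      \<le> (1 + 1) * (\<integral>\<omega>. (inner (v \<omega>) (e - ?d))\<^sup>2 \<partial>M) + (1 + inverse 1) * (\<integral>\<omega>. (inner (v \<omega>) ?d - \<eta> \<omega>)\<^sup>2 \<partial>M)"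
    by (intro integral_sq_add_le square_integrable_inner[OF vsq]
        square_integrable_diff obs_space_square_integrable[OF \<eta>(1)]) simp
  also have "(\<integral>\<omega>. (inner (v \<omega>) (e - ?d))\<^sup>2 \<partial>M) \<le> \<epsilon> / 4"
  proof -
    have "(\<integral>\<omega>. (inner (v \<omega>) (e - ?d))\<^sup>2 \<partial>M) \<le> K * (norm (e - ?d))\<^sup>2"
      unfolding K_def by (rule square_integrable_inner[OF vsq])
    also have "\<dots> \<le> (K + 1) * r\<^sup>2" using nd K0 by (intro mult_mono) auto
    also have "\<dots> = \<epsilon> / 4"
      unfolding r(2) using K0 by (subst times_divide_eq_right, subst nonzero_mult_div_cancel_left) auto
    finally show ?thesis .
  qed
  finally have "(\<integral>\<omega>. (inner (v \<omega>) (e - ?d) + (inner (v \<omega>) ?d - \<eta> \<omega>))\<^sup>2 \<partial>M) < \<epsilon>"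
    using \<eta>(2) by simp
  then show "\<exists>\<eta>\<in>obs_space t. (\<integral>\<omega>. (inner (v \<omega>) e - \<eta> \<omega>)\<^sup>2 \<partial>M) < \<epsilon>"
    using \<eta>(1) by (intro bexI[of _ \<eta>]) (simp add: inner_diff_right)
qed

lemma linear_mse_lower_bound:
  assumes v: "v \<in> linear_causal_space M \<iota> p y"
  shows "log_det \<le> \<gamma> * (\<integral>\<omega>. (norm (x \<omega> - v \<omega>))\<^sup>2 \<partial>M)"
proof (rule mse_lower_bound)
  show "square_integrable M v" using v by (simp add: linear_causal_space_def)
  fix N j k n assume j: "j < (N :: nat)"
  note t = node_bounds(5)[OF j]
  show "inner (error_cov \<phi> (p (node N (Suc j))) n (block_basis N j k)) (block_basis N j k)
      \<le> \<gamma> * (\<integral>\<omega>. (inner (x \<omega>) (block_basis N j k) - inner (v \<omega>) (block_basis N j k))\<^sup>2 \<partial>M)"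
    using closed_span_error[OF t linear_causal_coordinate[OF v t block_basis_p(2)[OF j]], of n "block_basis N j k" k] \<gamma>
    by (simp add: divide_le_eq mult.commute)
qed

lemma least_linear_causal_mse_eq: "least_linear_causal_mse M \<iota> p y x = log_det / \<gamma>"
proof -
  let ?V = "linear_causal_space M \<iota> p y" and ?E = "\<lambda>z. \<integral>\<omega>. (norm (x \<omega> - z \<omega>))\<^sup>2 \<partial>M"
  have lower: "log_det / \<gamma> \<le> ?E v" if "v \<in> ?V" for v
    using linear_mse_lower_bound[OF that] \<gamma> by (simp add: divide_le_eq mult.commute)
  have "(INF z\<in>?V. ?E z) \<le> log_det / \<gamma> + \<epsilon>" if e: "0 < \<epsilon>" for \<epsilon>
  proof -
    obtain z where z: "z \<in> ?V" "\<gamma> * ?E z \<le> log_det + \<gamma> * \<epsilon>"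
      by (rule mse_upper_bound[OF mult_pos_pos[OF \<gamma> e]])
    have "(INF z\<in>?V. ?E z) \<le> ?E z" using lower z(1) by (intro cINF_lower bdd_belowI2)
    also have "\<dots> \<le> log_det / \<gamma> + \<epsilon>" using z(2) \<gamma> by (simp add: field_simps)
    finally show ?thesis .
  qed
  then have "(INF z\<in>?V. ?E z) \<le> log_det / \<gamma>" by (rule field_le_epsilon)
  moreover have "log_det / \<gamma> \<le> (INF z\<in>?V. ?E z)"
  proof (rule cINF_greatest)
    show "?V \<noteq> {}" by (rule mse_upper_bound[of 1]) auto
  qed (rule lower)
  ultimately show ?thesis by (simp add: least_linear_causal_mse_def)
qed

lemma obs_filtration_subalgebra: "subalgebra M (obs_filtration M \<iota> p y t)"
  unfolding subalgebra_def space_obs_filtration sets_obs_filtration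
  using obs_filtration_generators by (simp add: sets.sigma_sets_subset)

text \<open>This is where the null sets in the filtration matter: an almost sure limit differs from
  the pointwise limit on a null set.\<close>

lemma obs_filtration_AE_closed:
  fixes f :: "'a \<Rightarrow> real"
  assumes f: "f \<in> borel_measurable M" and g: "\<And>n. g n \<in> borel_measurable (obs_filtration M \<iota> p y t)"
    and lim: "AE \<omega> in M. (\<lambda>n :: nat. g n \<omega>) \<longlonglongrightarrow> f \<omega>"
  shows "f \<in> borel_measurable (obs_filtration M \<iota> p y t)"
proof -
  let ?F = "obs_filtration M \<iota> p y t"
  define h where "h = (\<lambda>\<omega>. lim (\<lambda>n. g n \<omega>))"
  have h: "h \<in> borel_measurable ?F" unfolding h_def using g by (rule borel_measurable_lim_metric)
  have hM: "h \<in> borel_measurable M" by (rule measurable_from_subalg[OF obs_filtration_subalgebra h])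
  have "AE \<omega> in M. f \<omega> = h \<omega>" using lim by eventually_elim (simp add: h_def limI)
  then have null: "{\<omega>\<in>space M. f \<omega> \<noteq> h \<omega>} \<in> null_sets M"
    by (simp only: AE_iff_null_sets)
  have nullF: "S \<in> sets ?F" if "S \<in> null_sets M" for S
    unfolding sets_obs_filtration using that by (intro sigma_sets.Basic) blast
  show ?thesis
  proof (rule measurableI)
    fix B :: "real set" assume B: "B \<in> sets borel"
    let ?N = "{\<omega>\<in>space M. f \<omega> \<noteq> h \<omega>}"
    have "h -` B \<inter> space M \<in> sets ?F" using measurable_sets[OF h B] by (simp add: space_obs_filtration)
    moreover have "(f -` B \<inter> space M) \<inter> ?N \<in> sets ?F"
      using measurable_sets[OF f B] null by (intro nullF null_set_Int1)
    ultimately have "((h -` B \<inter> space M) - ?N) \<union> ((f -` B \<inter> space M) \<inter> ?N) \<in> sets ?F"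
      by (intro sets.Un sets.Diff nullF[OF null])
    also have "((h -` B \<inter> space M) - ?N) \<union> ((f -` B \<inter> space M) \<inter> ?N) = f -` B \<inter> space M" by auto
    finally show "f -` B \<inter> space ?F \<in> sets ?F" unfolding space_obs_filtration .
  qed simp
qed

lemma adapted_combination:
  assumes "u \<in> adapted_space M \<iota> p y" "v \<in> adapted_space M \<iota> p y"
  shows "(\<lambda>\<omega>. a *\<^sub>R u \<omega> + b *\<^sub>R v \<omega>) \<in> adapted_space M \<iota> p y"
  using assms unfolding adapted_space_def
  by (auto simp: inner_add_left intro!: square_integrable_add square_integrable_scaleR
      borel_measurable_add borel_measurable_times borel_measurable_const)

lemma adapted_closed:
  assumes v: "\<And>n :: nat. v n \<in> adapted_space M \<iota> p y" and z: "square_integrable M z"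
    and lim: "AE \<omega> in M. (\<lambda>n. v n \<omega>) \<longlonglongrightarrow> z \<omega>"
  shows "z \<in> adapted_space M \<iota> p y"
  unfolding adapted_space_def
proof (intro CollectI conjI ballI allI)
  fix t l assume t: "t \<in> {0..1::real}"
  have [measurable]: "z \<in> borel_measurable M" using z by (rule square_integrable_measurable)
  show "(\<lambda>\<omega>. inner (z \<omega>) (p t (dual_embed \<iota> l))) \<in> borel_measurable (obs_filtration M \<iota> p y t)"
  proof (rule obs_filtration_AE_closed)
    show "(\<lambda>\<omega>. inner (v n \<omega>) (p t (dual_embed \<iota> l))) \<in> borel_measurable (obs_filtration M \<iota> p y t)" for n
      using v[of n] t by (simp add: adapted_space_def)
    show "AE \<omega> in M. (\<lambda>n. inner (v n \<omega>) (p t (dual_embed \<iota> l))) \<longlonglongrightarrow> inner (z \<omega>) (p t (dual_embed \<iota> l))"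
      using lim by eventually_elim (intro tendsto_intros)
  qed measurable
qed (rule z)

text \<open>The counterpart of \<open>linear_causal_coordinate\<close> for adapted estimators.\<close>

lemma adapted_coordinate:
  assumes v: "v \<in> adapted_space M \<iota> p y" and t: "t \<in> {0..1}" and e: "p t e = e"
  shows "(\<lambda>\<omega>. inner (v \<omega>) e) \<in> borel_measurable (obs_filtration M \<iota> p y t)"
proof -
  have "\<exists>l. norm (dual_embed \<iota> l - e) < inverse (real (Suc n))" for n
    by (rule dual_embed_approx[of "inverse (real (Suc n))" e]) auto
  then obtain l where l: "\<And>n. norm (dual_embed \<iota> (l n) - e) < inverse (real (Suc n))" by metis
  have "(\<lambda>n. dual_embed \<iota> (l n) - e) \<longlonglongrightarrow> 0"
    by (rule Lim_null_comparison[OF _ LIMSEQ_inverse_real_of_nat]) (use l in \<open>auto intro!: always_eventually less_imp_le\<close>)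
  then have "(\<lambda>n. dual_embed \<iota> (l n)) \<longlonglongrightarrow> e" by (simp only: LIM_zero_iff)
  then have "(\<lambda>n. p t (dual_embed \<iota> (l n))) \<longlonglongrightarrow> p t e" by (intro tendsto_intros)
  then have lim: "(\<lambda>n. inner (v \<omega>) (p t (dual_embed \<iota> (l n)))) \<longlonglongrightarrow> inner (v \<omega>) e" for \<omega>
    unfolding e by (intro tendsto_intros)
  show ?thesis
  proof (rule borel_measurable_LIMSEQ_real)
    show "(\<lambda>\<omega>. inner (v \<omega>) (p t (dual_embed \<iota> (l n)))) \<in> borel_measurable (obs_filtration M \<iota> p y t)" for n
      using v t by (simp add: adapted_space_def)
  qed (rule lim)
qed

lemma L2_closed_span_square_integrable: "f \<in> L2_closed_span M S \<Longrightarrow> square_integrable M f"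
  by (simp add: L2_closed_span_def)

lemma L2_closed_span_combination:
  assumes t: "t \<in> {0..1}" and uv: "u \<in> L2_closed_span M (obs_space t)" "v \<in> L2_closed_span M (obs_space t)"
  shows "(\<lambda>\<omega>. a *\<^sub>R u \<omega> + b *\<^sub>R v \<omega>) \<in> L2_closed_span M (obs_space t)"
proof -
  have sq: "square_integrable M (\<lambda>\<omega>. a *\<^sub>R u \<omega> + b *\<^sub>R v \<omega>)"
    by (intro square_integrable_add square_integrable_scaleR L2_closed_span_square_integrable[OF uv(1)] L2_closed_span_square_integrable[OF uv(2)])
  moreover have "\<exists>\<eta>\<in>obs_space t. (\<integral>\<omega>. (a *\<^sub>R u \<omega> + b *\<^sub>R v \<omega> - \<eta> \<omega>)\<^sup>2 \<partial>M) < \<epsilon>" if e: "0 < \<epsilon>" for \<epsilon>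
  proof -
    define s where "s = (\<epsilon> / 4) / (a\<^sup>2 + b\<^sup>2 + 1)"
    have D: "0 < a\<^sup>2 + b\<^sup>2 + 1" by (simp add: add_nonneg_pos)
    have s: "0 < s" using e D by (simp add: s_def)
    obtain \<eta> \<theta> where \<eta>: "\<eta> \<in> obs_space t" "(\<integral>\<omega>. (u \<omega> - \<eta> \<omega>)\<^sup>2 \<partial>M) < s" and \<theta>: "\<theta> \<in> obs_space t" "(\<integral>\<omega>. (v \<omega> - \<theta> \<omega>)\<^sup>2 \<partial>M) < s"
      using uv s unfolding L2_closed_span_iff[OF t] by blast
    have du: "square_integrable M (\<lambda>\<omega>. u \<omega> - \<eta> \<omega>)" "square_integrable M (\<lambda>\<omega>. v \<omega> - \<theta> \<omega>)"
      by (intro square_integrable_diff L2_closed_span_square_integrable[OF uv(1)] L2_closed_span_square_integrable[OF uv(2)] obs_space_square_integrable[OF \<eta>(1)] obs_space_square_integrable[OF \<theta>(1)])+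
    have "(\<integral>\<omega>. (a *\<^sub>R (u \<omega> - \<eta> \<omega>) + b *\<^sub>R (v \<omega> - \<theta> \<omega>))\<^sup>2 \<partial>M)
        \<le> (1 + 1) * (\<integral>\<omega>. (a *\<^sub>R (u \<omega> - \<eta> \<omega>))\<^sup>2 \<partial>M) + (1 + inverse 1) * (\<integral>\<omega>. (b *\<^sub>R (v \<omega> - \<theta> \<omega>))\<^sup>2 \<partial>M)"
      by (intro integral_sq_add_le square_integrable_scaleR du) simp
    also have "\<dots> = 2 * (a\<^sup>2 * (\<integral>\<omega>. (u \<omega> - \<eta> \<omega>)\<^sup>2 \<partial>M)) + 2 * (b\<^sup>2 * (\<integral>\<omega>. (v \<omega> - \<theta> \<omega>)\<^sup>2 \<partial>M))"
      by (simp add: power_mult_distrib)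
    also have "\<dots> \<le> 2 * (a\<^sup>2 * s) + 2 * (b\<^sup>2 * s)"
      using \<eta> \<theta> by (intro add_mono mult_left_mono) auto
    also have "\<dots> \<le> 2 * ((a\<^sup>2 + b\<^sup>2 + 1) * s)" using s by (simp add: algebra_simps)
    also have "(a\<^sup>2 + b\<^sup>2 + 1) * s = \<epsilon> / 4"
      unfolding s_def using D by (subst times_divide_eq_right, subst nonzero_mult_div_cancel_left) auto
    also have "2 * (\<epsilon> / 4) < \<epsilon>" using e by simp
    finally have "(\<integral>\<omega>. (a *\<^sub>R u \<omega> + b *\<^sub>R v \<omega> - (a * \<eta> \<omega> + b * \<theta> \<omega>))\<^sup>2 \<partial>M) < \<epsilon>"
      by (simp add: algebra_simps)
    then show ?thesis by (rule bexI[OF _ obs_space_combination[OF t \<eta>(1) \<theta>(1), of a b]])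
  qed
  ultimately show "(\<lambda>\<omega>. a *\<^sub>R u \<omega> + b *\<^sub>R v \<omega>) \<in> L2_closed_span M (obs_space t)" unfolding L2_closed_span_iff[OF t] by blast
qed

lemma L2_closed_span_closed:
  assumes t: "t \<in> {0..1}" and v: "\<And>n :: nat. v n \<in> L2_closed_span M (obs_space t)"
    and z: "square_integrable M z" and lim: "(\<lambda>n. \<integral>\<omega>. (norm (v n \<omega> - z \<omega>))\<^sup>2 \<partial>M) \<longlonglongrightarrow> 0"
  shows "z \<in> L2_closed_span M (obs_space t)"
proof -
  have "\<exists>\<eta>\<in>obs_space t. (\<integral>\<omega>. (z \<omega> - \<eta> \<omega>)\<^sup>2 \<partial>M) < \<epsilon>" if e: "0 < \<epsilon>" for \<epsilon>
  proof -
    have "\<forall>\<^sub>F n in sequentially. (\<integral>\<omega>. (norm (v n \<omega> - z \<omega>))\<^sup>2 \<partial>M) < \<epsilon> / 4"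
      using e by (intro order_tendstoD(2)[OF lim]) simp
    then obtain n where n: "(\<integral>\<omega>. (v n \<omega> - z \<omega>)\<^sup>2 \<partial>M) < \<epsilon> / 4" by (auto simp: eventually_sequentially)
    obtain \<eta> where \<eta>: "\<eta> \<in> obs_space t" "(\<integral>\<omega>. (v n \<omega> - \<eta> \<omega>)\<^sup>2 \<partial>M) < \<epsilon> / 4"
      using v[of n] e unfolding L2_closed_span_iff[OF t] by (meson divide_pos_pos zero_less_numeral)
    have "(\<integral>\<omega>. ((z \<omega> - v n \<omega>) + (v n \<omega> - \<eta> \<omega>))\<^sup>2 \<partial>M)
        \<le> (1 + 1) * (\<integral>\<omega>. (z \<omega> - v n \<omega>)\<^sup>2 \<partial>M) + (1 + inverse 1) * (\<integral>\<omega>. (v n \<omega> - \<eta> \<omega>)\<^sup>2 \<partial>M)"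
      by (intro integral_sq_add_le square_integrable_diff z L2_closed_span_square_integrable[OF v] obs_space_square_integrable[OF \<eta>(1)]) simp
    also have "\<dots> < \<epsilon>" using n \<eta>(2) by (simp add: power2_commute)
    finally show ?thesis using \<eta>(1) by (intro bexI[of _ \<eta>]) simp
  qed
  then show "z \<in> L2_closed_span M (obs_space t)" unfolding L2_closed_span_iff[OF t] using z by blast
qed

lemma gaussian_characteristic_function:
  assumes gx: "centered_gaussian M x"
  shows "(\<integral>\<omega>. iexp (inner (x \<omega>) h + blinfun_apply l (w \<omega>)) \<partial>M)
    = complex_of_real (exp (- (inner (R h) h + (norm (dual_embed \<iota> l))\<^sup>2) / 2))"
proof -
  have xg: "real_centered_gaussian M (\<lambda>\<omega>. inner (x \<omega>) h)"
  proof -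
    have "real_centered_gaussian M (\<lambda>\<omega>. blinfun_apply (blinfun_inner_left h) (x \<omega>))"
      using gx unfolding centered_gaussian_def by blast
    then show ?thesis by (simp add: inner_commute)
  qed
  have "indep_var borel (\<lambda>\<omega>. iexp (inner (x \<omega>) h)) borel (\<lambda>\<omega>. iexp (blinfun_apply l (w \<omega>)))"
    by (intro independent_rv_compose[OF indep] borel_measurable_continuous_onI continuous_intros)
  then have "(\<integral>\<omega>. iexp (inner (x \<omega>) h) * iexp (blinfun_apply l (w \<omega>)) \<partial>M)
      = (\<integral>\<omega>. iexp (inner (x \<omega>) h) \<partial>M) * (\<integral>\<omega>. iexp (blinfun_apply l (w \<omega>)) \<partial>M)"
    by (rule indep_var_lebesgue_integral) (auto intro!: integrable_iexp)
  also have "\<dots> = complex_of_real (exp (- (inner (R h) h + (norm (dual_embed \<iota> l))\<^sup>2) / 2))"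
    using real_centered_gaussian_moments(3)[OF xg, of 1] real_centered_gaussian_moments(3)[OF noise_gaussian, of 1 l]
      second_moment(1)[of h 0] second_moment(1)[of 0 l] dual_embed_combination[of \<iota> 0 l 0 l]
    by (simp add: exp_add[symmetric] of_real_mult[symmetric] add_divide_distrib del: of_real_mult of_real_exp)
  finally show ?thesis by (simp add: exp_add distrib_left)
qed

text \<open>Let \<open>Z\<close> be the best linear estimate of \<open>X = (x, e)\<close>. For an observation \<open>\<theta>\<close> in place of
  \<open>Z\<close>, the pair of \<open>X - \<theta>\<close> and an observation \<open>\<eta>\<close> is jointly Gaussian, so
  \<open>E (X - \<theta>) cos \<eta> = 0\<close> and \<open>E (X - \<theta>) sin \<eta>\<close> is a multiple of \<open>E (X - \<theta>) \<eta>\<close>. Letting \<open>\<theta>\<close>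
  tend to \<open>Z\<close> makes both vanish. Hence \<open>X - Z\<close> is orthogonal to every square integrable
  function of the observations, and no such \<open>g\<close> is closer to \<open>X\<close> than \<open>Z\<close>.\<close>

lemma gaussian_measurable_error:
  assumes gx: "centered_gaussian M x" and t: "t \<in> {0..1}"
    and g: "g \<in> borel_measurable (obs_filtration M \<iota> p y t)" and gsq: "square_integrable M g"
  shows "inner (error_cov \<phi> (p t) n e) e / \<gamma> \<le> (\<integral>\<omega>. (inner (x \<omega>) e - g \<omega>)\<^sup>2 \<partial>M)"
proof -
  let ?X = "\<lambda>\<omega>. inner (x \<omega>) e" and ?Y = "obs_space t"
  let ?V = "L2_closed_span M ?Y"
  note Xsq = signal_coordinate_square_integrable[of e]
  have Vsq: "square_integrable M v" if "v \<in> ?V" for v using that by (rule L2_closed_span_square_integrable)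
  have "\<exists>Z. is_L2_projection M ?V ?X Z"
  proof (rule L2_projection_exists[OF Xsq Vsq])
    show "?V \<noteq> {}" using obs_space_zero[OF t] obs_space_subset_closed_span[of t] by blast
  next
    show "(\<lambda>\<omega>. a *\<^sub>R u \<omega> + b *\<^sub>R v \<omega>) \<in> ?V" if "u \<in> ?V" "v \<in> ?V" for u v a b
      using that by (rule L2_closed_span_combination[OF t])
  next
    show "z \<in> ?V" if "\<And>n. v n \<in> ?V" "square_integrable M z"
      "(\<lambda>n. \<integral>\<omega>. (norm (v n \<omega> - z \<omega>))\<^sup>2 \<partial>M) \<longlonglongrightarrow> 0" for v :: "nat \<Rightarrow> 'a \<Rightarrow> real" and z
      using that by (rule L2_closed_span_closed[OF t])
  qed
  then obtain Z where ZV: "Z \<in> ?V" and Zorth: "\<And>v. v \<in> ?V \<Longrightarrow> (\<integral>\<omega>. inner (?X \<omega> - Z \<omega>) (v \<omega>) \<partial>M) = 0"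
    unfolding is_L2_projection_def by blast
  note Zsq = Vsq[OF ZV]
  have XZ: "square_integrable M (\<lambda>\<omega>. ?X \<omega> - Z \<omega>)" by (rule square_integrable_diff[OF Xsq Zsq])
  have trig: "(\<integral>\<omega>. (?X \<omega> - Z \<omega>) * cos (\<eta> \<omega>) \<partial>M) = 0 \<and> (\<integral>\<omega>. (?X \<omega> - Z \<omega>) * sin (\<eta> \<omega>) \<partial>M) = 0"
    if \<eta>: "\<eta> \<in> ?Y" for \<eta>
  proof -
    note esq = obs_space_square_integrable[OF \<eta>]
    have [measurable]: "\<eta> \<in> borel_measurable M" using esq by (rule square_integrable_measurable)
    define c where "c = exp (- (\<integral>\<omega>. (\<eta> \<omega>)\<^sup>2 \<partial>M) / 2)"
    have bsq: "square_integrable M (\<lambda>\<omega>. cos (\<eta> \<omega>))" "square_integrable M (\<lambda>\<omega>. sin (\<eta> \<omega>))"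
      unfolding square_integrable_def
      by (auto intro!: integrable_const_bound[of _ 1] simp: abs_square_le_1)
    have gauss: "(\<integral>\<omega>. (?X \<omega> - \<theta> \<omega>) * cos (\<eta> \<omega>) \<partial>M) = 0"
      "(\<integral>\<omega>. (?X \<omega> - \<theta> \<omega>) * sin (\<eta> \<omega>) \<partial>M) = (\<integral>\<omega>. (?X \<omega> - \<theta> \<omega>) * \<eta> \<omega> \<partial>M) * c" if \<theta>: "\<theta> \<in> ?Y" for \<theta>
    proof -
      obtain l1 l2 where l: "\<theta> = (\<lambda>\<omega>. blinfun_apply l1 (y \<omega>))" "\<eta> = (\<lambda>\<omega>. blinfun_apply l2 (y \<omega>))"
        using \<theta> \<eta> by (auto simp: obs_space_iff[OF t])
      have dsq: "square_integrable M (\<lambda>\<omega>. ?X \<omega> - \<theta> \<omega>)"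
        by (rule square_integrable_diff[OF Xsq obs_space_square_integrable[OF \<theta>]])
      have ch: "(\<integral>\<omega>. iexp (a * (?X \<omega> - \<theta> \<omega>) + \<eta> \<omega>) \<partial>M)
          = complex_of_real (exp (- (\<integral>\<omega>. (a * (?X \<omega> - \<theta> \<omega>) + \<eta> \<omega>)\<^sup>2 \<partial>M) / 2))" for a
      proof -
        define h where "h = a *\<^sub>R (e - sqrt \<gamma> *\<^sub>R dual_embed \<iota> l1) + sqrt \<gamma> *\<^sub>R dual_embed \<iota> l2"
        define l where "l = l2 - a *\<^sub>R l1"
        have eq: "a * (?X \<omega> - \<theta> \<omega>) + \<eta> \<omega> = inner (x \<omega>) h + blinfun_apply l (w \<omega>)" for \<omega>
          by (simp add: \<open>\<theta> = _\<close> \<open>\<eta> = _\<close> h_def l_def functional_y inner_add_right inner_diff_right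
              blinfun.diff_left blinfun.scaleR_left algebra_simps)
        show ?thesis unfolding eq second_moment by (rule gaussian_characteristic_function[OF gx])
      qed
      show "(\<integral>\<omega>. (?X \<omega> - \<theta> \<omega>) * cos (\<eta> \<omega>) \<partial>M) = 0"
        "(\<integral>\<omega>. (?X \<omega> - \<theta> \<omega>) * sin (\<eta> \<omega>) \<partial>M) = (\<integral>\<omega>. (?X \<omega> - \<theta> \<omega>) * \<eta> \<omega> \<partial>M) * c"
        unfolding c_def using dsq esq ch
        by (intro jointly_gaussian_covariance; auto simp: square_integrable_def)+
    qed
    have prodI: "integrable M (\<lambda>\<omega>. f \<omega> * h \<omega>)" if "square_integrable M f" "square_integrable M h" for f h :: "'a \<Rightarrow> real"
      using integrable_inner_square_integrable[OF that] by simp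
    \<comment> \<open>Replacing \<open>\<theta>\<close> by \<open>Z\<close> costs a multiple of the distance between them; for the sine the
      linear term is kept with the factor \<open>c\<close>, where \<open>E (X - Z) \<eta> = 0\<close> can be used.\<close>
    have small: "(\<integral>\<omega>. (?X \<omega> - Z \<omega>) * cos (\<eta> \<omega>) \<partial>M)\<^sup>2 \<le> \<epsilon> * (\<integral>\<omega>. (cos (\<eta> \<omega>))\<^sup>2 \<partial>M)
        \<and> (\<integral>\<omega>. (?X \<omega> - Z \<omega>) * sin (\<eta> \<omega>) \<partial>M)\<^sup>2 \<le> \<epsilon> * (\<integral>\<omega>. (c * \<eta> \<omega> - sin (\<eta> \<omega>))\<^sup>2 \<partial>M)" if e: "0 < \<epsilon>" for \<epsilon>
    proof -
      obtain \<theta> where \<theta>: "\<theta> \<in> ?Y" "(\<integral>\<omega>. (Z \<omega> - \<theta> \<omega>)\<^sup>2 \<partial>M) < \<epsilon>"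
        using ZV e unfolding L2_closed_span_iff[OF t] by blast
      note tsq = obs_space_square_integrable[OF \<theta>(1)]
      have d1: "square_integrable M (\<lambda>\<omega>. \<theta> \<omega> - Z \<omega>)" and d2: "square_integrable M (\<lambda>\<omega>. Z \<omega> - \<theta> \<omega>)"
        and d3: "square_integrable M (\<lambda>\<omega>. ?X \<omega> - \<theta> \<omega>)" by (intro square_integrable_diff Zsq tsq Xsq)+
      have csq: "square_integrable M (\<lambda>\<omega>. c * \<eta> \<omega> - sin (\<eta> \<omega>))"
        using square_integrable_diff[OF square_integrable_scaleR[OF esq, of c] bsq(2)] by simp
      have "(\<integral>\<omega>. (?X \<omega> - Z \<omega>) * cos (\<eta> \<omega>) \<partial>M)
          = (\<integral>\<omega>. (?X \<omega> - \<theta> \<omega>) * cos (\<eta> \<omega>) + (\<theta> \<omega> - Z \<omega>) * cos (\<eta> \<omega>) \<partial>M)" by (simp add: algebra_simps)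
      also have "\<dots> = (\<integral>\<omega>. (\<theta> \<omega> - Z \<omega>) * cos (\<eta> \<omega>) \<partial>M)"
        by (subst Bochner_Integration.integral_add[OF prodI[OF d3 bsq(1)] prodI[OF d1 bsq(1)]]) (simp add: gauss[OF \<theta>(1)])
      finally have c1: "(\<integral>\<omega>. (?X \<omega> - Z \<omega>) * cos (\<eta> \<omega>) \<partial>M)\<^sup>2 \<le> (\<integral>\<omega>. (\<theta> \<omega> - Z \<omega>)\<^sup>2 \<partial>M) * (\<integral>\<omega>. (cos (\<eta> \<omega>))\<^sup>2 \<partial>M)"
        using L2_cauchy_schwarz[OF d1 bsq(1)] by simp
      have orth: "(\<integral>\<omega>. (?X \<omega> - Z \<omega>) * \<eta> \<omega> \<partial>M) = 0"
        using Zorth[of \<eta>] \<eta> obs_space_subset_closed_span[of t] by auto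
      have "(\<integral>\<omega>. (?X \<omega> - \<theta> \<omega>) * \<eta> \<omega> \<partial>M) = (\<integral>\<omega>. (?X \<omega> - Z \<omega>) * \<eta> \<omega> + (Z \<omega> - \<theta> \<omega>) * \<eta> \<omega> \<partial>M)"
        by (simp add: algebra_simps)
      also have "\<dots> = (\<integral>\<omega>. (Z \<omega> - \<theta> \<omega>) * \<eta> \<omega> \<partial>M)"
        by (subst Bochner_Integration.integral_add[OF prodI[OF XZ esq] prodI[OF d2 esq]]) (simp add: orth)
      finally have o2: "(\<integral>\<omega>. (?X \<omega> - \<theta> \<omega>) * \<eta> \<omega> \<partial>M) = (\<integral>\<omega>. (Z \<omega> - \<theta> \<omega>) * \<eta> \<omega> \<partial>M)" .
      have "(\<integral>\<omega>. (?X \<omega> - Z \<omega>) * sin (\<eta> \<omega>) \<partial>M)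
          = (\<integral>\<omega>. (?X \<omega> - \<theta> \<omega>) * sin (\<eta> \<omega>) - (Z \<omega> - \<theta> \<omega>) * sin (\<eta> \<omega>) \<partial>M)" by (simp add: algebra_simps)
      also have "\<dots> = c * (\<integral>\<omega>. (Z \<omega> - \<theta> \<omega>) * \<eta> \<omega> \<partial>M) - (\<integral>\<omega>. (Z \<omega> - \<theta> \<omega>) * sin (\<eta> \<omega>) \<partial>M)"
        by (subst Bochner_Integration.integral_diff[OF prodI[OF d3 bsq(2)] prodI[OF d2 bsq(2)]])
           (simp add: gauss[OF \<theta>(1)] o2)
      also have "\<dots> = (\<integral>\<omega>. c * ((Z \<omega> - \<theta> \<omega>) * \<eta> \<omega>) - (Z \<omega> - \<theta> \<omega>) * sin (\<eta> \<omega>) \<partial>M)"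
        using prodI[OF d2 esq] prodI[OF d2 bsq(2)] by simp
      also have "\<dots> = (\<integral>\<omega>. (Z \<omega> - \<theta> \<omega>) * (c * \<eta> \<omega> - sin (\<eta> \<omega>)) \<partial>M)" by (simp add: algebra_simps)
      finally have s1: "(\<integral>\<omega>. (?X \<omega> - Z \<omega>) * sin (\<eta> \<omega>) \<partial>M)\<^sup>2
          \<le> (\<integral>\<omega>. (Z \<omega> - \<theta> \<omega>)\<^sup>2 \<partial>M) * (\<integral>\<omega>. (c * \<eta> \<omega> - sin (\<eta> \<omega>))\<^sup>2 \<partial>M)"
        using L2_cauchy_schwarz[OF d2 csq] by simp
      have "(\<integral>\<omega>. (\<theta> \<omega> - Z \<omega>)\<^sup>2 \<partial>M) \<le> \<epsilon>" using \<theta>(2) by (simp add: power2_commute)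
      then show ?thesis
        using \<theta>(2) by (intro conjI order_trans[OF c1] order_trans[OF s1] mult_right_mono) auto
    qed
    have zero: "r = 0" if "\<And>\<epsilon>. 0 < \<epsilon> \<Longrightarrow> r\<^sup>2 \<le> \<epsilon> * C" for r C :: real
    proof -
      have "r\<^sup>2 \<le> 0 + \<epsilon>" if "0 < \<epsilon>" for \<epsilon>
      proof -
        have "r\<^sup>2 \<le> \<epsilon> / (\<bar>C\<bar> + 1) * C" using that by (intro \<open>\<And>\<epsilon>. 0 < \<epsilon> \<Longrightarrow> r\<^sup>2 \<le> \<epsilon> * C\<close>) simp
        also have "\<dots> \<le> \<epsilon> / (\<bar>C\<bar> + 1) * (\<bar>C\<bar> + 1)" using that by (intro mult_left_mono) auto
        finally show ?thesis by simp
      qed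
      then have "r\<^sup>2 \<le> 0" by (rule field_le_epsilon)
      then show ?thesis by simp
    qed
    show ?thesis
    proof
      show "(\<integral>\<omega>. (?X \<omega> - Z \<omega>) * cos (\<eta> \<omega>) \<partial>M) = 0" by (rule zero[OF conjunct1[OF small]])
      show "(\<integral>\<omega>. (?X \<omega> - Z \<omega>) * sin (\<eta> \<omega>) \<partial>M) = 0" by (rule zero[OF conjunct2[OF small]])
    qed
  qed
  have "(\<integral>\<omega>. g \<omega> * (?X \<omega> - Z \<omega>) \<partial>M) = 0"
  proof (rule orthogonal_of_generated[OF _ _ _ _ _ obs_filtration_eq g])
    show "integrable M (\<lambda>\<omega>. ?X \<omega> - Z \<omega>)"
    proof (rule integrable_of_square[OF square_integrable_measurable[OF XZ]])
      show "integrable M (\<lambda>\<omega>. (?X \<omega> - Z \<omega>)\<^sup>2)"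
        using XZ by (simp only: square_integrable_def real_norm_def power2_abs)
    qed
    show "\<eta> \<in> borel_measurable M" if "\<eta> \<in> ?Y" for \<eta>
      using obs_space_square_integrable[OF that] by (rule square_integrable_measurable)
    show "(\<lambda>\<omega>. \<Sum>k\<in>K. s k * fst k \<omega>) \<in> ?Y" if "finite K" "K \<subseteq> ?Y \<times> UNIV" for K :: "(('a \<Rightarrow> real) \<times> real set) set" and s
      using that by (intro obs_space_sum[OF t]) auto
    show "integrable M (\<lambda>\<omega>. g \<omega> * (?X \<omega> - Z \<omega>))"
      using integrable_inner_square_integrable[OF gsq XZ] by simp
  qed (use trig in auto)
  then have "(\<integral>\<omega>. (?X \<omega> - Z \<omega>) * g \<omega> \<partial>M) = 0" by (simp add: mult.commute)
  moreover have "(\<integral>\<omega>. (?X \<omega> - Z \<omega>) * Z \<omega> \<partial>M) = 0" using Zorth[OF ZV] by simp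
  ultimately have cross: "(\<integral>\<omega>. (?X \<omega> - Z \<omega>) * (Z \<omega> - g \<omega>) \<partial>M) = 0"
    using integrable_inner_square_integrable[OF XZ Zsq] integrable_inner_square_integrable[OF XZ gsq]
    by (simp add: right_diff_distrib)
  have "(\<integral>\<omega>. (norm ((?X \<omega> - Z \<omega>) + 1 *\<^sub>R (Z \<omega> - g \<omega>)))\<^sup>2 \<partial>M)
      = (\<integral>\<omega>. (norm (?X \<omega> - Z \<omega>))\<^sup>2 \<partial>M) + 2 * 1 * (\<integral>\<omega>. inner (?X \<omega> - Z \<omega>) (Z \<omega> - g \<omega>) \<partial>M)
        + 1\<^sup>2 * (\<integral>\<omega>. (norm (Z \<omega> - g \<omega>))\<^sup>2 \<partial>M)"
    by (rule integral_norm_add_scaleR_sq[OF XZ square_integrable_diff[OF Zsq gsq]])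
  then have "(\<integral>\<omega>. (?X \<omega> - g \<omega>)\<^sup>2 \<partial>M) = (\<integral>\<omega>. (?X \<omega> - Z \<omega>)\<^sup>2 \<partial>M) + (\<integral>\<omega>. (Z \<omega> - g \<omega>)\<^sup>2 \<partial>M)"
    using cross by simp
  moreover have "0 \<le> (\<integral>\<omega>. (Z \<omega> - g \<omega>)\<^sup>2 \<partial>M)" by simp
  ultimately show ?thesis using closed_span_error[OF t ZV, of n e] by linarith
qed

end

section \<open>The causal error formula\<close>

context signal_in_noise begin

lemma gaussian_mse_lower_bound:
  assumes gx: "centered_gaussian M x" and v: "v \<in> adapted_space M \<iota> p y"
  shows "log_det \<le> \<gamma> * (\<integral>\<omega>. (norm (x \<omega> - v \<omega>))\<^sup>2 \<partial>M)"
proof (rule mse_lower_bound)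
  show vsq: "square_integrable M v" using v by (simp add: adapted_space_def)
  fix N j k n assume j: "j < (N :: nat)"
  note t = node_bounds(5)[OF j]
  show "inner (error_cov \<phi> (p (node N (Suc j))) n (block_basis N j k)) (block_basis N j k)
      \<le> \<gamma> * (\<integral>\<omega>. (inner (x \<omega>) (block_basis N j k) - inner (v \<omega>) (block_basis N j k))\<^sup>2 \<partial>M)"
    using gaussian_measurable_error[OF gx t adapted_coordinate[OF v t block_basis_p(2)[OF j]]
        square_integrable_inner(1)[OF vsq], of n "block_basis N j k"] \<gamma>
    by (simp add: divide_le_eq mult.commute)
qed

lemma causal_estimator_exists: "\<exists>xh. is_causal_estimator M \<iota> p y x xh"
  unfolding is_causal_estimator_def
proof (rule L2_projection_exists[OF x_sq])
  show "adapted_space M \<iota> p y \<noteq> {}"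
    by (rule mse_upper_bound[of 1]) auto
  show "square_integrable M v" if "v \<in> adapted_space M \<iota> p y" for v
    using that by (simp add: adapted_space_def)
qed (auto intro: adapted_combination adapted_closed)

text \<open>The upper bound goes through the near-optimal delayed estimators, which the projection
  cannot do worse than.\<close>

lemma causal_estimator_error:
  assumes gx: "centered_gaussian M x" and xh: "is_causal_estimator M \<iota> p y x xh"
  shows "(\<integral>\<omega>. (norm (x \<omega> - xh \<omega>))\<^sup>2 \<partial>M) = log_det / \<gamma>"
proof (rule antisym)
  let ?E = "\<lambda>z. \<integral>\<omega>. (norm (x \<omega> - z \<omega>))\<^sup>2 \<partial>M"
  have xhV: "xh \<in> adapted_space M \<iota> p y" using xh by (simp add: is_causal_estimator_def is_L2_projection_def)
  show "log_det / \<gamma> \<le> ?E xh"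
    using gaussian_mse_lower_bound[OF gx xhV] \<gamma> by (simp add: divide_le_eq mult.commute)
  show "?E xh \<le> log_det / \<gamma>"
  proof (rule field_le_epsilon)
    fix \<epsilon> :: real assume e: "0 < \<epsilon>"
    obtain z where z: "z \<in> adapted_space M \<iota> p y" "\<gamma> * ?E z \<le> log_det + \<gamma> * \<epsilon>"
      by (rule mse_upper_bound[OF mult_pos_pos[OF \<gamma> e]])
    have "?E xh \<le> ?E z"
    proof (rule L2_projection_minimises[OF x_sq])
      show "is_L2_projection M (adapted_space M \<iota> p y) x xh" using xh by (simp add: is_causal_estimator_def)
      show "square_integrable M v" if "v \<in> adapted_space M \<iota> p y" for v
        using that by (simp add: adapted_space_def)
    qed (auto intro: adapted_combination z)
    also have "\<dots> \<le> log_det / \<gamma> + \<epsilon>" using z(2) \<gamma> by (simp add: field_simps)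
    finally show "?E xh \<le> log_det / \<gamma> + \<epsilon>" .
  qed
qed

end

text \<open>The weak form of Fernique's theorem. The second moments of the coordinates are summable
  because the squares of the coordinates have a pointwise finite sum \<open>|x|\<^sup>2\<close>.\<close>

lemma (in prob_space) gaussian_square_integrable:
  fixes x :: "'a \<Rightarrow> 'h::{real_inner, banach, second_countable_topology}"
  assumes gx: "centered_gaussian M x"
  shows "square_integrable M x"
proof -
  obtain e :: "nat \<Rightarrow> 'h" where e: "orthonormal_or_zero e UNIV" "range (\<lambda>h::'h. h) \<subseteq> closure (span (range e))"
    using orthonormal_system_of_range[OF bounded_linear_ident] by metis
  have on: "orthonormal_or_zero e {..<n}" for n using orthonormal_or_zero_subset[OF e(1)] by blast
  have [measurable]: "x \<in> borel_measurable M" using gx by (simp add: centered_gaussian_def)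
  have g: "real_centered_gaussian M (\<lambda>\<omega>. inner (x \<omega>) (e k))" for k
  proof -
    have "real_centered_gaussian M (\<lambda>\<omega>. blinfun_apply (blinfun_inner_left (e k)) (x \<omega>))"
      using gx unfolding centered_gaussian_def by blast
    then show ?thesis by (simp add: inner_commute)
  qed
  have gi: "integrable M (\<lambda>\<omega>. (inner (x \<omega>) (e k))\<^sup>2)" for k
    using g by (rule real_centered_gaussian_integrable_power)
  have summ: "summable (\<lambda>k. \<integral>\<omega>. (inner (x \<omega>) (e k))\<^sup>2 \<partial>M)"
    by (rule gaussian_variances_summable[OF g, where f = "\<lambda>\<omega>. (norm (x \<omega>))\<^sup>2"])
       (auto intro: bessel_inequality[OF on])
  let ?h = "\<lambda>n \<omega>. partial_proj e {..<n} (x \<omega>)"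
  have hn: "(norm (?h n \<omega>))\<^sup>2 = (\<Sum>k<n. (inner (x \<omega>) (e k))\<^sup>2)" for n \<omega>
    by (rule norm_partial_proj[OF on]) simp
  show ?thesis
  proof (rule fatou_square(1))
    show "square_integrable M (?h n)" for n
      unfolding square_integrable_def hn using gi by (auto simp: partial_proj_def)
    show "AE \<omega> in M. (\<lambda>n. ?h n \<omega>) \<longlonglongrightarrow> x \<omega>"
    proof (rule AE_I2)
      fix \<omega>
      have "x \<omega> \<in> closure (span (range e))" using e(2) by auto
      from has_sum_imp_sums[OF orthonormal_expansion[OF e(1) this]]
      show "(\<lambda>n. ?h n \<omega>) \<longlonglongrightarrow> x \<omega>" by (simp add: sums_def partial_proj_def)
    qed
    show "\<forall>\<^sub>F n in sequentially. (\<integral>\<omega>. (norm (?h n \<omega>))\<^sup>2 \<partial>M) \<le> (\<Sum>k. \<integral>\<omega>. (inner (x \<omega>) (e k))\<^sup>2 \<partial>M)"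
      unfolding hn using gi summ by (intro always_eventually allI) (simp add: sum_le_suminf)
  qed simp
qed

lemma (in prob_space) correlation_operator_positive:
  fixes x :: "'a \<Rightarrow> 'h::{real_inner, banach, second_countable_topology}"
  assumes x: "square_integrable M x" and R: "correlation_operator M x R"
  shows "positive_operator R" "trace_le R (\<integral>\<omega>. (norm (x \<omega>))\<^sup>2 \<partial>M)"
proof -
  have [measurable]: "x \<in> borel_measurable M" using x by (rule square_integrable_measurable)
  have R': "inner (R h) k = (\<integral>\<omega>. inner (x \<omega>) h * inner (x \<omega>) k \<partial>M)" for h k
    using R by (simp add: correlation_operator_def)
  show "positive_operator R"
  proof (rule positive_operator.intro)
    show "inner (R h) k = inner h (R k)" for h k
      by (subst (2) inner_commute) (simp add: R' mult.commute)
    show "0 \<le> inner (R h) h" for h by (simp add: R')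
  qed
  show "trace_le R (\<integral>\<omega>. (norm (x \<omega>))\<^sup>2 \<partial>M)"
    unfolding trace_le_def
  proof (intro allI impI)
    fix e :: "nat \<Rightarrow> 'h" and F :: "nat set" assume F: "finite F" "orthonormal_or_zero e F"
    have int: "integrable M (\<lambda>\<omega>. (inner (x \<omega>) h)\<^sup>2)" for h
      using square_integrable_inner(1)[OF x] by (simp add: square_integrable_def)
    have "(\<Sum>i\<in>F. inner (R (e i)) (e i)) = (\<integral>\<omega>. (\<Sum>i\<in>F. (inner (x \<omega>) (e i))\<^sup>2) \<partial>M)"
      using int by (simp add: R' power2_eq_square)
    also have "\<dots> \<le> (\<integral>\<omega>. (norm (x \<omega>))\<^sup>2 \<partial>M)"
      using int x bessel_inequality[OF F(2,1)] by (intro integral_mono) (auto simp: square_integrable_def)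
    finally show "(\<Sum>i\<in>F. inner (R (e i)) (e i)) \<le> (\<integral>\<omega>. (norm (x \<omega>))\<^sup>2 \<partial>M)" .
  qed
qed

text \<open>\<open>\<phi>\<^sub>i = \<surd>(\<gamma> \<lambda>\<^sub>i) f\<^sub>i\<close> for the orthonormal eigenvectors \<open>f\<^sub>i\<close>.\<close>

lemma spectral_factorisation:
  fixes R :: "'h::{real_inner, banach, second_countable_topology} \<Rightarrow>\<^sub>L 'h"
  assumes "positive_operator R" "trace_le R \<tau>" "eigenvalue_sequence R lam" and \<gamma>: "0 < \<gamma>"
  obtains \<phi> where "orthogonal_family \<phi> (\<gamma> *\<^sub>R R)" "\<And>i. (norm (\<phi> i))\<^sup>2 = lam i * \<gamma>"
proof -
  note sp = spectral_decomposition[OF assms(1-3)]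
  obtain f where f: "orthonormal_or_zero f UNIV" "\<And>i. f i = 0 \<longleftrightarrow> lam i = 0"
    "\<And>h. (\<lambda>i. lam i *\<^sub>R inner (f i) h *\<^sub>R f i) sums R h"
    using sp(3) by blast
  define \<phi> where "\<phi> = (\<lambda>i. sqrt (lam i * \<gamma>) *\<^sub>R f i)"
  have nn: "0 \<le> lam i * \<gamma>" for i using sp(1) \<gamma> by simp
  have norm: "(norm (\<phi> i))\<^sup>2 = lam i * \<gamma>" for i
  proof (cases "lam i = 0")
    case False
    then have "norm (f i) = 1" using f(1,2) by (auto simp: orthonormal_or_zero_def)
    then show ?thesis using nn[of i] by (simp add: \<phi>_def power_mult_distrib)
  qed (simp add: \<phi>_def)
  have "orthogonal_family \<phi> (\<gamma> *\<^sub>R R)"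
  proof (rule orthogonal_family.intro)
    show "inner (\<phi> i) (\<phi> j) = 0" if "i \<noteq> j" for i j
      using f(1) that by (simp add: \<phi>_def orthonormal_or_zero_def)
    show "summable (\<lambda>i. (norm (\<phi> i))\<^sup>2)" unfolding norm using sp(2) by (rule summable_mult2)
    show "(\<lambda>i. inner (\<phi> i) h *\<^sub>R \<phi> i) sums (\<gamma> *\<^sub>R R) h" for h
    proof -
      have "inner (\<phi> i) h *\<^sub>R \<phi> i = \<gamma> *\<^sub>R (lam i *\<^sub>R inner (f i) h *\<^sub>R f i)" for i
      proof -
        have "inner (\<phi> i) h *\<^sub>R \<phi> i = (sqrt (lam i * \<gamma>) * sqrt (lam i * \<gamma>)) *\<^sub>R (inner (f i) h *\<^sub>R f i)"
          by (simp only: \<phi>_def inner_scaleR_left scaleR_scaleR mult_ac)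
        also have "sqrt (lam i * \<gamma>) * sqrt (lam i * \<gamma>) = lam i * \<gamma>" by (rule real_sqrt_mult_self[THEN trans]) (use nn in simp)
        finally show ?thesis by (simp add: mult_ac)
      qed
      then show ?thesis unfolding blinfun.scaleR_left using sums_scaleR_right[OF f(3)] by simp
    qed
  qed
  then show thesis using norm that by blast
qed

theorem theorem4p1:
  fixes M :: "'a measure"
    and \<iota> :: "'h::{real_inner, banach, second_countable_topology} \<Rightarrow>\<^sub>L 'w::banach"
    and w y :: "'a \<Rightarrow> 'w"
    and p :: "real \<Rightarrow> 'h \<Rightarrow>\<^sub>L 'h"
    and x :: "'a \<Rightarrow> 'h"
    and R :: "'h \<Rightarrow>\<^sub>L 'h"
    and lam :: "nat \<Rightarrow> real"
    and \<gamma> :: real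
  assumes "abstract_wiener_space M \<iota> w"
    and "projection_flow \<iota> p"
    and "\<gamma> > 0"
    and "independent_rv M x w"
    and "correlation_operator M x R"
    and "eigenvalue_sequence R lam"
    and y: "y = (\<lambda>\<omega>. sqrt \<gamma> *\<^sub>R blinfun_apply \<iota> (x \<omega>) + w \<omega>)"
  shows
    "(centered_gaussian M x \<longrightarrow>
        (\<forall>i. 0 \<le> lam i) \<and> summable lam \<and>
        summable (\<lambda>i. ln (1 + lam i * \<gamma>)) \<and>
        (\<exists>xh. is_causal_estimator M \<iota> p y x xh) \<and>
        (\<forall>xh. is_causal_estimator M \<iota> p y x xh \<longrightarrow>
           (\<integral>\<omega>. (norm (x \<omega> - xh \<omega>))\<^sup>2 \<partial>M) = (1 / \<gamma>) * (\<Sum>i. ln (1 + lam i * \<gamma>)) \<and>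
           (\<integral>\<omega>. (norm (x \<omega> - xh \<omega>))\<^sup>2 \<partial>M) = (1 / \<gamma>) * ln (fredholm_det_one_plus (\<gamma> *\<^sub>R R))))
     \<and>
     (square_integrable M x \<and> (\<integral>\<omega>. x \<omega> \<partial>M) = 0 \<longrightarrow>
        (\<forall>i. 0 \<le> lam i) \<and> summable lam \<and>
        summable (\<lambda>i. ln (1 + lam i * \<gamma>)) \<and>
        least_linear_causal_mse M \<iota> p y x = (1 / \<gamma>) * (\<Sum>i. ln (1 + lam i * \<gamma>)) \<and>
        least_linear_causal_mse M \<iota> p y x = (1 / \<gamma>) * ln (fredholm_det_one_plus (\<gamma> *\<^sub>R R)))"
proof -
  interpret W: abstract_wiener_space M \<iota> w by fact
  have core: "(\<forall>i. 0 \<le> lam i) \<and> summable lam \<and> summable (\<lambda>i. ln (1 + lam i * \<gamma>)) \<and>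
      (\<exists>\<phi>. signal_in_noise M \<iota> w p \<phi> (\<gamma> *\<^sub>R R) x y R \<gamma> \<and>
        orthogonal_family.log_det \<phi> = (\<Sum>i. ln (1 + lam i * \<gamma>)) \<and>
        orthogonal_family.log_det \<phi> = ln (fredholm_det_one_plus (\<gamma> *\<^sub>R R)))"
    if x: "square_integrable M x"
  proof -
    note pos = W.correlation_operator_positive[OF x assms(5)]
    obtain \<phi> where \<phi>: "orthogonal_family \<phi> (\<gamma> *\<^sub>R R)" "\<And>i. (norm (\<phi> i))\<^sup>2 = lam i * \<gamma>"
      using spectral_factorisation[OF pos assms(6,3)] by metis
    have "signal_in_noise M \<iota> w p \<phi> (\<gamma> *\<^sub>R R) x y R \<gamma>"
      by (intro signal_in_noise.intro nest_with_family.intro signal_in_noise_axioms.intro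
          projection_flow_continuous_nest[OF assms(2)] \<phi>(1) assms x refl)
    moreover have "summable (\<lambda>i. ln (1 + lam i * \<gamma>))"
      using orthogonal_family.summable_ln[OF \<phi>(1)] by (simp add: \<phi>(2))
    moreover have "orthogonal_family.log_det \<phi> = (\<Sum>i. ln (1 + lam i * \<gamma>))"
      by (simp add: orthogonal_family.log_det_def[OF \<phi>(1)] \<phi>(2))
    moreover have "orthogonal_family.log_det \<phi> = ln (fredholm_det_one_plus (\<gamma> *\<^sub>R R))"
      by (simp add: orthogonal_family.fredholm_det_eq[OF \<phi>(1)])
    ultimately show ?thesis
      using spectral_decomposition(1,2)[OF pos assms(6)] by blast
  qed
  show ?thesis
  proof (intro conjI impI)
    assume gx: "centered_gaussian M x"
    note c = core[OF W.gaussian_square_integrable[OF gx]]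
    from c obtain \<phi> where S: "signal_in_noise M \<iota> w p \<phi> (\<gamma> *\<^sub>R R) x y R \<gamma>"
      and t: "orthogonal_family.log_det \<phi> = (\<Sum>i. ln (1 + lam i * \<gamma>))"
        "orthogonal_family.log_det \<phi> = ln (fredholm_det_one_plus (\<gamma> *\<^sub>R R))" by blast
    show "\<forall>i. 0 \<le> lam i" "summable lam" "summable (\<lambda>i. ln (1 + lam i * \<gamma>))" using c by blast+
    show "\<exists>xh. is_causal_estimator M \<iota> p y x xh" by (rule signal_in_noise.causal_estimator_exists[OF S])
    show "\<forall>xh. is_causal_estimator M \<iota> p y x xh \<longrightarrow>
           (\<integral>\<omega>. (norm (x \<omega> - xh \<omega>))\<^sup>2 \<partial>M) = (1 / \<gamma>) * (\<Sum>i. ln (1 + lam i * \<gamma>)) \<and>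
           (\<integral>\<omega>. (norm (x \<omega> - xh \<omega>))\<^sup>2 \<partial>M) = (1 / \<gamma>) * ln (fredholm_det_one_plus (\<gamma> *\<^sub>R R))"
      using signal_in_noise.causal_estimator_error[OF S gx] t by simp
  next
    assume "square_integrable M x \<and> (\<integral>\<omega>. x \<omega> \<partial>M) = 0"
    then have xs: "square_integrable M x" by blast
    note c = core[OF xs]
    from c obtain \<phi> where S: "signal_in_noise M \<iota> w p \<phi> (\<gamma> *\<^sub>R R) x y R \<gamma>"
      and t: "orthogonal_family.log_det \<phi> = (\<Sum>i. ln (1 + lam i * \<gamma>))"
        "orthogonal_family.log_det \<phi> = ln (fredholm_det_one_plus (\<gamma> *\<^sub>R R))" by blast
    show "\<forall>i. 0 \<le> lam i" "summable lam" "summable (\<lambda>i. ln (1 + lam i * \<gamma>))" using c by blast+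
    show "least_linear_causal_mse M \<iota> p y x = (1 / \<gamma>) * (\<Sum>i. ln (1 + lam i * \<gamma>))"
      "least_linear_causal_mse M \<iota> p y x = (1 / \<gamma>) * ln (fredholm_det_one_plus (\<gamma> *\<^sub>R R))"
      using signal_in_noise.least_linear_causal_mse_eq[OF S] t by simp_all
  qed
qed

end
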